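(* Let $N\ge 1$, let $\phi:\mathbb{P}^N\to\mathbb{P}^N$ be a morphism defined over $\mathbb{Q}$ of degree $d\ge 2$, and let $D$ be an effective divisor on $\mathbb{P}^N$ defined over $\mathbb{Q}$. For $n\ge 0$ let $D^{(n)}_{\mathrm{nc}}$ be a normal-crossings part of $D^{(n)}=(\phi^{(n)})^*D$. Suppose that $\deg D^{(n)}_{\mathrm{nc}}>N+1$ for some $n$, and assume that Vojta's conjecture on $\mathbb{P}^N$ holds for the divisor $D^{(n)}_{\mathrm{nc}}$. Then for any $P\in\mathbb{P}^N(\mathbb{Q})$, the set $\mathcal{O}_\phi(P)\cap(\mathbb{P}^N\setminus D)(\mathbb{Z})$ is not Zariski-dense in $\mathbb{P}^N$.
   Context: Iterates and orbits: $\phi^{(m)}$ is the $m$-fold composition of $\phi$ with itself ($\phi^{(0)}=\mathrm{id}$), and $\mathcal{O}_\phi(P)=\{\phi^{(m)}(P):m=0,1,2,\ldots\}$. The degree of $\phi$ is the common degree of the homogeneous polynomials (without common factor) defining it. Heights: For a number field $k$, $M_k$ is the set of its places; for $v\in M_k$, $|\cdot|_v$ is the $\frac{[k_v:\mathbb{Q}_v]}{[k:\mathbb{Q}]}$-th power of the extension of the normalized absolute value on $\mathbb{Q}$, and $v(x)=-\log|x|_v$ (with $v(0)=+\infty$). The Weil height is $h([x_0:\cdots:x_N])=\sum_{v\in M_k}\log\max_i|x_i|_v$. If an effective divisor $D$ on $\mathbb{P}^N$ defined over $k$ is given by a homogeneous polynomial $F$ with coefficients in the ring of integers of $k$ (fix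 one choice of $F$), the local height is $\lambda_v(D,[x_0:\cdots:x_N])=v(F(x_0,\ldots,x_N))-\deg(D)\min_i v(x_i)$ (equal to $+\infty$ on $|D|$). Integral points: for a finite set $S\subset M_k$ containing all archimedean places, with ring of $S$-integers $R_S$, $(\mathbb{P}^N\setminus D)(R_S)$ denotes any $(S,D)$-integral set, i.e. any set of the form $\{P\in(\mathbb{P}^N\setminus D)(k):\lambda_v(D,P)\le c_v\text{ for all }v\notin S\}$ with constants $c_v$, almost all equal to $0$. $(\mathbb{P}^N\setminus D)(\mathbb{Z})$ is the case $k=\mathbb{Q}$, $S=\{v_\infty\}$. (For $D=(X_N=0)$ and all $c_v=0$ these are the points $[a_0:\cdots:a_N]$, $a_i\in\mathbb{Z}$ with $\gcd$ $1$, with $a_N=\pm1$.) Normal crossings: a divisor is normal-crossings if near each point it is defined by $x_1\cdots x_k=0$ where $x_1,\ldots,x_k$ is part of a local (analytic) coordinate system; in particular each irreducible component has multiplicity $1$. A normal-crossings part $E_{\mathrm{nc}}$ of an effective divisor $E$ is a normal-crossings subdivisor of $E$ over $\overline{\mathbb{Q}}$ (i.e. $E-E_{\mathrm{nc}}$ effective) of highest possible degree; fix one if there are several. Vojta's conjecture on $\mathbb{P}^N$ for a normal-crossings divisor $E$: for every number field $k$ over which $E$ is defined, every finite set $S\subset M_k$ and every $\epsilon>0$, there exist a finite union $Z_\epsilon$ of hypersurfaces and a constant $C$ such that $\sum_{v\in S}\lambda_v(E,P)<(N+1+\epsilon)h(P)+C$ for all $P\in\mathbb{P}^N(k)\setminus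 Z_\epsilon$. *)

theory Defs
  imports
    "HOL-Analysis.Analysis"
    "HOL-Algebra.Algebraic_Closure_Type"
    "HOL-Library.Poly_Mapping"
begin

unbundle no fps_syntax

section \<open>Polynomials in the homogeneous coordinates\<close>

text \<open>
  \<open>\<P>\<^sup>N\<close> has homogeneous coordinates indexed by a finite type \<open>'n\<close> with \<open>CARD('n) = N + 1\<close>.  All
  geometry takes place over the complex numbers; number fields and the field of algebraic numbers
  are subfields of the complex numbers.
\<close>

type_synonym 'n mpoly = "('n \<Rightarrow>\<^sub>0 nat) \<Rightarrow>\<^sub>0 complex"

definition mp_const :: "complex \<Rightarrow> 'n mpoly" where
  "mp_const a = Poly_Mapping.single 0 a"

definition mp_var :: "'n \<Rightarrow> 'n mpoly" where
  "mp_var i = Poly_Mapping.single (Poly_Mapping.single i 1) 1"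

definition mp_eval :: "'n::finite mpoly \<Rightarrow> complex ^ 'n \<Rightarrow> complex" where
  "mp_eval F x =
     (\<Sum>m\<in>Poly_Mapping.keys F. Poly_Mapping.lookup F m * (\<Prod>i\<in>UNIV. (x $ i) ^ Poly_Mapping.lookup m i))"

definition mp_subst :: "('n::finite \<Rightarrow> 'n mpoly) \<Rightarrow> 'n mpoly \<Rightarrow> 'n mpoly" where
  "mp_subst \<sigma> F =
     (\<Sum>m\<in>Poly_Mapping.keys F.
        mp_const (Poly_Mapping.lookup F m) * (\<Prod>i\<in>UNIV. \<sigma> i ^ Poly_Mapping.lookup m i))"

definition mon_degree :: "('n::finite \<Rightarrow>\<^sub>0 nat) \<Rightarrow> nat" where
  "mon_degree m = (\<Sum>i\<in>UNIV. Poly_Mapping.lookup m i)"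

definition homogeneous :: "nat \<Rightarrow> 'n::finite mpoly \<Rightarrow> bool" where
  "homogeneous d F \<longleftrightarrow> (\<forall>m\<in>Poly_Mapping.keys F. mon_degree m = d)"

definition mp_degree :: "'n::finite mpoly \<Rightarrow> nat" where
  "mp_degree F = Max (mon_degree ` Poly_Mapping.keys F)"

definition coeffs_in :: "complex set \<Rightarrow> 'n mpoly \<Rightarrow> bool" where
  "coeffs_in A F \<longleftrightarrow> (\<forall>m. Poly_Mapping.lookup F m \<in> A)"


section \<open>Projective space and its Zariski topology\<close>

definition proj_point :: "complex ^ 'n \<Rightarrow> (complex ^ 'n) set" where
  "proj_point x = {c *s x | c. c \<noteq> 0}"

definition proj_space :: "(complex ^ 'n) set set" where
  "proj_space = {proj_point x | x. x \<noteq> 0}"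

definition coord_vectors :: "complex set \<Rightarrow> (complex ^ 'n) set" where
  "coord_vectors k = {x. x \<noteq> 0 \<and> (\<forall>i. x $ i \<in> k)}"

definition points_over :: "complex set \<Rightarrow> (complex ^ 'n) set set" where
  "points_over k = proj_point ` coord_vectors k"

definition vanishes_at :: "'n::finite mpoly \<Rightarrow> (complex ^ 'n) set \<Rightarrow> bool" where
  "vanishes_at H P \<longleftrightarrow> (\<forall>x\<in>P. mp_eval H x = 0)"

definition zariski_closed :: "(complex ^ 'n::finite) set set \<Rightarrow> bool" where
  "zariski_closed Z \<longleftrightarrow>
     (\<exists>\<H>. (\<forall>H\<in>\<H>. \<exists>e. homogeneous e H) \<and> Z = {P \<in> proj_space. \<forall>H\<in>\<H>. vanishes_at H P})"

definition zariski_dense :: "(complex ^ 'n::finite) set set \<Rightarrow> bool" where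
  "zariski_dense T \<longleftrightarrow> (\<forall>Z. zariski_closed Z \<and> T \<subseteq> Z \<longrightarrow> Z = proj_space)"

definition hypersurface :: "(complex ^ 'n::finite) set set \<Rightarrow> bool" where
  "hypersurface Z \<longleftrightarrow>
     (\<exists>H e. H \<noteq> 0 \<and> homogeneous e H \<and> e > 0 \<and> Z = {P \<in> proj_space. vanishes_at H P})"


section \<open>Endomorphisms and orbits\<close>

definition is_endomorphism :: "nat \<Rightarrow> ('n::finite \<Rightarrow> 'n mpoly) \<Rightarrow> bool" where
  "is_endomorphism d \<phi> \<longleftrightarrow>
     (\<forall>i. homogeneous d (\<phi> i)) \<and> (\<forall>x. (\<forall>i. mp_eval (\<phi> i) x = 0) \<longrightarrow> x = 0)"

definition endo_map ::
    "('n::finite \<Rightarrow> 'n mpoly) \<Rightarrow> (complex ^ 'n) set \<Rightarrow> (complex ^ 'n) set" where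
  "endo_map \<phi> P = (\<Union>x\<in>P. proj_point (\<chi> i. mp_eval (\<phi> i) x))"

definition forward_orbit :: "('n::finite \<Rightarrow> 'n mpoly) \<Rightarrow> (complex ^ 'n) set \<Rightarrow> (complex ^ 'n) set set" where
  "forward_orbit \<phi> P = {(endo_map \<phi> ^^ m) P | m. True}"

fun endo_iter :: "('n::finite \<Rightarrow> 'n mpoly) \<Rightarrow> nat \<Rightarrow> 'n \<Rightarrow> 'n mpoly" where
  "endo_iter \<phi> 0 = mp_var"
| "endo_iter \<phi> (Suc m) = (\<lambda>i. mp_subst (endo_iter \<phi> m) (\<phi> i))"


section \<open>Effective divisors\<close>

text \<open>
  An effective divisor on \<open>\<P>\<^sup>N\<close> is represented by an equation, a nonzero homogeneous polynomial;
  two equations define the same divisor iff they are proportional, the degree of the divisor is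
  that of the equation, a difference \<open>E - E'\<close> is effective iff the equation of \<open>E'\<close> divides that of
  \<open>E\<close>, and the pullback of \<open>E\<close> by an endomorphism is \<^const>\<open>mp_subst\<close>.
\<close>

definition divisor_equation :: "'n::finite mpoly \<Rightarrow> bool" where
  "divisor_equation F \<longleftrightarrow> F \<noteq> 0 \<and> (\<exists>e. homogeneous e F)"

definition same_divisor :: "'n::finite mpoly \<Rightarrow> 'n mpoly \<Rightarrow> bool" where
  "same_divisor F G \<longleftrightarrow> (\<exists>c. c \<noteq> 0 \<and> G = mp_const c * F)"

definition defined_over :: "complex set \<Rightarrow> 'n::finite mpoly \<Rightarrow> bool" where
  "defined_over k F \<longleftrightarrow> (\<exists>G. same_divisor F G \<and> coeffs_in k G)"

definition cholomorphic_on :: "(complex ^ 'n::finite \<Rightarrow> complex) \<Rightarrow> (complex ^ 'n) set \<Rightarrow> bool" where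
  "cholomorphic_on f U \<longleftrightarrow>
     (\<forall>z\<in>U. \<exists>f'. (f has_derivative f') (at z) \<and> (\<forall>c w. f' (c *s w) = c * f' w))"

text \<open>
  Analytic coordinates on the affine chart \<open>{z. z $ j = 1}\<close> near its point \<open>p\<close>: the chart is an affine
  hyperplane of \<open>complex ^ 'n\<close>, and a biholomorphic map between open sets of \<open>complex ^ 'n\<close> that
  preserves the \<open>j\<close>-th coordinate restricts to a biholomorphic map between open sets of the chart.
  The \<open>N\<close> functions \<open>\<lambda>z. \<psi> z $ i\<close> with \<open>i \<noteq> j\<close> are then local coordinates of the chart centred at \<open>p\<close>,
  and every system of local coordinates arises in this way after shrinking its domain, by
  extending \<open>x\<^sub>i\<close> to \<open>\<lambda>z. x\<^sub>i (z / z $ j)\<close>.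
\<close>

definition local_coordinates ::
    "'n::finite \<Rightarrow> complex ^ 'n \<Rightarrow> (complex ^ 'n) set \<Rightarrow> (complex ^ 'n \<Rightarrow> complex ^ 'n) \<Rightarrow> bool" where
  "local_coordinates j p U \<psi> \<longleftrightarrow>
     open U \<and> p \<in> U \<and> inj_on \<psi> U \<and> open (\<psi> ` U) \<and>
     (\<forall>i. cholomorphic_on (\<lambda>z. \<psi> z $ i) U) \<and>
     (\<forall>i. cholomorphic_on (\<lambda>w. inv_into U \<psi> w $ i) (\<psi> ` U)) \<and>
     (\<forall>z\<in>U. \<psi> z $ j = z $ j) \<and> (\<forall>i. i \<noteq> j \<longrightarrow> \<psi> p $ i = 0)"

definition normal_crossings :: "'n::finite mpoly \<Rightarrow> bool" where
  "normal_crossings F \<longleftrightarrow>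
     (\<forall>j p. p $ j = 1 \<longrightarrow>
        (\<exists>U \<psi> u I. local_coordinates j p U \<psi> \<and> j \<notin> I \<and>
           cholomorphic_on u U \<and> (\<forall>z\<in>U. u z \<noteq> 0) \<and>
           (\<forall>z\<in>U. z $ j = 1 \<longrightarrow> mp_eval F z = u z * (\<Prod>i\<in>I. \<psi> z $ i))))"

definition nc_subdivisor :: "'n::finite mpoly \<Rightarrow> 'n mpoly \<Rightarrow> bool" where
  "nc_subdivisor E G \<longleftrightarrow>
     divisor_equation G \<and> defined_over {a. Polynomial.algebraic a} G \<and> normal_crossings G \<and> G dvd E"

definition nc_part :: "'n::finite mpoly \<Rightarrow> 'n mpoly \<Rightarrow> bool" where
  "nc_part E G \<longleftrightarrow>
     nc_subdivisor E G \<and> (\<forall>G'. nc_subdivisor E G' \<longrightarrow> mp_degree G' \<le> mp_degree G)"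


section \<open>Number fields and their places\<close>

definition complex_ring :: "complex ring" where
  "complex_ring = ring_of_type_algebra"

definition number_field :: "complex set \<Rightarrow> bool" where
  "number_field k \<longleftrightarrow> subfield k complex_ring \<and> ring.finite_dimension complex_ring \<rat> k"

definition field_degree :: "complex set \<Rightarrow> nat" where
  "field_degree k = ring.dim complex_ring \<rat> k"

definition ring_of_integers :: "complex set \<Rightarrow> complex set" where
  "ring_of_integers k = {a \<in> k. algebraic_int a}"

definition padic_abs :: "nat \<Rightarrow> rat \<Rightarrow> real" where
  "padic_abs p q =
     (if q = 0 then 0
      else real p powi (int (Factorial_Ring.multiplicity (int p) (snd (quotient_of q)))
                        - int (Factorial_Ring.multiplicity (int p) (fst (quotient_of q)))))"

definition absolute_value_on :: "complex set \<Rightarrow> (complex \<Rightarrow> real) \<Rightarrow> bool" where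
  "absolute_value_on k v \<longleftrightarrow>
     (\<forall>x\<in>k. v x \<ge> 0 \<and> (v x = 0 \<longleftrightarrow> x = 0)) \<and>
     (\<forall>x\<in>k. \<forall>y\<in>k. v (x * y) = v x * v y \<and> v (x + y) \<le> v x + v y)"

text \<open>
  A place is identified with the unique absolute value in its class that extends one of the
  normalized absolute values of the rational numbers, continued by \<open>0\<close> outside the field.
\<close>

definition arch_places :: "complex set \<Rightarrow> (complex \<Rightarrow> real) set" where
  "arch_places k =
     {v. absolute_value_on k v \<and> (\<forall>x. x \<notin> k \<longrightarrow> v x = 0) \<and>
         (\<forall>q::rat. v (of_rat q) = \<bar>of_rat q\<bar>)}"

definition nonarch_places :: "complex set \<Rightarrow> (complex \<Rightarrow> real) set" where
  "nonarch_places k =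
     {v. absolute_value_on k v \<and> (\<forall>x. x \<notin> k \<longrightarrow> v x = 0) \<and>
         (\<exists>p. Factorial_Ring.prime p \<and> (\<forall>q. v (of_rat q) = padic_abs p q))}"

definition places :: "complex set \<Rightarrow> (complex \<Rightarrow> real) set" where
  "places k = arch_places k \<union> nonarch_places k"

text \<open>
  The completion \<open>k\<^sub>v\<close> consists of the Cauchy sequences modulo the null sequences; inside it,
  \<open>\<rat>\<^sub>v\<close> consists of the classes of rational Cauchy sequences.
\<close>

definition cauchy_ring :: "complex set \<Rightarrow> (complex \<Rightarrow> real) \<Rightarrow> (nat \<Rightarrow> complex) ring" where
  "cauchy_ring k v =
     \<lparr>carrier = {s. (\<forall>n. s n \<in> k) \<and> (\<forall>e>0. \<exists>M. \<forall>m\<ge>M. \<forall>n\<ge>M. v (s m - s n) < e)},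
      monoid.mult = (\<lambda>s t n. s n * t n), one = (\<lambda>_. 1),
      ring.zero = (\<lambda>_. 0), add = (\<lambda>s t n. s n + t n)\<rparr>"

definition null_sequences :: "complex set \<Rightarrow> (complex \<Rightarrow> real) \<Rightarrow> (nat \<Rightarrow> complex) set" where
  "null_sequences k v = {s \<in> carrier (cauchy_ring k v). (\<lambda>n. v (s n)) \<longlonglongrightarrow> 0}"

definition completion :: "complex set \<Rightarrow> (complex \<Rightarrow> real) \<Rightarrow> (nat \<Rightarrow> complex) set ring" where
  "completion k v = cauchy_ring k v Quot null_sequences k v"

definition rational_completion ::
    "complex set \<Rightarrow> (complex \<Rightarrow> real) \<Rightarrow> (nat \<Rightarrow> complex) set set" where
  "rational_completion k v =
     {null_sequences k v +>\<^bsub>cauchy_ring k v\<^esub> s | s.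
        s \<in> carrier (cauchy_ring k v) \<and> (\<forall>n. s n \<in> \<rat>)}"

definition local_degree :: "complex set \<Rightarrow> (complex \<Rightarrow> real) \<Rightarrow> nat" where
  "local_degree k v =
     ring.dim (completion k v) (rational_completion k v) (carrier (completion k v))"

definition norm_abs :: "complex set \<Rightarrow> (complex \<Rightarrow> real) \<Rightarrow> complex \<Rightarrow> real" where
  "norm_abs k v x = v x powr (real (local_degree k v) / real (field_degree k))"

definition val :: "complex set \<Rightarrow> (complex \<Rightarrow> real) \<Rightarrow> complex \<Rightarrow> ereal" where
  "val k v x = (if x = 0 then \<infinity> else ereal (- ln (norm_abs k v x)))"


section \<open>Heights and integral points\<close>

text \<open>
  Heights are functions of homogeneous coordinates in \<open>coord_vectors k\<close>; their values do not change
  when the coordinates are multiplied by a nonzero element of \<open>k\<close>.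
  The sum over all places has only finitely many nonzero terms.
\<close>

definition weil_height :: "complex set \<Rightarrow> complex ^ 'n::finite \<Rightarrow> real" where
  "weil_height k x = (\<Sum>\<^sub>\<infinity>v\<in>places k. ln (Max (range (\<lambda>i. norm_abs k v (x $ i)))))"

definition local_height ::
    "complex set \<Rightarrow> (complex \<Rightarrow> real) \<Rightarrow> 'n::finite mpoly \<Rightarrow> complex ^ 'n \<Rightarrow> ereal" where
  "local_height k v F x =
     val k v (mp_eval F x) - ereal (real (mp_degree F)) * Min (range (\<lambda>i. val k v (x $ i)))"

definition integral_set ::
    "complex set \<Rightarrow> (complex \<Rightarrow> real) set \<Rightarrow> 'n::finite mpoly \<Rightarrow> (complex ^ 'n) set set \<Rightarrow> bool" where
  "integral_set k S F T \<longleftrightarrow>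
     (\<exists>c :: (complex \<Rightarrow> real) \<Rightarrow> real.
        finite {v \<in> places k - S. c v \<noteq> 0} \<and>
        T = {proj_point x | x. x \<in> coord_vectors k \<and> mp_eval F x \<noteq> 0 \<and>
               (\<forall>v\<in>places k - S. local_height k v F x \<le> ereal (c v))})"

text \<open>
  Vojta's conjecture on \<open>\<P>\<^sup>N\<close>, where \<open>CARD('n) = N + 1\<close>, for the divisor with equation \<open>E\<close>.  The local
  heights over \<open>k\<close> are those of one equation \<open>G\<close> of the divisor with integral coefficients; which
  one is immaterial, since another choice changes each local height by a constant.
\<close>

definition vojta_conjecture :: "'n::finite mpoly \<Rightarrow> bool" where
  "vojta_conjecture E \<longleftrightarrow>
     (\<forall>k. number_field k \<and> defined_over k E \<longrightarrow>
       (\<exists>G. same_divisor E G \<and> coeffs_in (ring_of_integers k) G \<and>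
         (\<forall>S \<epsilon>. finite S \<and> S \<subseteq> places k \<and> \<epsilon> > 0 \<longrightarrow>
           (\<exists>\<Z> C. finite \<Z> \<and> (\<forall>Z\<in>\<Z>. hypersurface Z) \<and>
             (\<forall>x\<in>coord_vectors k. proj_point x \<notin> \<Union>\<Z> \<longrightarrow>
               (\<Sum>v\<in>S. local_height k v G x)
                 < ereal ((real CARD('n) + \<epsilon>) * weil_height k x + C))))))"

end

theory Submission
  imports Defs
begin

text \<open>
  If \<open>\<phi>\<^sup>m(P)\<close> is integral and \<open>m \<ge> n\<close>, put \<open>Q = \<phi>\<^sup>m\<^sup>-\<^sup>n(P)\<close>, with coprime integral coordinates \<open>x\<close>.  As \<open>\<phi>\<close> is a
  morphism, the coordinates of \<open>\<phi>\<^sup>n(x)\<close> have a bounded common factor, so \<open>F(\<phi>\<^sup>n(x))\<close> is bounded.  An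
  equation \<open>G\<close> of the normal-crossings part divides \<open>F \<circ> \<phi>\<^sup>n\<close>, and the norm of the cofactor is bounded
  below at integral points; hence the archimedean local heights of \<open>G\<close> add up to \<open>deg G h(Q)\<close> minus a
  bounded quantity.  Since \<open>deg G \<ge> N + 2\<close>, Vojta's inequality with \<open>\<epsilon> = 1/2\<close> bounds \<open>h(Q)\<close> outside a
  finite union \<open>Z\<close> of hypersurfaces, and \<open>\<phi>\<^sup>n(Z)\<close> lies in a hypersurface by a dimension count.

  The normal-crossings part need not be defined over the rationals.  Vojta's conjecture is applied over
  a field \<open>k = \<rat>(\<theta>)\<close> that contains \<open>\<i>\<close>, so that all archimedean places of \<open>k\<close> are complex, have local
  degree 2, and correspond to the roots of the minimal polynomial of \<open>\<theta>\<close> up to conjugation.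
\<close>

section \<open>Polynomial evaluation\<close>

text \<open>Existence arguments (the Nullstellensatz, the cofactor of \<open>G\<close>, Bezout
  identities, products over conjugates) produce complex coefficients without arithmetic control,
  whereas the estimates need rational or integral ones. The device used each time is
  \<open>linear_relations_descend\<close>: a \<open>k\<close>-linear functional that fixes 1
  replaces the coefficients by elements of \<open>k\<close> and preserves every linear relation
  whose other data lie in \<open>k\<close>, in particular the identities at integral points. The
  lower bound for the norm of the cofactor takes the place of a product formula. Finite places
  therefore enter only through coprimality and through the definition of integral points; the places
  of \<open>k\<close> above a prime are never classified. The Gaussian rationals are dense in the
  complex numbers and carry a single archimedean absolute value. This is why \<i> is adjoined: the
  archimedean places of \<open>k\<close> can be found by approximation, and every archimedean
  completion is the field of complex numbers. What Vojta's inequality leaves over is finite, namely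
  the orbit points with \<open>m < n\<close> and those with \<open>Q\<close> of bounded height;
  linear forms through them complete the equation of a hypersurface containing all integral orbit
  points.\<close>

abbreviation mon_val :: "complex ^ 'n \<Rightarrow> ('n::finite \<Rightarrow>\<^sub>0 nat) \<Rightarrow> complex" where
  "mon_val x m \<equiv> \<Prod>i\<in>UNIV. (x $ i) ^ Poly_Mapping.lookup m i"

lemma mp_eval_superset:
  assumes "finite M" "Poly_Mapping.keys F \<subseteq> M"
  shows "mp_eval F x = (\<Sum>m\<in>M. Poly_Mapping.lookup F m * mon_val x m)"
  unfolding mp_eval_def
  by (rule sum.mono_neutral_left) (use assms in \<open>auto simp: in_keys_iff\<close>)

lemma mp_eval_zero [simp]: "mp_eval 0 x = 0"
  by (simp add: mp_eval_def)

lemma mp_eval_add: "mp_eval (F + G) x = mp_eval F x + mp_eval G x"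
proof -
  let ?M = "Poly_Mapping.keys F \<union> Poly_Mapping.keys G"
  have "mp_eval (F + G) x = (\<Sum>m\<in>?M. Poly_Mapping.lookup (F + G) m * mon_val x m)"
    by (rule mp_eval_superset) (auto simp: keys_add)
  also have "\<dots> = mp_eval F x + mp_eval G x"
    by (simp add: mp_eval_superset[of ?M] lookup_add algebra_simps sum.distrib)
  finally show ?thesis .
qed

lemma mp_eval_sum: "mp_eval (\<Sum>a\<in>A. f a) x = (\<Sum>a\<in>A. mp_eval (f a) x)"
  by (induction A rule: infinite_finite_induct) (auto simp: mp_eval_add)

lemma mp_eval_single [simp]: "mp_eval (Poly_Mapping.single m a) x = a * mon_val x m"
  by (subst mp_eval_superset[of "{m}"]) auto

lemma mp_eval_uminus: "mp_eval (- F) x = - mp_eval F x"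
  using mp_eval_add[of F "- F" x] by (simp add: add_eq_0_iff)

lemma mp_eval_diff: "mp_eval (F - G) x = mp_eval F x - mp_eval G x"
  using mp_eval_add[of F "- G" x] by (simp add: mp_eval_uminus)

lemma keys_nonempty: "F \<noteq> 0 \<Longrightarrow> Poly_Mapping.keys F \<noteq> {}"
  by (metis ex_in_conv in_keys_iff lookup_zero poly_mapping_eqI)

lemma mpoly_eq_sum_single:
  "F = (\<Sum>m\<in>Poly_Mapping.keys F. Poly_Mapping.single m (Poly_Mapping.lookup F m))"
proof (rule poly_mapping_eqI)
  fix k
  have "(\<Sum>m\<in>Poly_Mapping.keys F. if m = k then Poly_Mapping.lookup F m else 0) = Poly_Mapping.lookup F k"
    by (subst sum.delta) (auto simp: in_keys_iff)
  then show "Poly_Mapping.lookup F k =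
      Poly_Mapping.lookup (\<Sum>m\<in>Poly_Mapping.keys F. Poly_Mapping.single m (Poly_Mapping.lookup F m)) k"
    by (simp add: lookup_sum lookup_single when_def)
qed

lemma mon_val_add: "mon_val x (m + m') = mon_val x m * mon_val x m'"
  by (simp add: lookup_add power_add prod.distrib)

lemma mp_eval_mult: "mp_eval (F * G) x = mp_eval F x * mp_eval G x"
proof -
  have "F * G = (\<Sum>m\<in>Poly_Mapping.keys F. \<Sum>m'\<in>Poly_Mapping.keys G.
      Poly_Mapping.single (m + m') (Poly_Mapping.lookup F m * Poly_Mapping.lookup G m'))"
  proof -
    have "F * G = (\<Sum>m\<in>Poly_Mapping.keys F. Poly_Mapping.single m (Poly_Mapping.lookup F m)) *
        (\<Sum>m\<in>Poly_Mapping.keys G. Poly_Mapping.single m (Poly_Mapping.lookup G m))"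
      by (simp flip: mpoly_eq_sum_single)
    then show ?thesis by (simp only: sum_product mult_single)
  qed
  then show ?thesis
    by (simp only: mp_eval_sum mp_eval_single mon_val_add)
       (simp add: mp_eval_def sum_product mult_ac)
qed

lemma mp_eval_const [simp]: "mp_eval (mp_const a) x = a"
  by (simp add: mp_const_def)

lemma mp_eval_one [simp]: "mp_eval 1 x = 1"
  using mp_eval_single[of 0 1 x] by simp

lemma mp_eval_var [simp]: "mp_eval (mp_var i) x = x $ i"
proof -
  have "mon_val x (Poly_Mapping.single i 1) = (\<Prod>j\<in>UNIV. if j = i then x $ j else 1)"
    by (rule prod.cong) (auto simp: lookup_single when_def)
  then show ?thesis by (simp add: mp_var_def)
qed

lemma mp_eval_power: "mp_eval (F ^ e) x = mp_eval F x ^ e"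
  by (induction e) (auto simp: mp_eval_mult)

lemma mp_eval_prod: "mp_eval (\<Prod>a\<in>A. f a) x = (\<Prod>a\<in>A. mp_eval (f a) x)"
  by (induction A rule: infinite_finite_induct) (auto simp: mp_eval_mult)

lemma mp_eval_subst: "mp_eval (mp_subst \<sigma> F) x = mp_eval F (\<chi> i. mp_eval (\<sigma> i) x)"
  by (simp add: mp_subst_def mp_eval_sum mp_eval_mult mp_eval_prod mp_eval_power mp_eval_def[of F])

lemma mp_const_0 [simp]: "mp_const 0 = 0"
  and mp_const_1 [simp]: "mp_const 1 = 1"
  by (simp_all add: mp_const_def)

lemma mp_const_add: "mp_const (a + b) = mp_const a + mp_const b"
  by (simp add: mp_const_def single_add)

lemma mp_const_mult: "mp_const (a * b) = mp_const a * mp_const b"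
  by (simp add: mp_const_def mult_single)

lemma mp_const_sum: "mp_const (\<Sum>a\<in>A. f a) = (\<Sum>a\<in>A. mp_const (f a))"
  by (induction A rule: infinite_finite_induct) (auto simp: mp_const_add)

lemma lookup_mp_const_mult: "Poly_Mapping.lookup (mp_const c * F) m = c * Poly_Mapping.lookup F m"
proof -
  have "mp_const c * F = (\<Sum>m\<in>Poly_Mapping.keys F. Poly_Mapping.single m (c * Poly_Mapping.lookup F m))"
  proof -
    have "mp_const c * F = mp_const c * (\<Sum>m\<in>Poly_Mapping.keys F. Poly_Mapping.single m (Poly_Mapping.lookup F m))"
      by (simp flip: mpoly_eq_sum_single)
    then show ?thesis by (simp add: mp_const_def sum_distrib_left mult_single)
  qed
  then have "Poly_Mapping.lookup (mp_const c * F) m =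
      (\<Sum>m'\<in>Poly_Mapping.keys F. if m' = m then c * Poly_Mapping.lookup F m' else 0)"
    by (simp add: lookup_sum lookup_single when_def)
  also have "\<dots> = c * Poly_Mapping.lookup F m"
    by (subst sum.delta) (auto simp: in_keys_iff)
  finally show ?thesis .
qed

lemma keys_mp_const_mult: "c \<noteq> 0 \<Longrightarrow> Poly_Mapping.keys (mp_const c * F) = Poly_Mapping.keys F"
  by (auto simp: in_keys_iff lookup_mp_const_mult)

lemma single_eq_prod_var:
  fixes m :: "'n::finite \<Rightarrow>\<^sub>0 nat"
  shows "Poly_Mapping.single m a = mp_const a * (\<Prod>i\<in>UNIV. mp_var i ^ Poly_Mapping.lookup m i)"
proof -
  have pow: "(mp_var i :: 'n mpoly) ^ e = Poly_Mapping.single (Poly_Mapping.single i e) 1" for i e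
    by (induction e) (auto simp: mp_var_def mult_single single_add [symmetric])
  have "(\<Prod>i\<in>A. Poly_Mapping.single (Poly_Mapping.single i (Poly_Mapping.lookup m i)) (1::complex)) =
      Poly_Mapping.single (\<Sum>i\<in>A. Poly_Mapping.single i (Poly_Mapping.lookup m i)) 1" for A
    by (induction A rule: infinite_finite_induct) (auto simp: mult_single)
  moreover have "(\<Sum>i\<in>UNIV. Poly_Mapping.single i (Poly_Mapping.lookup m i)) = m"
    by (rule poly_mapping_eqI) (simp add: lookup_sum lookup_single when_def)
  ultimately show ?thesis by (simp add: pow mp_const_def mult_single)
qed

lemma mpoly_eq_sum_vars:
  fixes F :: "'n::finite mpoly"
  shows "F = (\<Sum>m\<in>Poly_Mapping.keys F. mp_const (Poly_Mapping.lookup F m) * (\<Prod>i\<in>UNIV. mp_var i ^ Poly_Mapping.lookup m i))"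
  by (simp only: single_eq_prod_var [symmetric]) (rule mpoly_eq_sum_single)


section \<open>Homogeneous polynomials\<close>

lemma mon_degree_add: "mon_degree (m + m') = mon_degree m + mon_degree m'"
  by (simp add: mon_degree_def lookup_add sum.distrib)

lemma mon_degree_single [simp]: "mon_degree (Poly_Mapping.single i e) = e"
  by (simp add: mon_degree_def lookup_single when_def)

lemma homogeneous_zero [simp]: "homogeneous e 0"
  by (simp add: homogeneous_def)

lemma homogeneous_add: "homogeneous e F \<Longrightarrow> homogeneous e G \<Longrightarrow> homogeneous e (F + G)"
  unfolding homogeneous_def using keys_add[of F G] by blast

lemma homogeneous_sum: "(\<And>a. a \<in> A \<Longrightarrow> homogeneous e (f a)) \<Longrightarrow> homogeneous e (\<Sum>a\<in>A. f a)"
  by (induction A rule: infinite_finite_induct) (auto intro: homogeneous_add)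

lemma homogeneous_uminus: "homogeneous e F \<Longrightarrow> homogeneous e (- F)"
  unfolding homogeneous_def by (simp add: in_keys_iff)

lemma homogeneous_diff: "homogeneous e F \<Longrightarrow> homogeneous e G \<Longrightarrow> homogeneous e (F - G)"
  using homogeneous_add[of e F "- G"] homogeneous_uminus[of e G] by simp

lemma homogeneous_mult: "homogeneous e F \<Longrightarrow> homogeneous e' G \<Longrightarrow> homogeneous (e + e') (F * G)"
  unfolding homogeneous_def using keys_mult[of F G] by (fastforce simp: mon_degree_add)

lemma homogeneous_const [simp]: "homogeneous 0 (mp_const a)"
  by (auto simp: homogeneous_def mp_const_def mon_degree_def)

lemma homogeneous_one [simp]: "homogeneous 0 1"
  using homogeneous_const[of 1] by simp

lemma homogeneous_single: "homogeneous (mon_degree m) (Poly_Mapping.single m a)"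
  by (auto simp: homogeneous_def)

lemma homogeneous_var [simp]: "homogeneous (Suc 0) (mp_var i)"
  using homogeneous_single[of "Poly_Mapping.single i 1"] by (simp add: mp_var_def)

lemma homogeneous_const_mult: "homogeneous e F \<Longrightarrow> homogeneous e (mp_const c * F)"
  using homogeneous_mult[of 0 "mp_const c" e F] by simp

lemma homogeneous_power: "homogeneous e F \<Longrightarrow> homogeneous (e * j) (F ^ j)"
  by (induction j) (auto intro: homogeneous_mult)

lemma homogeneous_prod:
  "(\<And>a. a \<in> A \<Longrightarrow> homogeneous (e a) (f a)) \<Longrightarrow> homogeneous (\<Sum>a\<in>A. e a) (\<Prod>a\<in>A. f a)"
  by (induction A rule: infinite_finite_induct) (auto intro: homogeneous_mult)

lemma homogeneous_subst:
  assumes "homogeneous e F" "\<And>i. homogeneous q (\<sigma> i)"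
  shows "homogeneous (q * e) (mp_subst \<sigma> F)"
  unfolding mp_subst_def
proof (rule homogeneous_sum)
  fix m assume "m \<in> Poly_Mapping.keys F"
  then have "(\<Sum>i\<in>UNIV. q * Poly_Mapping.lookup m i) = q * e"
    using assms(1) by (simp add: homogeneous_def mon_degree_def flip: sum_distrib_left)
  then show "homogeneous (q * e) (mp_const (Poly_Mapping.lookup F m) * (\<Prod>i\<in>UNIV. \<sigma> i ^ Poly_Mapping.lookup m i))"
    using homogeneous_prod[of UNIV "\<lambda>i. q * Poly_Mapping.lookup m i" "\<lambda>i. \<sigma> i ^ Poly_Mapping.lookup m i"]
    by (metis assms(2) homogeneous_const_mult homogeneous_power)
qed

lemma mp_eval_homogeneous:
  assumes "homogeneous e F"
  shows "mp_eval F (c *s x) = c ^ e * mp_eval F x"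
proof -
  have "mon_val (c *s x) m = c ^ e * mon_val x m" if "m \<in> Poly_Mapping.keys F" for m
  proof -
    have "mon_val (c *s x) m = c ^ mon_degree m * mon_val x m"
      by (simp add: power_mult_distrib prod.distrib power_sum mon_degree_def)
    then show ?thesis using that assms by (simp add: homogeneous_def)
  qed
  then show ?thesis
    unfolding mp_eval_def sum_distrib_left by (auto intro!: sum.cong)
qed

lemma mp_degree_homogeneous:
  assumes "homogeneous e F" "F \<noteq> 0"
  shows "mp_degree F = e"
proof -
  obtain m where "m \<in> Poly_Mapping.keys F" using keys_nonempty[OF assms(2)] by blast
  then have "mon_degree ` Poly_Mapping.keys F = {e}"
    using assms unfolding homogeneous_def by (auto simp: image_iff)
  then show ?thesis by (simp add: mp_degree_def)
qed


section \<open>Nonvanishing\<close>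

text \<open>Kronecker substitution: if each new weight exceeds all weighted sums of the exponents
  treated before, the exponents can be read off one after another as quotients, so distinct
  monomials get distinct weights.\<close>

lemma exists_injective_weights:
  fixes K :: "('n::finite \<Rightarrow>\<^sub>0 nat) set"
  assumes "finite K"
  shows "\<exists>w. inj_on (\<lambda>m. \<Sum>i\<in>UNIV. Poly_Mapping.lookup m i * w i) K"
proof -
  have "\<exists>w. \<forall>m\<in>K. \<forall>m'\<in>K. (\<Sum>i\<in>S. Poly_Mapping.lookup m i * w i) = (\<Sum>i\<in>S. Poly_Mapping.lookup m' i * w i) \<longrightarrow>
      (\<forall>i\<in>S. Poly_Mapping.lookup m i = Poly_Mapping.lookup m' i)" if "finite S" for S :: "'n set"
    using that
  proof (induction S)
    case (insert j S)
    then obtain w where w: "\<And>m m'. m \<in> K \<Longrightarrow> m' \<in> K \<Longrightarrow>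
        (\<Sum>i\<in>S. Poly_Mapping.lookup m i * w i) = (\<Sum>i\<in>S. Poly_Mapping.lookup m' i * w i) \<Longrightarrow>
        (\<forall>i\<in>S. Poly_Mapping.lookup m i = Poly_Mapping.lookup m' i)" by blast
    define W where "W = Suc (\<Sum>m\<in>K. \<Sum>i\<in>S. Poly_Mapping.lookup m i * w i)"
    have W: "(\<Sum>i\<in>S. Poly_Mapping.lookup m i * w i) < W" if "m \<in> K" for m
      unfolding W_def less_Suc_eq_le using assms that by (intro member_le_sum) auto
    have eq: "(\<Sum>i\<in>insert j S. Poly_Mapping.lookup m i * (w(j := W)) i) =
        Poly_Mapping.lookup m j * W + (\<Sum>i\<in>S. Poly_Mapping.lookup m i * w i)" for m :: "'n \<Rightarrow>\<^sub>0 nat"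
    proof -
      have "(\<Sum>i\<in>S. Poly_Mapping.lookup m i * (w(j := W)) i) = (\<Sum>i\<in>S. Poly_Mapping.lookup m i * w i)"
        using insert.hyps by (intro sum.cong) auto
      then show ?thesis using insert.hyps by simp
    qed
    show ?case
    proof (intro exI[of _ "w(j := W)"] ballI impI)
      fix m m' i assume m: "m \<in> K" "m' \<in> K" and i: "i \<in> insert j S"
        and "(\<Sum>i\<in>insert j S. Poly_Mapping.lookup m i * (w(j := W)) i) =
             (\<Sum>i\<in>insert j S. Poly_Mapping.lookup m' i * (w(j := W)) i)"
      then have "Poly_Mapping.lookup m j * W + (\<Sum>i\<in>S. Poly_Mapping.lookup m i * w i) =
          Poly_Mapping.lookup m' j * W + (\<Sum>i\<in>S. Poly_Mapping.lookup m' i * w i)"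
        by (simp only: eq)
      note e = this
      have "Poly_Mapping.lookup m j = Poly_Mapping.lookup m' j"
        using arg_cong[OF e, of "\<lambda>t. t div W"] W[OF m(1)] W[OF m(2)]
        by (simp add: div_mult_self3)
      with e w[OF m] i show "Poly_Mapping.lookup m i = Poly_Mapping.lookup m' i" by auto
    qed
  qed auto
  from this[OF finite] show ?thesis
    unfolding inj_on_def by (metis UNIV_I poly_mapping_eqI)
qed

text \<open>Substituting \<open>x $ i = t ^ w i\<close> with separating weights keeps the monomials
  apart, so \<open>F\<close> and \<open>G\<close> become nonzero univariate polynomials with
  finitely many roots \<open>t\<close>.\<close>

lemma exists_nonvanishing:
  fixes F G :: "'n::finite mpoly"
  assumes "F \<noteq> 0" "G \<noteq> 0"
  shows "\<exists>x. (\<forall>i. x $ i \<noteq> 0) \<and> mp_eval F x \<noteq> 0 \<and> mp_eval G x \<noteq> 0"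
proof -
  obtain w where w: "inj_on (\<lambda>m. \<Sum>i\<in>UNIV. Poly_Mapping.lookup m i * w i) (Poly_Mapping.keys F \<union> Poly_Mapping.keys G)"
    using exists_injective_weights[of "Poly_Mapping.keys F \<union> Poly_Mapping.keys G"] by auto
  define s where "s m = (\<Sum>i\<in>UNIV. Poly_Mapping.lookup m i * w i)" for m :: "'n \<Rightarrow>\<^sub>0 nat"
  define u where "u H = (\<Sum>m\<in>Poly_Mapping.keys H. Polynomial.monom (Poly_Mapping.lookup H m) (s m))" for H :: "'n mpoly"
  define x where "x t = (\<chi> i. t ^ w i)" for t :: complex
  have ev: "poly (u H) t = mp_eval H (x t)" for H t
    unfolding u_def mp_eval_def x_def s_def
    by (simp add: poly_sum poly_monom power_sum mult.commute flip: power_mult)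
  have nz: "u H \<noteq> 0" if "H \<noteq> 0" "Poly_Mapping.keys H \<subseteq> Poly_Mapping.keys F \<union> Poly_Mapping.keys G" for H
  proof -
    from keys_nonempty[OF that(1)] obtain m where m: "m \<in> Poly_Mapping.keys H" by blast
    have inj: "s m' = s m \<longleftrightarrow> m' = m" if "m' \<in> Poly_Mapping.keys H" for m'
      using w that m \<open>Poly_Mapping.keys H \<subseteq> _\<close> unfolding s_def inj_on_def by blast
    have "Polynomial.coeff (u H) (s m) = (\<Sum>m'\<in>Poly_Mapping.keys H. if m' = m then Poly_Mapping.lookup H m' else 0)"
      unfolding u_def by (simp add: coeff_sum inj cong: sum.cong)
    also have "\<dots> = Poly_Mapping.lookup H m" using m by simp
    finally show ?thesis using m by (auto simp: in_keys_iff)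
  qed
  \<comment> \<open>The factor \<open>Polynomial.monom 1 1\<close> excludes \<open>t = 0\<close>, so
    all coordinates \<open>t ^ w i\<close> are nonzero.\<close>
  have "finite {t. poly (u F * u G * Polynomial.monom 1 1) t = 0}"
    using nz[of F] nz[of G] assms by (intro poly_roots_finite) auto
  then have "{t. poly (u F * u G * Polynomial.monom 1 1) t = 0} \<noteq> UNIV"
    using infinite_UNIV_char_0[where 'a=complex] by metis
  then obtain t where "poly (u F * u G * Polynomial.monom 1 1) t \<noteq> 0" by auto
  then show ?thesis
    by (intro exI[of _ "x t"]) (auto simp: ev poly_monom x_def)
qed

text \<open>A common point of nonvanishing rules out zero divisors.\<close>

lemma mpoly_mult_nonzero: "F \<noteq> 0 \<Longrightarrow> G \<noteq> 0 \<Longrightarrow> F * G \<noteq> (0 :: 'n::finite mpoly)"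
  using exists_nonvanishing[of F G] by (metis mp_eval_mult mp_eval_zero mult_eq_0_iff)

lemma mpoly_prod_nonzero: "(\<And>a. a \<in> A \<Longrightarrow> f a \<noteq> 0) \<Longrightarrow> (\<Prod>a\<in>A. f a) \<noteq> (0 :: 'n::finite mpoly)"
proof (induction A rule: infinite_finite_induct)
  case (insert a A)
  then show ?case using mpoly_mult_nonzero[of "f a" "\<Prod>a\<in>A. f a"] by simp
qed auto


section \<open>Linear algebra\<close>

text \<open>Gaussian elimination: an equation with a nonzero coefficient eliminates one unknown,
  which lowers both counts by one. Arbitrary index sets are allowed because later the unknowns are
  indexed by complex numbers and by disjoint unions of sets of monomials.\<close>

lemma homogeneous_system_nontrivial:
  fixes a :: "'m \<Rightarrow> 'u \<Rightarrow> 'a::field"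
  assumes "finite M" "finite U" "card M < card U"
  shows "\<exists>c. (\<exists>u\<in>U. c u \<noteq> 0) \<and> (\<forall>m\<in>M. (\<Sum>u\<in>U. c u * a m u) = 0)"
  using assms
proof (induction M arbitrary: U a)
  case empty
  then have "U \<noteq> {}" by auto
  then show ?case by (intro exI[of _ "\<lambda>_. 1"]) auto
next
  case (insert m M)
  show ?case
  proof (cases "\<forall>u\<in>U. a m u = 0")
    case True
    from insert obtain c where "\<exists>u\<in>U. c u \<noteq> 0" "\<forall>m\<in>M. (\<Sum>u\<in>U. c u * a m u) = 0"
      by (metis card_insert_disjoint Suc_lessD)
    with True show ?thesis by (intro exI[of _ c]) auto
  next
    case False
    then obtain u0 where u0: "u0 \<in> U" "a m u0 \<noteq> 0" by auto
    define a' where "a' m' u = a m' u - a m' u0 * a m u / a m u0" for m' u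
    have "card M < card (U - {u0})" using insert u0 by simp
    then obtain c where c: "\<exists>u\<in>U - {u0}. c u \<noteq> 0" "\<forall>m'\<in>M. (\<Sum>u\<in>U - {u0}. c u * a' m' u) = 0"
      using insert.IH[of "U - {u0}" a'] insert.prems by auto
    \<comment> \<open>The value at \<open>u0\<close> is the one that solves equation
      \<open>m\<close>.\<close>
    define c' where "c' = c(u0 := - (\<Sum>u\<in>U - {u0}. c u * a m u) / a m u0)"
    have split: "(\<Sum>u\<in>U. c' u * f u) = c' u0 * f u0 + (\<Sum>u\<in>U - {u0}. c u * f u)" for f
    proof -
      have "(\<Sum>u\<in>U - {u0}. c' u * f u) = (\<Sum>u\<in>U - {u0}. c u * f u)"
        by (rule sum.cong) (auto simp: c'_def)
      then show ?thesis using u0 insert.prems by (simp add: sum.remove)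
    qed
    have "(\<Sum>u\<in>U. c' u * a m u) = 0"
      unfolding split using u0 by (simp add: c'_def)
    moreover have "(\<Sum>u\<in>U. c' u * a m' u) = 0" if "m' \<in> M" for m'
    proof -
      have "(\<Sum>u\<in>U - {u0}. c u * a m' u) - (\<Sum>u\<in>U - {u0}. c u * a m u) * (a m' u0 / a m u0) = 0"
        using c(2) that by (simp add: a'_def algebra_simps sum_subtractf sum_distrib_left sum_distrib_right)
      then show ?thesis unfolding split using u0 by (simp add: c'_def field_simps)
    qed
    ultimately show ?thesis
      using c(1) by (intro exI[of _ c']) (auto simp: c'_def)
  qed
qed

text \<open>A closure predicate on plain sets, so that computations stay in the type
  \<open>complex\<close>; \<open>subfield_complex_ring\<close> translates it into the notion used by
  \<open>number_field\<close>.\<close>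

definition is_subfield :: "complex set \<Rightarrow> bool" where
  "is_subfield k \<longleftrightarrow> 0 \<in> k \<and> 1 \<in> k \<and>
     (\<forall>a\<in>k. \<forall>b\<in>k. a - b \<in> k \<and> a * b \<in> k) \<and> (\<forall>a\<in>k. inverse a \<in> k)"

lemma is_subfieldD:
  assumes "is_subfield k"
  shows "0 \<in> k" "1 \<in> k" "a \<in> k \<Longrightarrow> b \<in> k \<Longrightarrow> a - b \<in> k" "a \<in> k \<Longrightarrow> b \<in> k \<Longrightarrow> a * b \<in> k"
    "a \<in> k \<Longrightarrow> inverse a \<in> k" "a \<in> k \<Longrightarrow> - a \<in> k" "a \<in> k \<Longrightarrow> b \<in> k \<Longrightarrow> a + b \<in> k"
    "a \<in> k \<Longrightarrow> b \<in> k \<Longrightarrow> a / b \<in> k"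
proof -
  show 1: "0 \<in> k" "1 \<in> k" "a \<in> k \<Longrightarrow> b \<in> k \<Longrightarrow> a - b \<in> k" "a \<in> k \<Longrightarrow> b \<in> k \<Longrightarrow> a * b \<in> k"
    "a \<in> k \<Longrightarrow> inverse a \<in> k" for a b
    using assms by (auto simp: is_subfield_def)
  show m: "a \<in> k \<Longrightarrow> - a \<in> k" for a using 1(3)[OF 1(1), of a] by simp
  show "a \<in> k \<Longrightarrow> b \<in> k \<Longrightarrow> a + b \<in> k" using 1(3)[of a "- b"] m by simp
  show "a \<in> k \<Longrightarrow> b \<in> k \<Longrightarrow> a / b \<in> k" using 1(4)[of a "inverse b"] 1(5) by (simp add: divide_inverse)
qed

lemma is_subfield_Rats: "is_subfield \<rat>"
  by (auto simp: is_subfield_def)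

lemma is_subfield_sum: "is_subfield k \<Longrightarrow> (\<And>a. a \<in> A \<Longrightarrow> f a \<in> k) \<Longrightarrow> (\<Sum>a\<in>A. f a) \<in> k"
  by (induction A rule: infinite_finite_induct) (auto simp: is_subfieldD)

lemma is_subfield_prod: "is_subfield k \<Longrightarrow> (\<And>a. a \<in> A \<Longrightarrow> f a \<in> k) \<Longrightarrow> (\<Prod>a\<in>A. f a) \<in> k"
  by (induction A rule: infinite_finite_induct) (auto simp: is_subfieldD)

lemma is_subfield_power: "is_subfield k \<Longrightarrow> a \<in> k \<Longrightarrow> a ^ e \<in> k"
  by (induction e) (auto simp: is_subfieldD)

text \<open>A \<open>k\<close>-linear functional on the \<open>k\<close>-span of \<open>1\<close> and the \<open>c i\<close>, fixing \<open>1\<close>.\<close>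

lemma linear_relations_descend:
  fixes c :: "'i \<Rightarrow> complex"
  assumes k: "is_subfield k" and "finite I"
  shows "\<exists>c'. (\<forall>i\<in>I. c' i \<in> k) \<and>
     (\<forall>a b. (\<forall>i\<in>I. a i \<in> k) \<and> b \<in> k \<and> (\<Sum>i\<in>I. a i * c i) = b \<longrightarrow> (\<Sum>i\<in>I. a i * c' i) = b)"
  using assms(2)
proof (induction I)
  case (insert j I)
  then obtain c' where c': "\<And>i. i \<in> I \<Longrightarrow> c' i \<in> k"
    and rel: "\<And>a b. (\<And>i. i \<in> I \<Longrightarrow> a i \<in> k) \<Longrightarrow> b \<in> k \<Longrightarrow> (\<Sum>i\<in>I. a i * c i) = b \<Longrightarrow> (\<Sum>i\<in>I. a i * c' i) = b"
    by blast
  show ?case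
  proof (cases "\<exists>a b. (\<forall>i\<in>I. a i \<in> k) \<and> b \<in> k \<and> c j = (\<Sum>i\<in>I. a i * c i) + b")
    case True
    then obtain a0 b0 where 0: "\<And>i. i \<in> I \<Longrightarrow> a0 i \<in> k" "b0 \<in> k" "c j = (\<Sum>i\<in>I. a0 i * c i) + b0"
      by blast
    \<comment> \<open>In the affine span the new value is forced: it is the same combination of the
      values already chosen.\<close>
    define d where "d = c'(j := (\<Sum>i\<in>I. a0 i * c' i) + b0)"
    have dI: "(\<Sum>i\<in>I. a i * d i) = (\<Sum>i\<in>I. a i * c' i)" for a
      by (rule sum.cong) (use insert.hyps in \<open>auto simp: d_def\<close>)
    show ?thesis
    proof (intro exI[of _ d] conjI allI impI ballI; (elim conjE)?)
      show "d i \<in> k" if "i \<in> insert j I" for i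
        using that 0 c' k by (auto simp: d_def intro!: is_subfieldD(7) is_subfield_sum is_subfieldD(4))
      fix a b assume a: "\<forall>i\<in>insert j I. a i \<in> k" and b: "b \<in> k" and eq: "(\<Sum>i\<in>insert j I. a i * c i) = b"
      have "(\<Sum>i\<in>I. (a i + a j * a0 i) * c i) = b - a j * b0"
        using eq insert.hyps 0(3) by (simp add: algebra_simps sum.distrib sum_distrib_left)
      then have "(\<Sum>i\<in>I. (a i + a j * a0 i) * c' i) = b - a j * b0"
        by (intro rel) (use a b 0 k in \<open>auto intro!: is_subfieldD(3,4,7)\<close>)
      then show "(\<Sum>i\<in>insert j I. a i * d i) = b"
        using insert.hyps by (simp add: dI) (simp add: d_def algebra_simps sum.distrib sum_distrib_left)
    qed
  next
    case False
    \<comment> \<open>No relation over \<open>k\<close> involves \<open>c j\<close> in this case, so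
      the value 0 is a free choice.\<close>
    define d where "d = c'(j := 0)"
    have dI: "(\<Sum>i\<in>I. a i * d i) = (\<Sum>i\<in>I. a i * c' i)" for a
      by (rule sum.cong) (use insert.hyps in \<open>auto simp: d_def\<close>)
    show ?thesis
    proof (intro exI[of _ d] conjI allI impI ballI; (elim conjE)?)
      show "d i \<in> k" if "i \<in> insert j I" for i
        using that c' k by (auto simp: d_def is_subfieldD)
      fix a b assume a: "\<forall>i\<in>insert j I. a i \<in> k" and b: "b \<in> k" and eq: "(\<Sum>i\<in>insert j I. a i * c i) = b"
      have "a j = 0"
      proof (rule ccontr)
        assume nz: "a j \<noteq> 0"
        have "a j * c j = b - (\<Sum>i\<in>I. a i * c i)" using eq insert.hyps by (simp add: algebra_simps)
        then have "c j = (\<Sum>i\<in>I. (- (a i / a j)) * c i) + b / a j"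
          using nz by (simp add: field_simps sum_negf sum_divide_distrib[symmetric])
        moreover have "- (a i / a j) \<in> k" if "i \<in> I" for i
          using that a k by (intro is_subfieldD(6,8)) auto
        moreover have "b / a j \<in> k" using a b k by (intro is_subfieldD(8)) auto
        ultimately have "\<exists>a b. (\<forall>i\<in>I. a i \<in> k) \<and> b \<in> k \<and> c j = (\<Sum>i\<in>I. a i * c i) + b"
          by (intro exI[of _ "\<lambda>i. - (a i / a j)"] exI[of _ "b / a j"]) auto
        with False show False by (rule notE)
      qed
      with eq insert.hyps a b rel[of a b] show "(\<Sum>i\<in>insert j I. a i * d i) = b"
        by (simp add: dI)
    qed
  qed
qed auto

section \<open>The weak Nullstellensatz\<close>

definition mp_ideal :: "'n::finite mpoly set \<Rightarrow> bool" where
  "mp_ideal I \<longleftrightarrow> 0 \<in> I \<and> (\<forall>p\<in>I. \<forall>q\<in>I. p + q \<in> I) \<and> (\<forall>p\<in>I. \<forall>q. p * q \<in> I)"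

lemma mp_idealD:
  assumes "mp_ideal I"
  shows "0 \<in> I" "p \<in> I \<Longrightarrow> q \<in> I \<Longrightarrow> p + q \<in> I" "p \<in> I \<Longrightarrow> p * q \<in> I" "p \<in> I \<Longrightarrow> q * p \<in> I"
    "p \<in> I \<Longrightarrow> - p \<in> I" "p \<in> I \<Longrightarrow> q \<in> I \<Longrightarrow> p - q \<in> I"
proof -
  show 1: "0 \<in> I" "\<And>p q. p \<in> I \<Longrightarrow> q \<in> I \<Longrightarrow> p + q \<in> I" "\<And>p q. p \<in> I \<Longrightarrow> p * q \<in> I"
    using assms by (auto simp: mp_ideal_def)
  show "p \<in> I \<Longrightarrow> q * p \<in> I" using 1(3)[of p q] by (simp add: mult.commute)
  show 2: "\<And>p. p \<in> I \<Longrightarrow> - p \<in> I" using 1(3)[where q="-1"] by simp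
  show "p \<in> I \<Longrightarrow> q \<in> I \<Longrightarrow> p - q \<in> I" using 1(2)[of p "- q"] 2 by simp
qed

lemma mp_ideal_sum: "mp_ideal I \<Longrightarrow> (\<And>a. a \<in> A \<Longrightarrow> f a \<in> I) \<Longrightarrow> (\<Sum>a\<in>A. f a) \<in> I"
  by (induction A rule: infinite_finite_induct) (auto simp: mp_idealD)

definition adjoin :: "'n::finite mpoly set \<Rightarrow> 'n mpoly \<Rightarrow> 'n mpoly set" where
  "adjoin I f = {p + q * f | p q. p \<in> I}"

lemma mp_ideal_adjoin: "mp_ideal I \<Longrightarrow> mp_ideal (adjoin I f)"
  unfolding mp_ideal_def[of "adjoin I f"]
proof (intro conjI ballI allI)
  assume I: "mp_ideal I"
  show "0 \<in> adjoin I f"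
    unfolding adjoin_def using mp_idealD(1)[OF I] by (intro CollectI exI[of _ 0]) simp
  fix p assume "p \<in> adjoin I f"
  then obtain p1 p2 where p: "p1 \<in> I" "p = p1 + p2 * f" by (auto simp: adjoin_def)
  show "p + q \<in> adjoin I f" if "q \<in> adjoin I f" for q
  proof -
    from that obtain q1 q2 where q: "q1 \<in> I" "q = q1 + q2 * f" by (auto simp: adjoin_def)
    have "p + q = (p1 + q1) + (p2 + q2) * f" by (simp add: p q algebra_simps)
    then show ?thesis using mp_idealD(2)[OF I p(1) q(1)] unfolding adjoin_def by blast
  qed
  show "p * q \<in> adjoin I f" for q
  proof -
    have "p * q = p1 * q + (p2 * q) * f" by (simp add: p algebra_simps)
    then show ?thesis using mp_idealD(3)[OF I p(1)] unfolding adjoin_def by blast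
  qed
qed

lemma subset_adjoin: "mp_ideal I \<Longrightarrow> I \<subseteq> adjoin I f"
proof
  fix p assume "p \<in> I"
  then show "p \<in> adjoin I f"
    unfolding adjoin_def by (intro CollectI exI[of _ p] exI[of _ 0]) simp
qed

lemma mem_adjoin: "mp_ideal I \<Longrightarrow> f \<in> adjoin I f"
  unfolding adjoin_def by (intro CollectI exI[of _ 0] exI[of _ 1]) (simp add: mp_idealD)

text \<open>As a ring homomorphism this carries factorizations into linear factors, available for
  univariate complex polynomials, into the multivariate ring.\<close>

definition eval_at_var :: "'n \<Rightarrow> complex poly \<Rightarrow> 'n::finite mpoly" where
  "eval_at_var i P = poly (map_poly mp_const P) (mp_var i)"

lemma eval_at_var_0 [simp]: "eval_at_var i 0 = 0"
  by (simp add: eval_at_var_def)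

lemma eval_at_var_pCons [simp]: "eval_at_var i (pCons a P) = mp_const a + mp_var i * eval_at_var i P"
  by (cases "a = 0 \<and> P = 0") (auto simp: eval_at_var_def map_poly_pCons)

lemma eval_at_var_add: "eval_at_var i (P + Q) = eval_at_var i P + eval_at_var i Q"
  by (induction P Q rule: poly_induct2) (auto simp: mp_const_add algebra_simps)

lemma eval_at_var_sum: "eval_at_var i (\<Sum>a\<in>A. f a) = (\<Sum>a\<in>A. eval_at_var i (f a))"
  by (induction A rule: infinite_finite_induct) (auto simp: eval_at_var_add)

lemma eval_at_var_smult: "eval_at_var i (Polynomial.smult a P) = mp_const a * eval_at_var i P"
  by (induction P) (auto simp: mp_const_mult algebra_simps)

lemma eval_at_var_mult: "eval_at_var i (P * Q) = eval_at_var i P * eval_at_var i Q"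
  by (induction P) (auto simp: eval_at_var_add eval_at_var_smult algebra_simps)

lemma eval_at_var_1 [simp]: "eval_at_var i 1 = 1"
  by (simp add: one_pCons)

lemma eval_at_var_prod: "eval_at_var i (\<Prod>a\<in>A. f a) = (\<Prod>a\<in>A. eval_at_var i (f a))"
  by (induction A rule: infinite_finite_induct) (auto simp: eval_at_var_mult)

lemma finite_bounded_exponents: "finite {m :: 'n::finite \<Rightarrow>\<^sub>0 nat. \<forall>i. Poly_Mapping.lookup m i \<le> D}"
proof (rule finite_imageD)
  show "finite (Poly_Mapping.lookup ` {m :: 'n \<Rightarrow>\<^sub>0 nat. \<forall>i. Poly_Mapping.lookup m i \<le> D})"
  proof (rule finite_subset)
    show "finite (PiE (UNIV :: 'n set) (\<lambda>_. {..D}))" by (rule finite_PiE) auto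
  qed auto
  show "inj_on Poly_Mapping.lookup {m :: 'n \<Rightarrow>\<^sub>0 nat. \<forall>i. Poly_Mapping.lookup m i \<le> D}"
    by (intro inj_onI poly_mapping_eqI) simp
qed

lemma exists_exponent_bound:
  fixes K :: "('n::finite \<Rightarrow>\<^sub>0 nat) set"
  assumes "finite K"
  shows "\<exists>D. \<forall>m\<in>K. \<forall>i. Poly_Mapping.lookup m i \<le> D"
proof (intro exI ballI allI)
  fix m i assume "m \<in> K"
  have "Poly_Mapping.lookup m i \<le> (\<Sum>i\<in>UNIV. Poly_Mapping.lookup m i)"
    by (intro member_le_sum) auto
  also have "\<dots> \<le> (\<Sum>m\<in>K. \<Sum>i\<in>UNIV. Poly_Mapping.lookup m i)"
    using assms \<open>m \<in> K\<close> by (intro member_le_sum) auto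
  finally show "Poly_Mapping.lookup m i \<le> (\<Sum>m\<in>K. \<Sum>i\<in>UNIV. Poly_Mapping.lookup m i)" .
qed

text \<open>If every \<open>x\<^sub>i - a\<close> were invertible modulo \<open>I\<close>, with inverse \<open>b a\<close>, then uncountably many
  elements \<open>b a\<close> would lie in a space of countable dimension; a linear relation between them yields
  a nonzero univariate polynomial in \<open>x\<^sub>i\<close> that lies in \<open>I\<close>, yet is a product of units.\<close>

lemma exists_proper_adjoin:
  fixes I :: "'n::finite mpoly set"
  assumes I: "mp_ideal I" and proper: "1 \<notin> I"
  shows "\<exists>a. 1 \<notin> adjoin I (mp_var i - mp_const a)"
proof (rule ccontr)
  assume "\<not> ?thesis"
  then have "\<forall>a. \<exists>b. 1 - b * (mp_var i - mp_const a) \<in> I"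
    unfolding adjoin_def by (auto simp: algebra_simps) (metis add_diff_cancel_left' diff_diff_eq2)
  then obtain b where b: "\<And>a. 1 - b a * (mp_var i - mp_const a) \<in> I" by metis
  \<comment> \<open>Every linear factor of \<open>P\<close> is a unit modulo \<open>I\<close>, so
    factors can be cancelled until a constant remains; a nonzero constant in \<open>I\<close> would
    contradict properness.\<close>
  have units: "P = 0" if "eval_at_var i P \<in> I" for P
    using that
  proof (induction "Polynomial.degree P" arbitrary: P rule: less_induct)
    case (less P)
    show ?case
    proof (cases "Polynomial.degree P = 0")
      case True
      then obtain c where c: "P = [:c:]" by (metis degree_eq_zeroE)
      show ?thesis
      proof (rule ccontr)
        assume "P \<noteq> 0"
        with c have "mp_const (1 / c) * mp_const c = (1 :: 'n mpoly)" by (simp flip: mp_const_mult)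
        moreover have "mp_const (1 / c) * mp_const c \<in> I"
          using less.prems c by (intro mp_idealD(4)[OF I]) simp
        ultimately show False using proper by (simp only:)
      qed
    next
      case False
      then obtain r where "poly P r = 0"
        by (metis fundamental_theorem_of_algebra constant_degree)
      then obtain Q where Q: "P = [:- r, 1:] * Q" by (auto simp: poly_eq_0_iff_dvd)
      have nz: "Q \<noteq> 0" using False Q by auto
      then have deg: "Polynomial.degree Q < Polynomial.degree P"
        unfolding Q by (subst degree_mult_eq) auto
      have L: "eval_at_var i [:- r, 1:] = mp_var i - mp_const r"
        using mp_const_add[of r "- r"] by (simp add: add_eq_0_iff)
      have "eval_at_var i Q = (1 - b r * (mp_var i - mp_const r)) * eval_at_var i Q + b r * eval_at_var i P"
        unfolding Q eval_at_var_mult L by (simp add: algebra_simps)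
      also have "\<dots> \<in> I"
        using b[of r] less.prems by (intro mp_idealD(2)[OF I] mp_idealD(3)[OF I] mp_idealD(4)[OF I])
      finally show ?thesis using less.hyps[OF deg] nz by blast
    qed
  qed
  define box where "box D = {m :: 'n \<Rightarrow>\<^sub>0 nat. \<forall>i. Poly_Mapping.lookup m i \<le> D}" for D
  define V where "V D = {a. Poly_Mapping.keys (b a) \<subseteq> box D}" for D
  have "a \<in> (\<Union>D. V D)" for a
    using exists_exponent_bound[of "Poly_Mapping.keys (b a)"] by (auto simp: V_def box_def)
  then have "(\<Union>D. V D) = UNIV" by auto
  moreover have "uncountable (UNIV :: complex set)"
    using uncountable_UNIV_complex .
  \<comment> \<open>Countably many exponent bounds cover all complex \<open>a\<close>, so a single
    bound serves infinitely many of the inverses.\<close>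
  ultimately obtain D where "uncountable (V D)"
    by (metis countable_UN countableI_type)
  then have "infinite (V D)" using countable_finite by blast
  then obtain U where U: "U \<subseteq> V D" "finite U" "card U = Suc (card (box D))"
    by (metis infinite_arbitrarily_large)
  have fin: "finite (box D)" unfolding box_def by (rule finite_bounded_exponents)
  obtain c u0 where u0: "u0 \<in> U" "c u0 \<noteq> 0"
    and c: "\<And>m. m \<in> box D \<Longrightarrow> (\<Sum>u\<in>U. c u * Poly_Mapping.lookup (b u) m) = 0"
    using homogeneous_system_nontrivial[OF fin U(2), of "\<lambda>m u. Poly_Mapping.lookup (b u) m"] U(3) by auto
  have rel: "(\<Sum>u\<in>U. mp_const (c u) * b u) = 0"
  proof (rule poly_mapping_eqI)
    fix m
    show "Poly_Mapping.lookup (\<Sum>u\<in>U. mp_const (c u) * b u) m = Poly_Mapping.lookup 0 m"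
    proof (cases "m \<in> box D")
      case False
      then have "m \<notin> Poly_Mapping.keys (b u)" if "u \<in> U" for u
        using that U(1) by (auto simp: V_def)
      then have "Poly_Mapping.lookup (b u) m = 0" if "u \<in> U" for u
        using that by (simp add: in_keys_iff)
      then show ?thesis by (simp add: lookup_sum lookup_mp_const_mult)
    qed (simp add: lookup_sum lookup_mp_const_mult c)
  qed
  define L where "L u = mp_var i - mp_const u" for u
  have L: "eval_at_var i [:- u, 1:] = L u" for u
    using mp_const_add[of u "- u"] by (simp add: add_eq_0_iff L_def)
  \<comment> \<open>\<open>P\<close> is the numerator of the sum of the fractions
    \<open>c u / (X - u)\<close>, which modulo \<open>I\<close> is the linear relation just found;
    at \<open>u0\<close> only one summand survives.\<close>
  define P where "P = (\<Sum>u\<in>U. Polynomial.smult (c u) (\<Prod>w\<in>U - {u}. [:- w, 1:]))"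
  have "eval_at_var i P = (\<Sum>u\<in>U. mp_const (c u) * (\<Prod>w\<in>U - {u}. L w))"
    unfolding P_def by (simp only: eval_at_var_sum eval_at_var_smult eval_at_var_prod L)
  also have "\<dots> = (\<Sum>u\<in>U. (1 - b u * L u) * (mp_const (c u) * (\<Prod>w\<in>U - {u}. L w))) +
      (\<Prod>w\<in>U. L w) * (\<Sum>u\<in>U. mp_const (c u) * b u)"
    unfolding sum_distrib_left sum.distrib [symmetric]
    using U(2) by (intro sum.cong) (auto simp: prod.remove algebra_simps)
  also have "\<dots> \<in> I"
    unfolding rel using b by (auto intro!: mp_ideal_sum[OF I] mp_idealD(3)[OF I] simp: L_def)
  finally have "P = 0" by (rule units)
  moreover have "poly P u0 = c u0 * (\<Prod>w\<in>U - {u0}. u0 - w)"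
  proof -
    have "poly P u0 = (\<Sum>u\<in>U. c u * (\<Prod>w\<in>U - {u}. u0 - w))"
      unfolding P_def by (simp add: poly_sum poly_prod)
    also have "\<dots> = (\<Sum>u\<in>U. if u = u0 then c u * (\<Prod>w\<in>U - {u}. u0 - w) else 0)"
    proof (rule sum.cong)
      fix u assume "u \<in> U"
      have "(\<Prod>w\<in>U - {u}. u0 - w) = 0" if "u \<noteq> u0"
        using U(2) u0(1) that by (intro prod_zero bexI[of _ u0]) auto
      then show "c u * (\<Prod>w\<in>U - {u}. u0 - w) = (if u = u0 then c u * (\<Prod>w\<in>U - {u}. u0 - w) else 0)"
        by auto
    qed simp
    finally have "poly P u0 = (\<Sum>u\<in>U. if u = u0 then c u * (\<Prod>w\<in>U - {u}. u0 - w) else 0)" .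
    then show ?thesis using U(2) u0(1) by simp
  qed
  ultimately show False using u0 U(2) by auto
qed

text \<open>One linear polynomial per variable is adjoined while the ideal stays proper. Modulo the
  final ideal each \<open>f\<close> is congruent to the constant \<open>mp_eval f x\<close>, and a
  nonzero constant is a unit; neither maximal ideals nor a basis theorem enter.\<close>

theorem weak_nullstellensatz:
  fixes I :: "'n::finite mpoly set"
  assumes I: "mp_ideal I" and "1 \<notin> I"
  shows "\<exists>x. \<forall>f\<in>I. mp_eval f x = 0"
proof -
  have "\<exists>J a. mp_ideal J \<and> I \<subseteq> J \<and> 1 \<notin> J \<and> (\<forall>i\<in>S. mp_var i - mp_const (a i) \<in> J)"
    if "finite S" for S :: "'n set"
    using that
  proof (induction S)
    case empty
    show ?case using assms by (intro exI[of _ I]) auto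
  next
    case (insert i S)
    then obtain J a where J: "mp_ideal J" "I \<subseteq> J" "1 \<notin> J" "\<And>i. i \<in> S \<Longrightarrow> mp_var i - mp_const (a i) \<in> J"
      by blast
    obtain c where c: "1 \<notin> adjoin J (mp_var i - mp_const c)"
      using exists_proper_adjoin[OF J(1,3)] by blast
    show ?case
    proof (intro exI[of _ "adjoin J (mp_var i - mp_const c)"] exI[of _ "a(i := c)"] conjI ballI)
      fix j assume "j \<in> insert i S"
      then show "mp_var j - mp_const ((a(i := c)) j) \<in> adjoin J (mp_var i - mp_const c)"
        using J insert.hyps subset_adjoin[OF J(1)] mem_adjoin[OF J(1)] by auto
    qed (use c J subset_adjoin[OF J(1)] mp_ideal_adjoin[OF J(1)] in auto)
  qed
  from this[of UNIV] have "\<exists>J a. mp_ideal J \<and> I \<subseteq> J \<and> 1 \<notin> J \<and> (\<forall>i. mp_var i - mp_const (a i) \<in> J)"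
    by simp
  then obtain J a where J: "mp_ideal J" "I \<subseteq> J" "1 \<notin> J"
    and a: "\<And>i. mp_var i - mp_const (a i) \<in> J" by blast
  define x where "x = vec_lambda a"
  have cmult: "p * q - p' * q' \<in> J" if "p - p' \<in> J" "q - q' \<in> J" for p q p' q'
  proof -
    have "p * q - p' * q' = (p - p') * q + p' * (q - q')" by (simp add: algebra_simps)
    also have "\<dots> \<in> J"
      using that by (intro mp_idealD(2)[OF J(1)] mp_idealD(3)[OF J(1)] mp_idealD(4)[OF J(1)])
    finally show ?thesis .
  qed
  have cpow: "mp_var i ^ e - mp_const (a i ^ e) \<in> J" for i e
    by (induction e) (auto simp: mp_const_mult mp_idealD[OF J(1)] intro: cmult a)
  have cprod: "(\<Prod>i\<in>A. mp_var i ^ e i) - mp_const (\<Prod>i\<in>A. a i ^ e i) \<in> J" for A e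
    by (induction A rule: infinite_finite_induct)
       (auto simp: mp_const_mult mp_idealD[OF J(1)] intro: cmult cpow)
  show ?thesis
  proof (intro exI ballI)
    fix f assume "f \<in> I"
    have "(\<Sum>m\<in>Poly_Mapping.keys f. mp_const (Poly_Mapping.lookup f m) * (\<Prod>i\<in>UNIV. mp_var i ^ Poly_Mapping.lookup m i)) -
        (\<Sum>m\<in>Poly_Mapping.keys f. mp_const (Poly_Mapping.lookup f m) * mp_const (mon_val x m)) \<in> J"
      unfolding sum_subtractf [symmetric]
      by (intro mp_ideal_sum[OF J(1)] cmult) (auto simp: x_def mp_idealD[OF J(1)] intro: cprod)
    then have "f - mp_const (mp_eval f x) \<in> J"
      by (simp only: mpoly_eq_sum_vars [symmetric] mp_eval_def mp_const_sum mp_const_mult)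
    then have "mp_const (mp_eval f x) \<in> J"
      using mp_idealD(6)[OF J(1), of f "f - mp_const (mp_eval f x)"] \<open>f \<in> I\<close> J(2) by auto
    then have "mp_const (1 / mp_eval f x) * mp_const (mp_eval f x) \<in> J"
      by (intro mp_idealD(4)[OF J(1)]) simp
    then show "mp_eval f x = 0"
      using J(3) by (cases "mp_eval f x = 0") (auto simp flip: mp_const_mult)
  qed
qed

section \<open>Common factors of the values of an endomorphism\<close>

definition int_vec :: "('n \<Rightarrow> int) \<Rightarrow> complex ^ 'n" where
  "int_vec z = (\<chi> i. of_int (z i))"

lemma int_vec_nth [simp]: "int_vec z $ i = of_int (z i)"
  by (simp add: int_vec_def)

lemma Rats_finite_common_denominator:
  fixes c :: "'i \<Rightarrow> complex"
  assumes "finite I" "\<And>i. i \<in> I \<Longrightarrow> c i \<in> \<rat>"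
  shows "\<exists>A::int. A > 0 \<and> (\<forall>i\<in>I. of_int A * c i \<in> \<int>)"
  using assms
proof (induction I)
  case empty
  show ?case by (intro exI[of _ 1]) simp
next
  case (insert j I)
  then obtain A where A: "A > 0" "\<And>i. i \<in> I \<Longrightarrow> of_int A * c i \<in> \<int>" by auto
  from insert.prems have "c j \<in> \<rat>" by simp
  then obtain a b where ab: "b > 0" "c j = of_int a / of_int b" by (elim Rats_cases')
  show ?case
  proof (intro exI[of _ "A * b"] conjI ballI)
    show "A * b > 0" using A ab by simp
    fix i assume "i \<in> insert j I"
    then consider "i = j" | "i \<in> I" by auto
    then show "of_int (A * b) * c i \<in> \<int>"
    proof cases
      case 1
      have "of_int (A * b) * c i = of_int (A * a)" using ab 1 by simp
      then show ?thesis by (metis Ints_of_int)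
    next
      case 2
      have "of_int (A * b) * c i = of_int b * (of_int A * c i)" by simp
      then show ?thesis using A(2)[OF 2] by (metis Ints_mult Ints_of_int)
    qed
  qed
qed

lemma mon_val_Rats: "(\<And>i. x $ i \<in> \<rat>) \<Longrightarrow> mon_val x m \<in> \<rat>"
  by (intro is_subfield_prod[OF is_subfield_Rats] Rats_power)

lemma mp_eval_in_subfield:
  fixes x :: "complex ^ 'n::finite"
  assumes "is_subfield k" "coeffs_in k F" "\<And>i. x $ i \<in> k"
  shows "mp_eval F x \<in> k"
  unfolding mp_eval_def using assms
  by (intro is_subfield_sum is_subfieldD(4) is_subfield_prod is_subfield_power) (auto simp: coeffs_in_def)

text \<open>In the chart \<open>x $ i0 = 1\<close> the forms have no common zero, so 1 is a
  combination of them modulo \<open>mp_var i0 - 1\<close>. Evaluating at \<open>z\<close> divided by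
  \<open>z i0\<close> and clearing denominators writes \<open>A * z i0 ^ M\<close> as an integral
  combination of the values at \<open>z\<close>, all of which are multiples of
  \<open>c\<close>.\<close>

lemma common_factor_dvd_power:
  fixes \<psi> :: "'n::finite \<Rightarrow> 'n mpoly" and i0 :: 'n
  assumes zero: "\<And>x. (\<forall>i. mp_eval (\<psi> i) x = 0) \<Longrightarrow> x = 0"
    and hom: "\<And>i. homogeneous q (\<psi> i)" and rat: "\<And>i. coeffs_in \<rat> (\<psi> i)"
  shows "\<exists>A M. A > 0 \<and> (\<forall>z c. (\<forall>i. \<exists>w. mp_eval (\<psi> i) (int_vec z) = of_int (c * w)) \<longrightarrow> c dvd A * z i0 ^ M)"
proof -
  define I where "I = {(\<Sum>j\<in>UNIV. B j * \<psi> j) + C * (mp_var i0 - 1) | B C. True}"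
  have "mp_ideal I"
    unfolding mp_ideal_def
  proof (intro conjI ballI allI)
    show "0 \<in> I" unfolding I_def by (intro CollectI exI[of _ "\<lambda>_. 0"] exI[of _ 0]) simp
    fix p assume "p \<in> I"
    then obtain B C where p: "p = (\<Sum>j\<in>UNIV. B j * \<psi> j) + C * (mp_var i0 - 1)" by (auto simp: I_def)
    show "p + q \<in> I" if "q \<in> I" for q
    proof -
      from that obtain B' C' where q: "q = (\<Sum>j\<in>UNIV. B' j * \<psi> j) + C' * (mp_var i0 - 1)" by (auto simp: I_def)
      have "p + q = (\<Sum>j\<in>UNIV. (B j + B' j) * \<psi> j) + (C + C') * (mp_var i0 - 1)"
        by (simp add: p q algebra_simps sum.distrib)
      then show ?thesis unfolding I_def
        by (intro CollectI exI[of _ "\<lambda>j. B j + B' j"] exI[of _ "C + C'"]) simp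
    qed
    show "p * q \<in> I" for q
    proof -
      have "p * q = (\<Sum>j\<in>UNIV. (B j * q) * \<psi> j) + (C * q) * (mp_var i0 - 1)"
        by (simp add: p algebra_simps sum_distrib_left)
      then show ?thesis unfolding I_def
        by (intro CollectI exI[of _ "\<lambda>j. B j * q"] exI[of _ "C * q"]) simp
    qed
  qed
  moreover have "\<not> (\<exists>x. \<forall>f\<in>I. mp_eval f x = 0)"
  proof
    assume "\<exists>x. \<forall>f\<in>I. mp_eval f x = 0"
    then obtain x where x: "\<And>f. f \<in> I \<Longrightarrow> mp_eval f x = 0" by blast
    have "\<psi> i \<in> I" for i
    proof -
      have "(\<Sum>j\<in>UNIV. (if j = i then 1 else 0) * \<psi> j) = (\<Sum>j\<in>UNIV. if j = i then \<psi> j else 0)"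
        by (rule sum.cong) auto
      then show ?thesis unfolding I_def
        by (intro CollectI exI[of _ "\<lambda>j. if j = i then 1 else 0"] exI[of _ 0]) simp
    qed
    moreover have "mp_var i0 - 1 \<in> I"
      unfolding I_def by (intro CollectI exI[of _ "\<lambda>_. 0"] exI[of _ 1]) simp
    ultimately have "\<forall>i. mp_eval (\<psi> i) x = 0" "x $ i0 = 1"
      using x x[of "mp_var i0 - 1"] by (auto simp: mp_eval_diff)
    with zero[of x] show False by simp
  qed
  ultimately have "1 \<in> I" using weak_nullstellensatz by blast
  then obtain B C where one: "1 = (\<Sum>j\<in>UNIV. B j * \<psi> j) + C * (mp_var i0 - 1)" by (auto simp: I_def)
  define J where "J = (SIGMA j:UNIV. Poly_Mapping.keys (B j))"
  have finJ: "finite J" unfolding J_def by auto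
  define b where "b = (\<lambda>(j, m). Poly_Mapping.lookup (B j) m)"
  \<comment> \<open>The certificate has complex coefficients; rational ones that satisfy the same
    identity at rational points of the chart suffice.\<close>
  obtain b' where b': "\<forall>u\<in>J. b' u \<in> \<rat>"
    and rel: "\<forall>a c. (\<forall>u\<in>J. a u \<in> \<rat>) \<and> c \<in> \<rat> \<and> (\<Sum>u\<in>J. a u * b u) = c \<longrightarrow> (\<Sum>u\<in>J. a u * b' u) = c"
    using linear_relations_descend[OF is_subfield_Rats finJ, of b] by (elim exE conjE)
  have id: "(\<Sum>(j, m)\<in>J. (mp_eval (\<psi> j) x * mon_val x m) * b' (j, m)) = 1"
    if "x $ i0 = 1" "\<And>i. x $ i \<in> \<rat>" for x :: "complex ^ 'n"
  proof -
    have "1 = mp_eval ((\<Sum>j\<in>UNIV. B j * \<psi> j) + C * (mp_var i0 - 1)) x" by (simp flip: one)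
    also have "\<dots> = (\<Sum>j\<in>UNIV. \<Sum>m\<in>Poly_Mapping.keys (B j). (mp_eval (\<psi> j) x * mon_val x m) * b (j, m))"
      using that(1)
      by (simp add: mp_eval_add mp_eval_sum mp_eval_mult mp_eval_diff mp_eval_def[of "B _"] b_def sum_distrib_left sum_distrib_right mult_ac)
    also have "\<dots> = (\<Sum>u\<in>J. (case u of (j, m) \<Rightarrow> mp_eval (\<psi> j) x * mon_val x m) * b u)"
      unfolding J_def by (subst sum.Sigma) (auto simp: case_prod_unfold)
    finally have "(\<Sum>u\<in>J. (case u of (j, m) \<Rightarrow> mp_eval (\<psi> j) x * mon_val x m) * b' u) = 1"
      using that(2) rat
      by (intro rel[rule_format] conjI ballI) (auto simp: split_beta intro!: Rats_mult mon_val_Rats mp_eval_in_subfield[OF is_subfield_Rats])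
    then show ?thesis by (simp add: case_prod_unfold)
  qed
  obtain A where A: "A > 0" "\<And>u. u \<in> J \<Longrightarrow> of_int A * b' u \<in> \<int>"
    using Rats_finite_common_denominator[OF finJ, of b'] b' by auto
  define D where "D = (\<Sum>(j, m)\<in>J. mon_degree m)"
  have D: "mon_degree m \<le> D" if "(j, m) \<in> J" for j m
    using member_le_sum[of "(j, m)" J "\<lambda>(j, m). mon_degree m"] that finJ by (auto simp: D_def)
  \<comment> \<open>\<open>q + D\<close> clears all powers of \<open>z i0\<close> from the
    denominators; the successor makes \<open>M\<close> positive, so that the case
    \<open>z i0 = 0\<close> is divisibility of 0.\<close>
  define M where "M = Suc (q + D)"
  show ?thesis
  proof (intro exI[of _ A] exI[of _ M] conjI allI impI)
    show "A > 0" by fact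
    fix z c assume "\<forall>i. \<exists>w. mp_eval (\<psi> i) (int_vec z) = of_int (c * w)"
    then obtain w where w: "\<And>i. mp_eval (\<psi> i) (int_vec z) = of_int (c * w i)" by metis
    show "c dvd A * z i0 ^ M"
    proof (cases "z i0 = 0")
      case False
      define t :: complex where "t = of_int (z i0)"
      have t: "t \<noteq> 0" using False by (simp add: t_def)
      define x where "x = inverse t *s int_vec z"
      have xQ: "x $ i \<in> \<rat>" for i by (simp add: x_def t_def)
      have x0: "x $ i0 = 1" using t by (simp add: x_def t_def)
      have psi: "mp_eval (\<psi> j) x = inverse t ^ q * of_int (c * w j)" for j
        unfolding x_def mp_eval_homogeneous[OF hom] w ..
      define zm where "zm m = (\<Prod>i\<in>UNIV. z i ^ Poly_Mapping.lookup m i)" for m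
      have mon: "mon_val x m = inverse t ^ mon_degree m * of_int (zm m)" for m
        by (simp add: x_def zm_def power_mult_distrib prod.distrib power_sum mon_degree_def)
      define s where "s = (\<lambda>(j, m). of_int (w j * zm m) * t ^ (M - q - mon_degree m) * (of_int A * b' (j, m)))"
      have eq: "of_int A * t ^ M = of_int c * (\<Sum>u\<in>J. s u)"
      proof -
        have "of_int A * t ^ M = (\<Sum>u\<in>J. of_int A * t ^ M * (case u of (j, m) \<Rightarrow> (mp_eval (\<psi> j) x * mon_val x m) * b' (j, m)))"
          using id[OF x0 xQ] by (simp only: sum_distrib_left [symmetric] mult_1_right)
        also have "\<dots> = (\<Sum>u\<in>J. of_int c * s u)"
        proof (rule sum.cong[OF refl])
          fix u assume u: "u \<in> J"
          obtain j m where jm: "u = (j, m)" by (cases u)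
          have "mon_degree m \<le> D" using D u jm by blast
          then have "t ^ M = t ^ q * t ^ mon_degree m * t ^ (M - q - mon_degree m)"
            by (simp add: M_def flip: power_add)
          then show "of_int A * t ^ M * (case u of (j, m) \<Rightarrow> (mp_eval (\<psi> j) x * mon_val x m) * b' (j, m)) = of_int c * s u"
            using t unfolding jm prod.case psi mon s_def by (simp add: field_simps)
        qed
        finally show ?thesis by (simp only: sum_distrib_left)
      qed
      have "(\<Sum>u\<in>J. s u) \<in> \<int>"
      proof (rule Ints_sum)
        fix u assume "u \<in> J"
        then show "s u \<in> \<int>" using A(2)[of u]
          by (cases u) (auto simp: s_def t_def simp del: of_int_mult intro!: Ints_mult Ints_power)
      qed
      then obtain r where "(\<Sum>u\<in>J. s u) = of_int r" by (elim Ints_cases)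
      with eq have "of_int (A * z i0 ^ M) = (of_int (c * r) :: complex)" by (simp add: t_def)
      then have "A * z i0 ^ M = c * r" by (simp only: of_int_eq_iff)
      then show ?thesis by simp
    qed (simp add: M_def)
  qed
qed

text \<open>The factor \<open>c\<close> divides \<open>B * z i ^ M i\<close> for every
  \<open>i\<close>, hence \<open>B\<close> times the gcd of these powers, and that gcd is a unit for
  coprime \<open>z\<close>. The exponents may vary with the coordinate.\<close>

lemma bounded_common_factor:
  fixes \<psi> :: "'n::finite \<Rightarrow> 'n mpoly"
  assumes zero: "\<And>x. (\<forall>i. mp_eval (\<psi> i) x = 0) \<Longrightarrow> x = 0"
    and hom: "\<And>i. homogeneous q (\<psi> i)" and rat: "\<And>i. coeffs_in \<rat> (\<psi> i)"
  shows "\<exists>A>0. \<forall>z c. (\<forall>p. Factorial_Ring.prime p \<longrightarrow> (\<exists>i. \<not> p dvd z i)) \<and>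
      (\<forall>i. \<exists>w. mp_eval (\<psi> i) (int_vec z) = of_int (c * w)) \<longrightarrow> c dvd (A :: int)"
proof -
  have "\<forall>i. \<exists>A M. A > 0 \<and> (\<forall>z c. (\<forall>i. \<exists>w. mp_eval (\<psi> i) (int_vec z) = of_int (c * w)) \<longrightarrow> c dvd A * z i ^ M)"
  proof
    fix i
    show "\<exists>A M. A > 0 \<and> (\<forall>z c. (\<forall>i. \<exists>w. mp_eval (\<psi> i) (int_vec z) = of_int (c * w)) \<longrightarrow> c dvd A * z i ^ M)"
      by (rule common_factor_dvd_power[OF _ hom rat]) (rule zero)
  qed
  then obtain A M where A: "\<And>i. A i > 0"
    "\<And>i z c. (\<forall>i. \<exists>w. mp_eval (\<psi> i) (int_vec z) = of_int (c * w)) \<Longrightarrow> c dvd A i * z i ^ M i"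
    by metis
  define B where "B = (\<Prod>i\<in>UNIV. A i)"
  show ?thesis
  proof (intro exI[of _ B] conjI allI impI; (elim conjE)?)
    show B: "B > 0" unfolding B_def using A(1) by (simp add: prod_pos)
    fix z c
    assume z: "\<forall>p. Factorial_Ring.prime p \<longrightarrow> (\<exists>i. \<not> p dvd z i)" and c: "\<forall>i. \<exists>w. mp_eval (\<psi> i) (int_vec z) = of_int (c * w)"
    have dvd: "c dvd B * z i ^ M i" for i
    proof -
      have "A i dvd B" unfolding B_def by (intro dvd_prodI) auto
      then show ?thesis using A(2)[OF c] by (meson dvd_trans dvd_refl mult_dvd_mono)
    qed
    define G where "G = Gcd (range (\<lambda>i. z i ^ M i))"
    have "c dvd Gcd ((*) B ` range (\<lambda>i. z i ^ M i))"
      by (rule Gcd_greatest) (use dvd in auto)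
    also have "\<dots> = normalize (B * G)" unfolding G_def by (rule Gcd_mult)
    finally have cB: "c dvd B * G" by simp
    have "is_unit G"
    proof (rule ccontr)
      assume nu: "\<not> is_unit G"
      have "\<exists>p. Factorial_Ring.prime p \<and> p dvd G"
      proof (cases "G = 0")
        \<comment> \<open>Every prime divides \<open>G\<close> here; 2 is an arbitrary
          choice.\<close>
        case True then show ?thesis by (intro exI[of _ 2]) simp
      next
        case False then show ?thesis using nu prime_divisor_exists by blast
      qed
      then obtain p where p: "Factorial_Ring.prime p" "p dvd G" by blast
      obtain i where "\<not> p dvd z i" using z p by blast
      moreover have "p dvd z i ^ M i" using p(2) unfolding G_def by (meson Gcd_dvd dvd_trans rangeI)
      ultimately show False using p(1) prime_dvd_power by blast
    qed
    then show "c dvd B" using cB by (simp add: dvd_mult_unit_iff)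
  qed
qed


section \<open>Images of hypersurfaces\<close>

lemma finite_mon_degree: "finite {m :: 'n::finite \<Rightarrow>\<^sub>0 nat. mon_degree m = t}"
proof (rule finite_subset[OF _ finite_bounded_exponents[of t]], safe)
  fix m :: "'n \<Rightarrow>\<^sub>0 nat" and i
  show "Poly_Mapping.lookup m i \<le> mon_degree m"
    unfolding mon_degree_def by (rule member_le_sum) auto
qed

text \<open>All exponents but that of \<open>i0\<close> range freely over \<open>{..t}\<close>; the
  exponent of \<open>i0\<close> fills the degree up, which is possible because the others add up to
  at most \<open>N * t\<close>.\<close>

lemma card_mon_degree_lower:
  assumes "CARD('n::finite) = N + 1"
  shows "(t + 1) ^ N \<le> card {m :: 'n \<Rightarrow>\<^sub>0 nat. mon_degree m = N * t}"
proof -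
  obtain i0 :: 'n where True by blast
  define F where "F = PiE (UNIV - {i0}) (\<lambda>_. {..t})"
  define g where "g f = Abs_poly_mapping (\<lambda>i. if i = i0 then N * t - (\<Sum>j\<in>UNIV - {i0}. f j) else f i)" for f
  have cardF: "card F = (t + 1) ^ N"
    unfolding F_def using assms by (simp add: card_PiE card_Diff_singleton)
  have lk: "Poly_Mapping.lookup (g f) i = (if i = i0 then N * t - (\<Sum>j\<in>UNIV - {i0}. f j) else f i)" for f i
    unfolding g_def by (subst lookup_Abs_poly_mapping) auto
  have "card F \<le> card {m :: 'n \<Rightarrow>\<^sub>0 nat. mon_degree m = N * t}"
  proof (rule card_inj_on_le)
    show "inj_on g F"
    proof (rule inj_onI)
      fix f f' assume f: "f \<in> F" "f' \<in> F" and eq: "g f = g f'"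
      show "f = f'"
      proof (rule PiE_ext[OF f[unfolded F_def]])
        fix i assume "i \<in> UNIV - {i0}"
        then show "f i = f' i" using lk[of f i] lk[of f' i] eq by simp
      qed
    qed
    show "g ` F \<subseteq> {m. mon_degree m = N * t}"
    proof safe
      fix f assume f: "f \<in> F"
      have "(\<Sum>j\<in>UNIV - {i0}. f j) \<le> (\<Sum>j\<in>UNIV - {i0}. t)"
        using f by (intro sum_mono) (auto simp: F_def)
      also have "\<dots> = N * t" using assms by (simp add: card_Diff_singleton)
      finally have le: "(\<Sum>j\<in>UNIV - {i0}. f j) \<le> N * t" .
      have "mon_degree (g f) = Poly_Mapping.lookup (g f) i0 + (\<Sum>j\<in>UNIV - {i0}. Poly_Mapping.lookup (g f) j)"
        unfolding mon_degree_def by (rule sum.remove) auto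
      also have "(\<Sum>j\<in>UNIV - {i0}. Poly_Mapping.lookup (g f) j) = (\<Sum>j\<in>UNIV - {i0}. f j)"
        by (rule sum.cong) (auto simp: lk)
      finally show "mon_degree (g f) = N * t" using le by (simp add: lk)
    qed
  qed (rule finite_mon_degree)
  with cardF show ?thesis by simp
qed

text \<open>Monomials whose exponent at \<open>i0\<close> is at least \<open>e\<close> correspond to
  monomials of degree \<open>M - e\<close>. The others are determined by this exponent, below
  \<open>e\<close>, and by \<open>N - 1\<close> further exponents of size at most \<open>M\<close>,
  the last one being forced. This bounds the codimension, in degree \<open>M\<close>, of the
  multiples of a form of degree \<open>e\<close>.\<close>

lemma card_mon_degree_upper:
  assumes "CARD('n::finite) = N + 1" "N \<ge> 1" "e \<le> M"
  shows "card {m :: 'n \<Rightarrow>\<^sub>0 nat. mon_degree m = M} \<le> card {m :: 'n \<Rightarrow>\<^sub>0 nat. mon_degree m = M - e} + e * (M + 1) ^ (N - 1)"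
proof -
  obtain i0 :: 'n where True by blast
  have "card (UNIV - {i0}) \<noteq> 0" using assms by (simp add: card_Diff_singleton)
  then obtain i1 where i1: "i1 \<noteq> i0" by (metis Diff_iff UNIV_I card_eq_0_iff ex_in_conv insertI1 singletonD)
  define Xm where "Xm = {m :: 'n \<Rightarrow>\<^sub>0 nat. mon_degree m = M \<and> Poly_Mapping.lookup m i0 \<ge> e}"
  define Y where "Y = {m :: 'n \<Rightarrow>\<^sub>0 nat. mon_degree m = M \<and> Poly_Mapping.lookup m i0 < e}"
  have fin: "finite Xm" "finite Y" unfolding Xm_def Y_def
    by (auto intro: finite_subset[OF _ finite_mon_degree[of M]])
  have "card Xm \<le> card {m :: 'n \<Rightarrow>\<^sub>0 nat. mon_degree m = M - e}"
  proof (rule card_inj_on_le)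
    define g where "g m = minus m (Poly_Mapping.single i0 e)" for m :: "'n \<Rightarrow>\<^sub>0 nat"
    have g: "m = g m + Poly_Mapping.single i0 e" if "m \<in> Xm" for m
      using that by (intro poly_mapping_eqI) (auto simp: g_def lookup_add lookup_minus lookup_single when_def Xm_def)
    show "inj_on g Xm" by (intro inj_onI) (metis g)
    show "g ` Xm \<subseteq> {m. mon_degree m = M - e}"
    proof safe
      fix m assume m: "m \<in> Xm"
      have "M = mon_degree (g m + Poly_Mapping.single i0 e)" using m g[OF m] by (simp add: Xm_def)
      then show "mon_degree (g m) = M - e" by (simp add: mon_degree_add)
    qed
  qed (rule finite_mon_degree)
  moreover have "card Y \<le> card ({..<e} \<times> PiE (- {i0, i1}) (\<lambda>_. {..M}))"
  proof (rule card_inj_on_le)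
    define g where "g m = (Poly_Mapping.lookup m i0, restrict (Poly_Mapping.lookup m) (- {i0, i1}))" for m :: "'n \<Rightarrow>\<^sub>0 nat"
    show "inj_on g Y"
    proof (rule inj_onI, rule poly_mapping_eqI)
      fix m m' i assume m: "m \<in> Y" "m' \<in> Y" and eq: "g m = g m'"
      have ne: "Poly_Mapping.lookup m j = Poly_Mapping.lookup m' j" if "j \<noteq> i1" for j
      proof (cases "j = i0")
        case False
        with eq that show ?thesis unfolding g_def by (auto dest!: fun_cong[of _ _ j])
      qed (use eq in \<open>simp add: g_def\<close>)
      have sp: "mon_degree a = Poly_Mapping.lookup a i1 + (\<Sum>j\<in>UNIV - {i1}. Poly_Mapping.lookup a j)" for a :: "'n \<Rightarrow>\<^sub>0 nat"
        unfolding mon_degree_def by (rule sum.remove) auto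
      have "(\<Sum>j\<in>UNIV - {i1}. Poly_Mapping.lookup m j) = (\<Sum>j\<in>UNIV - {i1}. Poly_Mapping.lookup m' j)"
        by (rule sum.cong) (auto simp: ne)
      with sp[of m] sp[of m'] m have "Poly_Mapping.lookup m i1 = Poly_Mapping.lookup m' i1"
        by (simp add: Y_def)
      with ne show "Poly_Mapping.lookup m i = Poly_Mapping.lookup m' i" by (cases "i = i1") auto
    qed
    have "Poly_Mapping.lookup m j \<le> mon_degree m" for m :: "'n \<Rightarrow>\<^sub>0 nat" and j
      unfolding mon_degree_def by (rule member_le_sum) auto
    then show "g ` Y \<subseteq> {..<e} \<times> PiE (- {i0, i1}) (\<lambda>_. {..M})"
      unfolding g_def Y_def
      by (intro image_subsetI SigmaI) (simp_all only: fst_conv snd_conv restrict_PiE_iff, auto)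
  qed (auto intro!: finite_PiE)
  moreover have "card ({..<e} \<times> PiE (- {i0, i1}) (\<lambda>_. {..M})) = e * (M + 1) ^ (N - 1)"
  proof -
    have "card (- {i0, i1}) = N - 1"
      unfolding Compl_eq_Diff_UNIV using assms i1 by (subst card_Diff_subset) auto
    then show ?thesis by (simp add: card_PiE card_cartesian_product)
  qed
  moreover have "{m :: 'n \<Rightarrow>\<^sub>0 nat. mon_degree m = M} = Xm \<union> Y" by (auto simp: Xm_def Y_def)
  moreover have "card (Xm \<union> Y) \<le> card Xm + card Y" by (rule card_Un_le)
  ultimately show ?thesis by simp
qed

text \<open>The forms of degree \<open>D\<close> have dimension of order \<open>D ^ N\<close>, and their pullbacks modulo \<open>H\<close> lie in a
  space of dimension of order \<open>D ^ (N - 1)\<close>.\<close>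

lemma hypersurface_image_in_hypersurface:
  fixes \<psi> :: "'n::finite \<Rightarrow> 'n mpoly"
  assumes card: "CARD('n) = N + 1" "N \<ge> 1"
    and H: "H \<noteq> 0" "homogeneous e H" and hom: "\<And>i. homogeneous q (\<psi> i)" and q: "q \<ge> 1"
  shows "\<exists>H' D. H' \<noteq> 0 \<and> homogeneous D H' \<and>
    (\<forall>x. mp_eval H x = 0 \<longrightarrow> mp_eval H' (\<chi> i. mp_eval (\<psi> i) x) = 0)"
proof -
  define Mon where "Mon t = {m :: 'n \<Rightarrow>\<^sub>0 nat. mon_degree m = t}" for t
  have fin [simp]: "finite (Mon t)" for t unfolding Mon_def by (rule finite_mon_degree)
  \<comment> \<open>The first summand yields \<open>t + 1 > e * (q * N) ^ (N - 1)\<close>, so that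
    \<open>(t + 1) ^ N\<close> exceeds the codimension bound \<open>e * (M + 1) ^ (N - 1)\<close>;
    the second one ensures \<open>e \<le> M\<close>.\<close>
  define t where "t = e * (q * N) ^ (N - 1) + e"
  define D where "D = N * t"
  define M where "M = q * D"
  have "1 * t \<le> (q * N) * t" using q card(2) by (intro mult_right_mono) (simp_all add: Suc_leI)
  then have eM: "e \<le> M" by (simp add: M_def D_def t_def algebra_simps)
  have "M + 1 \<le> (q * N) * (t + 1)" using q card(2) by (simp add: M_def D_def algebra_simps Suc_leI)
  then have "e * (M + 1) ^ (N - 1) \<le> e * ((q * N) * (t + 1)) ^ (N - 1)"
    by (intro mult_left_mono power_mono) auto
  also have "\<dots> = (e * (q * N) ^ (N - 1)) * (t + 1) ^ (N - 1)"
    by (simp only: power_mult_distrib mult.assoc)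
  also have "\<dots> < (t + 1) * (t + 1) ^ (N - 1)"
    by (intro mult_strict_right_mono) (auto simp: t_def)
  also have "\<dots> = (t + 1) ^ N" using card(2) by (simp flip: power_Suc)
  also have "\<dots> \<le> card (Mon D)" unfolding Mon_def D_def by (rule card_mon_degree_lower[OF card(1)])
  finally have lt: "e * (M + 1) ^ (N - 1) < card (Mon D)" .
  have "card (Mon M) \<le> card (Mon (M - e)) + e * (M + 1) ^ (N - 1)"
    unfolding Mon_def by (rule card_mon_degree_upper[OF card eM])
  also have "\<dots> < card (Mon D) + card (Mon (M - e))" using lt by simp
  also have "\<dots> = card (Sum_Type.Plus (Mon D) (Mon (M - e)))" by (simp add: card_Plus)
  finally have less: "card (Mon M) < card (Sum_Type.Plus (Mon D) (Mon (M - e)))" .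
  define Xm :: "('n \<Rightarrow>\<^sub>0 nat) \<Rightarrow> 'n mpoly" where "Xm m = Poly_Mapping.single m 1" for m
  \<comment> \<open>A relation among the \<open>V u\<close> says that the pullback of a form of
    degree \<open>D\<close> plus \<open>H\<close> times a form of degree \<open>M - e\<close> is
    zero. The form of degree \<open>D\<close> then vanishes on the image of the zero set of
    \<open>H\<close>.\<close>
  define V where "V u = (case u of Inl m \<Rightarrow> mp_subst \<psi> (Xm m) | Inr m \<Rightarrow> H * Xm m)" for u
  have Xh: "homogeneous (mon_degree m) (Xm m)" for m unfolding Xm_def by (rule homogeneous_single)
  have V: "Poly_Mapping.keys (V u) \<subseteq> Mon M" if "u \<in> Sum_Type.Plus (Mon D) (Mon (M - e))" for u
  proof -
    have "homogeneous M (V u)"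
    proof (cases u)
      case (Inl m)
      with that have "mon_degree m = D" by (auto simp: Mon_def)
      then show ?thesis unfolding Inl V_def M_def using homogeneous_subst[OF Xh[of m] hom] by simp
    next
      case (Inr m)
      with that have "mon_degree m = M - e" by (auto simp: Mon_def)
      then show ?thesis unfolding Inr V_def using homogeneous_mult[OF H(2) Xh[of m]] eM by simp
    qed
    then show ?thesis by (auto simp: homogeneous_def Mon_def)
  qed
  obtain c u0 where u0: "u0 \<in> Sum_Type.Plus (Mon D) (Mon (M - e))" "c u0 \<noteq> 0"
    and c: "\<And>m. m \<in> Mon M \<Longrightarrow> (\<Sum>u\<in>Sum_Type.Plus (Mon D) (Mon (M - e)). c u * Poly_Mapping.lookup (V u) m) = 0"
    using homogeneous_system_nontrivial[OF _ _ less, of "\<lambda>m u. Poly_Mapping.lookup (V u) m"] by auto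
  have "(\<Sum>u\<in>Sum_Type.Plus (Mon D) (Mon (M - e)). mp_const (c u) * V u) = 0"
  proof (rule poly_mapping_eqI)
    fix m
    show "Poly_Mapping.lookup (\<Sum>u\<in>Sum_Type.Plus (Mon D) (Mon (M - e)). mp_const (c u) * V u) m = Poly_Mapping.lookup 0 m"
    proof (cases "m \<in> Mon M")
      case False
      then have "m \<notin> Poly_Mapping.keys (V u)" if "u \<in> Sum_Type.Plus (Mon D) (Mon (M - e))" for u
        using V[OF that] by blast
      then have "Poly_Mapping.lookup (V u) m = 0" if "u \<in> Sum_Type.Plus (Mon D) (Mon (M - e))" for u
        using that by (simp add: in_keys_iff)
      then have "(\<Sum>u\<in>Sum_Type.Plus (Mon D) (Mon (M - e)). c u * Poly_Mapping.lookup (V u) m) = 0"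
        by (intro sum.neutral) auto
      then show ?thesis by (simp only: lookup_sum lookup_mp_const_mult lookup_zero)
    qed (simp only: lookup_sum lookup_mp_const_mult lookup_zero c)
  qed
  then have rel: "(\<Sum>m\<in>Mon D. mp_const (c (Inl m)) * mp_subst \<psi> (Xm m)) +
      (\<Sum>m\<in>Mon (M - e). mp_const (c (Inr m)) * (H * Xm m)) = 0"
    by (simp add: sum.Plus V_def)
  define A where "A = (\<Sum>m\<in>Mon D. mp_const (c (Inl m)) * Xm m)"
  define B where "B = (\<Sum>m\<in>Mon (M - e). mp_const (c (Inr m)) * Xm m)"
  have ev: "mp_eval A (\<chi> i. mp_eval (\<psi> i) x) + mp_eval H x * mp_eval B x = 0" for x
    using arg_cong[OF rel, of "\<lambda>p. mp_eval p x"]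
    unfolding A_def B_def by (simp add: mp_eval_add mp_eval_sum mp_eval_mult mp_eval_subst sum_distrib_left mult_ac)
  have lkXm: "Poly_Mapping.lookup (\<Sum>m\<in>S. mp_const (d m) * Xm m) m' = d m'" if "finite S" "m' \<in> S" for S d m'
  proof -
    have "Poly_Mapping.lookup (\<Sum>m\<in>S. mp_const (d m) * Xm m) m' = (\<Sum>m\<in>S. if m = m' then d m else 0)"
      unfolding lookup_sum lookup_mp_const_mult Xm_def lookup_single when_def by (intro sum.cong) auto
    then show ?thesis using that by simp
  qed
  \<comment> \<open>If \<open>A\<close> were zero, then \<open>H * B\<close> and hence
    \<open>B\<close> would be zero, and with them all coefficients of the relation.\<close>
  have "A \<noteq> 0"
  proof
    assume "A = 0"
    then have "mp_eval H x * mp_eval B x = 0" for x using ev[of x] by simp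
    then have "B = 0" using exists_nonvanishing[OF H(1), of B] by auto
    from u0(1) show False
    proof
      fix m assume "u0 = Inl m" "m \<in> Mon D"
      then show False using lkXm[of "Mon D" m "\<lambda>m. c (Inl m)"] u0(2) \<open>A = 0\<close> by (simp add: A_def)
    next
      fix m assume "u0 = Inr m" "m \<in> Mon (M - e)"
      then show False using lkXm[of "Mon (M - e)" m "\<lambda>m. c (Inr m)"] u0(2) \<open>B = 0\<close> by (simp add: B_def)
    qed
  qed
  moreover have "homogeneous D A"
    unfolding A_def
  proof (intro homogeneous_sum homogeneous_const_mult)
    fix m assume "m \<in> Mon D"
    then show "homogeneous D (Xm m)" using Xh[of m] by (simp add: Mon_def)
  qed
  moreover have "mp_eval A (\<chi> i. mp_eval (\<psi> i) x) = 0" if "mp_eval H x = 0" for x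
    using ev[of x] that by simp
  ultimately show ?thesis by blast
qed

section \<open>The field generated by an algebraic number\<close>

definition rpoly :: "rat poly \<Rightarrow> complex \<Rightarrow> complex" where
  "rpoly p z = poly (map_poly of_rat p) z"

lemma map_poly_of_rat_mult:
  "map_poly of_rat (p * q) = (map_poly of_rat p * map_poly of_rat q :: complex poly)"
  by (rule poly_eqI) (simp add: coeff_map_poly coeff_mult of_rat_sum of_rat_mult)

lemma map_poly_of_rat_add:
  "map_poly of_rat (p + q) = (map_poly of_rat p + map_poly of_rat q :: complex poly)"
  by (rule poly_eqI) (simp add: coeff_map_poly of_rat_add)

lemma degree_map_poly_of_rat [simp]:
  "Polynomial.degree (map_poly of_rat p :: complex poly) = Polynomial.degree p"
  by (rule degree_map_poly) simp

lemma map_poly_of_rat_eq_0_iff [simp]: "map_poly of_rat p = (0 :: complex poly) \<longleftrightarrow> p = 0"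
  by (simp add: poly_eq_iff coeff_map_poly)

lemma rpoly_add: "rpoly (p + q) z = rpoly p z + rpoly q z"
  by (simp add: rpoly_def map_poly_of_rat_add)

lemma rpoly_mult: "rpoly (p * q) z = rpoly p z * rpoly q z"
  by (simp add: rpoly_def map_poly_of_rat_mult)

lemma rpoly_pCons [simp]: "rpoly (pCons a p) z = of_rat a + z * rpoly p z"
  by (simp add: rpoly_def map_poly_pCons)

lemma rpoly_0 [simp]: "rpoly 0 z = 0"
  by (simp add: rpoly_def)

lemma rpoly_1 [simp]: "rpoly 1 z = 1"
  by (simp add: one_pCons)

lemma rpoly_minus: "rpoly (- p) z = - rpoly p z"
  using rpoly_add[of p "- p" z] by (simp add: add_eq_0_iff)

lemma rpoly_diff: "rpoly (p - q) z = rpoly p z - rpoly q z"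
  using rpoly_add[of p "- q" z] by (simp add: rpoly_minus)

lemma rpoly_smult: "rpoly (Polynomial.smult c p) z = of_rat c * rpoly p z"
  using rpoly_mult[of "[:c:]" p z] by simp

lemma infinite_range_of_rat: "infinite (range (of_rat :: rat \<Rightarrow> complex))"
  using finite_imageD[of "of_rat :: rat \<Rightarrow> complex" UNIV] infinite_UNIV_char_0[where 'a = rat]
  by (auto simp: inj_on_def)

lemma rpoly_altdef: "rpoly p z = (\<Sum>i\<le>Polynomial.degree p. of_rat (poly.coeff p i) * z ^ i)"
  by (simp add: rpoly_def poly_altdef coeff_map_poly)

lemma finite_rpoly_roots: "f \<noteq> 0 \<Longrightarrow> finite {z. rpoly f z = 0}"
  unfolding rpoly_def by (rule poly_roots_finite) simp

text \<open>By reciprocity, the product over the roots of \<open>f\<close> of the values of \<open>r = p mod f\<close> is, up to a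
  rational factor, the product over the roots of \<open>r\<close> of the values of \<open>f\<close>.\<close>

lemma prod_over_roots_rational:
  fixes n :: nat
  assumes "f \<noteq> 0" "map_poly of_rat f = Polynomial.smult c (\<Prod>i<n. [:- a i, 1:])"
  shows "(\<Prod>i<n. rpoly p (a i)) \<in> \<rat>"
  using assms
proof (induction n arbitrary: f c a p rule: less_induct)
  case (less n)
  define C where "C = map_poly (of_rat :: rat \<Rightarrow> complex) f"
  have c0: "c \<noteq> 0" using less.prems by auto
  have deg: "Polynomial.degree f = n"
  proof -
    have "Polynomial.degree (\<Prod>i<n. [:- a i, 1:]) = n"
      by (subst degree_prod_sum_eq) auto
    then show ?thesis using less.prems(2) c0 degree_map_poly_of_rat[of f] by simp
  qed
  have f_eval: "rpoly f y = c * (\<Prod>i<n. y - a i)" for y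
    by (simp add: rpoly_def less.prems(2) poly_prod)
  have cQ: "c \<in> \<rat>"
  proof -
    have "c = poly.coeff (map_poly of_rat f) n"
    proof -
      have "poly.coeff (\<Prod>i<n. [:- a i, 1:]) (Polynomial.degree (\<Prod>i<n. [:- a i, 1:])) = 1"
        by (simp add: lead_coeff_prod)
      moreover have "Polynomial.degree (\<Prod>i<n. [:- a i, 1:]) = n"
        by (subst degree_prod_sum_eq) auto
      ultimately show ?thesis by (simp add: less.prems(2))
    qed
    then show ?thesis by (simp add: coeff_map_poly)
  qed
  define r where "r = p mod f"
  have pr: "rpoly p (a i) = rpoly r (a i)" if "i < n" for i
  proof -
    have "rpoly f (a i) = 0" using that by (auto simp: f_eval)
    moreover have "rpoly p (a i) = rpoly (p div f * f + r) (a i)" by (simp add: r_def)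
    ultimately show ?thesis by (simp only: rpoly_add rpoly_mult mult_zero_right add_0)
  qed
  have "(\<Prod>i<n. rpoly r (a i)) \<in> \<rat>"
  proof (cases "r = 0 \<or> n = 0")
    case True
    then show ?thesis by (cases "n = 0") (auto simp: power_0_left)
  next
    case False
    then have dr: "Polynomial.degree r < n"
      using degree_mod_less[OF less.prems(1), of p] deg by (auto simp: r_def)
    define m where "m = Polynomial.degree r"
    \<comment> \<open>The roots of \<open>r\<close> may repeat, which is why the statement uses
      indexed families of roots and not sets.\<close>
    obtain b where b: "Polynomial.smult (poly.coeff (map_poly of_rat r) m) (\<Prod>i<m. [:- b i, 1:]) = (map_poly of_rat r :: complex poly)"
      using complex_poly_decompose'[of "map_poly of_rat r"] by (auto simp: m_def)
    define l where "l = (of_rat (poly.coeff r m) :: complex)"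
    have r_eval: "rpoly r x = l * (\<Prod>j<m. x - b j)" for x
      unfolding rpoly_def by (subst b [symmetric]) (simp add: poly_prod l_def coeff_map_poly)
    have IH: "(\<Prod>j<m. rpoly f (b j)) \<in> \<rat>"
      by (rule less.IH[of m r l b]) (use False dr b in \<open>auto simp: m_def l_def coeff_map_poly\<close>)
    have "(\<Prod>i<n. rpoly r (a i)) = l ^ n * (\<Prod>i<n. \<Prod>j<m. (- 1) * (b j - a i))"
      by (simp add: r_eval prod.distrib)
    also have "(\<Prod>i<n. \<Prod>j<m. (- 1) * (b j - a i)) = ((- 1) ^ m) ^ n * (\<Prod>i<n. \<Prod>j<m. (b j - a i))"
      by (simp only: prod.distrib prod_constant card_lessThan)
    also have "(\<Prod>i<n. \<Prod>j<m. (b j - a i)) = (\<Prod>j<m. \<Prod>i<n. (b j - a i))"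
      by (rule prod.swap)
    also have "\<dots> = (\<Prod>j<m. rpoly f (b j) / c)"
      using c0 by (simp add: f_eval)
    also have "\<dots> = (\<Prod>j<m. rpoly f (b j)) / c ^ m"
      by (simp add: prod_dividef)
    finally have "(\<Prod>i<n. rpoly r (a i)) = l ^ n * (((- 1) ^ m) ^ n * ((\<Prod>j<m. rpoly f (b j)) / c ^ m))" .
    then show ?thesis using IH cQ by (auto simp: l_def)
  qed
  moreover have "(\<Prod>i<n. rpoly p (a i)) = (\<Prod>i<n. rpoly r (a i))"
    using pr by (intro prod.cong) auto
  ultimately show ?case by simp
qed

text \<open>The ring generated by \<open>\<theta>\<close> over the rationals; for algebraic
  \<open>\<theta>\<close> it is a field (\<open>is_subfield_adj\<close>).\<close>

definition adj :: "complex \<Rightarrow> complex set" where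
  "adj \<theta> = range (\<lambda>p. rpoly p \<theta>)"

lemma rpoly_in_adj [simp]: "rpoly p \<theta> \<in> adj \<theta>"
  by (simp add: adj_def)

lemma self_in_adj: "\<theta> \<in> adj \<theta>"
  using rpoly_in_adj[of "[:0, 1:]" \<theta>] by simp

lemma Rats_subset_adj: "\<rat> \<subseteq> adj \<theta>"
proof
  fix x :: complex assume "x \<in> \<rat>"
  then obtain q where "x = of_rat q" by (elim Rats_cases)
  then show "x \<in> adj \<theta>" using rpoly_in_adj[of "[:q:]" \<theta>] by simp
qed

text \<open>A generator of the ideal of relations of \<open>\<theta>\<close>, determined up to a
  rational factor. Irreducibility is a consequence and is used in the form of
  \<open>is_minpoly_bezout\<close>.\<close>

definition is_minpoly :: "rat poly \<Rightarrow> complex \<Rightarrow> bool" where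
  "is_minpoly f \<theta> \<longleftrightarrow> f \<noteq> 0 \<and> (\<forall>p. rpoly p \<theta> = 0 \<longleftrightarrow> f dvd p)"

lemma algebraic_iff_rpoly: "Polynomial.algebraic \<theta> \<longleftrightarrow> (\<exists>p. p \<noteq> 0 \<and> rpoly p \<theta> = 0)"
proof
  assume "Polynomial.algebraic \<theta>"
  then obtain p where p: "\<And>i. poly.coeff p i \<in> \<rat>" "p \<noteq> 0" "poly p \<theta> = 0"
    unfolding algebraic_altdef by blast
  obtain q where q: "p = map_poly of_rat q" using ratpolyE[OF p(1)] by blast
  then show "\<exists>p. p \<noteq> 0 \<and> rpoly p \<theta> = 0"
    using p by (intro exI[of _ q]) (auto simp: rpoly_def)
next
  assume "\<exists>p. p \<noteq> 0 \<and> rpoly p \<theta> = 0"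
  then obtain p where "p \<noteq> 0" "rpoly p \<theta> = 0" by blast
  then show "Polynomial.algebraic \<theta>"
    unfolding algebraic_altdef
    by (intro exI[of _ "map_poly of_rat p"]) (auto simp: rpoly_def coeff_map_poly)
qed

lemma is_minpoly_exists:
  assumes "Polynomial.algebraic \<theta>"
  shows "\<exists>f. is_minpoly f \<theta>"
proof -
  from assms have "\<exists>p. p \<noteq> 0 \<and> rpoly p \<theta> = 0" by (simp add: algebraic_iff_rpoly)
  then obtain f where f: "f \<noteq> 0" "rpoly f \<theta> = 0"
    and min: "\<And>p. p \<noteq> 0 \<and> rpoly p \<theta> = 0 \<Longrightarrow> Polynomial.degree f \<le> Polynomial.degree p"
    using ex_has_least_nat[of "\<lambda>p. p \<noteq> 0 \<and> rpoly p \<theta> = 0" _ Polynomial.degree] by blast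
  have "f dvd p" if "rpoly p \<theta> = 0" for p
  proof -
    have "rpoly (p div f * f + p mod f) \<theta> = 0" using that by simp
    then have "rpoly (p mod f) \<theta> = 0" using f(2) by (simp only: rpoly_add rpoly_mult mult_zero_right add_0)
    then have "p mod f = 0"
      using min[of "p mod f"] degree_mod_less[OF f(1), of p] by (metis leD)
    then show ?thesis by (simp add: mod_eq_0_iff_dvd)
  qed
  moreover have "rpoly p \<theta> = 0" if "f dvd p" for p
    using that f(2) by (auto simp: rpoly_mult elim!: dvdE)
  ultimately show ?thesis using f(1) unfolding is_minpoly_def by blast
qed

text \<open>The gcd of \<open>f\<close> and \<open>p\<close> does not vanish at
  \<open>\<theta>\<close>, so the complementary factor of \<open>f\<close> does and is divisible by
  \<open>f\<close>; degrees force the gcd to be constant.\<close>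

lemma is_minpoly_bezout:
  assumes f: "is_minpoly f \<theta>" and "rpoly p \<theta> \<noteq> 0"
  shows "\<exists>u v. u * f + v * p = 1"
proof -
  define g where "g = gcd f p"
  have "g dvd f" "g dvd p" by (simp_all add: g_def)
  then obtain h where h: "f = g * h" by (elim dvdE)
  have g0: "rpoly g \<theta> \<noteq> 0" using \<open>g dvd p\<close> assms(2) by (auto simp: rpoly_mult elim!: dvdE)
  have "rpoly f \<theta> = 0" using f by (simp add: is_minpoly_def)
  then have "rpoly h \<theta> = 0" using g0 by (simp add: h rpoly_mult)
  then have "f dvd h" using f by (simp add: is_minpoly_def)
  moreover have "f \<noteq> 0" using f by (simp add: is_minpoly_def)
  ultimately have "Polynomial.degree g = 0"
    using dvd_imp_degree_le[of f h] h by (auto simp: degree_mult_eq)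
  then obtain c where c: "g = [:c:]" by (metis degree_eq_zeroE)
  with \<open>f \<noteq> 0\<close> h have "c \<noteq> 0" by auto
  define u v where "u = fst (bezout_coefficients f p)" and "v = snd (bezout_coefficients f p)"
  have "u * f + v * p = [:c:]" unfolding u_def v_def bezout_coefficients_fst_snd c [symmetric] g_def ..
  then have "[:1 / c:] * (u * f + v * p) = [:1 / c:] * [:c:]" by simp
  also have "\<dots> = 1" using \<open>c \<noteq> 0\<close> by (simp add: one_pCons)
  finally show ?thesis
    by (intro exI[of _ "[:1 / c:] * u"] exI[of _ "[:1 / c:] * v"]) (simp add: algebra_simps)
qed

text \<open>All roots of \<open>f\<close> satisfy the same rational relations; this is what makes
  \<open>emb\<close> well defined.\<close>

lemma is_minpoly_rpoly_eq_0_iff: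
  assumes f: "is_minpoly f \<theta>" and "rpoly f \<rho> = 0"
  shows "rpoly p \<rho> = 0 \<longleftrightarrow> rpoly p \<theta> = 0"
proof
  assume "rpoly p \<theta> = 0"
  then have "f dvd p" using f by (simp add: is_minpoly_def)
  then show "rpoly p \<rho> = 0" using assms(2) by (auto simp: rpoly_mult elim!: dvdE)
next
  assume 0: "rpoly p \<rho> = 0"
  show "rpoly p \<theta> = 0"
  proof (rule ccontr)
    assume "rpoly p \<theta> \<noteq> 0"
    then obtain u v where uv: "u * f + v * p = 1" using is_minpoly_bezout[OF f] by blast
    have "rpoly (u * f + v * p) \<rho> = 0" using 0 assms(2) by (simp add: rpoly_add rpoly_mult)
    with uv show False by simp
  qed
qed

lemma is_subfield_adj:
  assumes "Polynomial.algebraic \<theta>"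
  shows "is_subfield (adj \<theta>)"
proof -
  obtain f where f: "is_minpoly f \<theta>" using is_minpoly_exists[OF assms] by blast
  have inv: "inverse (rpoly p \<theta>) \<in> adj \<theta>" for p
  proof (cases "rpoly p \<theta> = 0")
    case True
    then show ?thesis using Rats_subset_adj[of \<theta>] by auto
  next
    case False
    then obtain u v where uv: "u * f + v * p = 1" using is_minpoly_bezout[OF f] by blast
    have "rpoly f \<theta> = 0" using f by (simp add: is_minpoly_def)
    then have "rpoly v \<theta> * rpoly p \<theta> = rpoly (u * f + v * p) \<theta>" by (simp add: rpoly_add rpoly_mult)
    then have "rpoly v \<theta> = inverse (rpoly p \<theta>)" using False uv by (simp add: field_simps)
    then show ?thesis by (metis rpoly_in_adj)
  qed
  show ?thesis
    unfolding is_subfield_def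
  proof (intro conjI ballI)
    show "0 \<in> adj \<theta>" "1 \<in> adj \<theta>" using Rats_subset_adj[of \<theta>] by auto
    fix a assume "a \<in> adj \<theta>"
    then obtain p where p: "a = rpoly p \<theta>" by (auto simp: adj_def)
    show "inverse a \<in> adj \<theta>" unfolding p by (rule inv)
    fix b assume "b \<in> adj \<theta>"
    then obtain q where q: "b = rpoly q \<theta>" by (auto simp: adj_def)
    show "a - b \<in> adj \<theta>" "a * b \<in> adj \<theta>"
      unfolding p q rpoly_diff [symmetric] rpoly_mult [symmetric] by simp_all
  qed
qed

lemma adj_subset:
  assumes "is_subfield k" "\<rat> \<subseteq> k" "\<theta> \<in> k"
  shows "adj \<theta> \<subseteq> k"
proof
  fix x assume "x \<in> adj \<theta>"
  then obtain p where "x = rpoly p \<theta>" by (auto simp: adj_def)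
  then show "x \<in> k" unfolding rpoly_altdef using assms
    by (auto intro!: is_subfield_sum is_subfieldD(4) is_subfield_power)
qed

text \<open>The derivative has smaller degree than \<open>f\<close>, so it does not vanish at
  \<open>\<theta>\<close> and hence at no other root of \<open>f\<close>.\<close>

lemma minpoly_rsquarefree:
  assumes f: "is_minpoly f \<theta>"
  shows "rsquarefree (map_poly of_rat f :: complex poly)"
proof -
  have f0: "f \<noteq> 0" "rpoly f \<theta> = 0" using f by (auto simp: is_minpoly_def)
  have "Polynomial.degree f \<noteq> 0"
  proof
    assume "Polynomial.degree f = 0"
    then obtain c where "f = [:c:]" by (metis degree_eq_zeroE)
    with f0 show False by simp
  qed
  then have p0: "pderiv f \<noteq> 0" by (simp add: pderiv_eq_0_iff)
  have "\<not> f dvd pderiv f"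
    using dvd_imp_degree_le[OF _ p0, of f] \<open>Polynomial.degree f \<noteq> 0\<close> by (auto simp: degree_pderiv)
  then have ne: "rpoly (pderiv f) \<theta> \<noteq> 0" using f by (simp add: is_minpoly_def)
  have "pderiv (map_poly of_rat f) = (map_poly of_rat (pderiv f) :: complex poly)"
    by (rule poly_eqI) (simp add: coeff_pderiv coeff_map_poly of_rat_mult of_rat_add)
  then show ?thesis
    using is_minpoly_rpoly_eq_0_iff[OF f, of _ "pderiv f"] ne
    by (auto simp: rsquarefree_roots rpoly_def)
qed

text \<open>The roots are simple, so the root set indexes each linear factor of \<open>f\<close>
  exactly once and \<open>prod_over_roots_rational\<close> applies.\<close>

lemma norm_rational:
  assumes f: "is_minpoly f \<theta>"
  shows "(\<Prod>\<rho> | rpoly f \<rho> = 0. rpoly p \<rho>) \<in> \<rat>"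
proof -
  have f0: "f \<noteq> 0" using f by (auto simp: is_minpoly_def)
  define R where "R = {\<rho>. rpoly f \<rho> = 0}"
  have fin: "finite R" unfolding R_def by (rule finite_rpoly_roots[OF f0])
  then obtain a where a: "bij_betw a {..<card R} R"
    using bij_betw_from_nat_into_finite by (metis ex_bij_betw_nat_finite lessThan_atLeast0)
  define c where "c = poly.coeff (map_poly of_rat f :: complex poly) (Polynomial.degree f)"
  have "map_poly of_rat f = Polynomial.smult c (\<Prod>z\<in>R. [:- z, 1:])"
    using complex_poly_decompose_rsquarefree[OF minpoly_rsquarefree[OF f]]
    by (simp add: c_def R_def rpoly_def)
  also have "(\<Prod>z\<in>R. [:- z, 1:]) = (\<Prod>i<card R. [:- a i, 1:])"
    by (rule prod.reindex_bij_betw[OF a, symmetric])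
  finally have "(\<Prod>i<card R. rpoly p (a i)) \<in> \<rat>"
    by (rule prod_over_roots_rational[OF f0])
  also have "(\<Prod>i<card R. rpoly p (a i)) = (\<Prod>\<rho>\<in>R. rpoly p \<rho>)"
    by (rule prod.reindex_bij_betw[OF a])
  finally show ?thesis by (simp add: R_def)
qed

text \<open>The values of \<open>\<Prod>\<beta>' f (x - c \<beta>')\<close>, over the conjugates \<open>\<beta>'\<close> of \<open>\<beta>\<close>, are norms.\<close>

lemma algebraic_add_multiple:
  fixes \<alpha> \<beta> :: complex
  assumes "Polynomial.algebraic \<alpha>" "Polynomial.algebraic \<beta>"
  shows "Polynomial.algebraic (\<alpha> + of_rat c * \<beta>)"
proof -
  obtain f where f: "is_minpoly f \<alpha>" using is_minpoly_exists[OF assms(1)] by blast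
  obtain g where g: "is_minpoly g \<beta>" using is_minpoly_exists[OF assms(2)] by blast
  have f0: "f \<noteq> 0" "rpoly f \<alpha> = 0" and g0: "g \<noteq> 0" "rpoly g \<beta> = 0"
    using f g by (auto simp: is_minpoly_def)
  define B where "B = {b. rpoly g b = 0}"
  have fin: "finite B" unfolding B_def by (rule finite_rpoly_roots[OF g0(1)])
  define Q where "Q = (\<Prod>b\<in>B. (map_poly of_rat f \<circ>\<^sub>p [:- of_rat c * b, 1:] :: complex poly))"
  have Q_eval: "poly Q x = (\<Prod>b\<in>B. rpoly f (x - of_rat c * b))" for x
    by (simp add: Q_def poly_prod poly_pcompose rpoly_def)
  have Q0: "Q \<noteq> 0"
    unfolding Q_def using fin f0(1) by (auto simp: pcompose_eq_0_iff)
  have val: "poly Q (of_rat x) \<in> \<rat>" for x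
  proof -
    have "rpoly (f \<circ>\<^sub>p [:x, - c:]) b = rpoly f (of_rat x - of_rat c * b)" for b
      by (induction f) (auto simp: pcompose_pCons rpoly_add rpoly_mult rpoly_smult rpoly_minus of_rat_minus algebra_simps)
    then have "poly Q (of_rat x) = (\<Prod>b\<in>B. rpoly (f \<circ>\<^sub>p [:x, - c:]) b)"
      by (simp add: Q_eval)
    then show ?thesis using norm_rational[OF g, of "f \<circ>\<^sub>p [:x, - c:]"] by (simp add: B_def)
  qed
  define I where "I = {..Polynomial.degree Q}"
  have finI: "finite I" by (simp add: I_def)
  obtain q where q: "\<forall>i\<in>I. q i \<in> \<rat>"
    and rel: "\<forall>a b. (\<forall>i\<in>I. a i \<in> \<rat>) \<and> b \<in> \<rat> \<and> (\<Sum>i\<in>I. a i * poly.coeff Q i) = b \<longrightarrow> (\<Sum>i\<in>I. a i * q i) = b"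
    using linear_relations_descend[OF is_subfield_Rats finI, of "poly.coeff Q"] by (elim exE conjE)
  \<comment> \<open>\<open>Q'\<close> has rational coefficients and the same values as
    \<open>Q\<close> at all rational points; infinitely many agreements give
    \<open>Q' = Q\<close>.\<close>
  define Q' where "Q' = (\<Sum>i\<in>I. Polynomial.monom (q i) i)"
  have "poly Q' (of_rat x) = poly Q (of_rat x)" for x
  proof -
    have "(\<Sum>i\<in>I. of_rat x ^ i * poly.coeff Q i) = poly Q (of_rat x)"
      by (simp add: poly_altdef I_def mult.commute)
    then have "(\<Sum>i\<in>I. of_rat x ^ i * q i) = poly Q (of_rat x)"
      using val by (intro rel[rule_format]) auto
    then show ?thesis by (simp add: Q'_def poly_sum poly_monom mult.commute)
  qed
  then have "range of_rat \<subseteq> {x. poly (Q' - Q) x = 0}" by auto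
  moreover have "infinite (range (of_rat :: rat \<Rightarrow> complex))"
    by (rule infinite_range_of_rat)
  ultimately have "Q' - Q = 0" using poly_roots_finite finite_subset by blast
  have "poly.coeff Q i \<in> \<rat>" for i
  proof (cases "i \<in> I")
    case True
    have "Q = Q'" using \<open>Q' - Q = 0\<close> by simp
    then have "poly.coeff Q i = (\<Sum>j\<in>I. if j = i then q j else 0)"
      by (simp add: Q'_def coeff_sum)
    then show ?thesis using True q by (simp add: I_def)
  qed (simp add: I_def coeff_eq_0)
  moreover have "poly Q (\<alpha> + of_rat c * \<beta>) = 0"
    unfolding Q_eval using fin f0 g0 by (intro prod_zero bexI[of _ \<beta>]) (auto simp: B_def)
  ultimately show ?thesis using Q0 algebraicI'[of Q] by blast
qed

text \<open>For \<open>\<gamma> = \<alpha> + c * \<beta>\<close> with suitable rational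
  \<open>c\<close>, the polynomials \<open>f (\<gamma> - c * x)\<close> and \<open>g x\<close> have
  \<beta> as their only common root, and it is a simple root of \<open>g\<close>; so their gcd is
  \<open>x - \<beta>\<close>. The Bezout identity for it, found over the complex numbers, descends
  to \<open>adj \<gamma>\<close>.\<close>

lemma primitive_element_two:
  fixes \<alpha> \<beta> :: complex
  assumes \<alpha>: "Polynomial.algebraic \<alpha>" and \<beta>: "Polynomial.algebraic \<beta>"
  shows "\<exists>\<gamma>. Polynomial.algebraic \<gamma> \<and> \<alpha> \<in> adj \<gamma> \<and> \<beta> \<in> adj \<gamma>"
proof -
  obtain f where f: "is_minpoly f \<alpha>" using is_minpoly_exists[OF \<alpha>] by blast
  obtain g where g: "is_minpoly g \<beta>" using is_minpoly_exists[OF \<beta>] by blast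
  have f0: "f \<noteq> 0" "rpoly f \<alpha> = 0" and g0: "g \<noteq> 0" "rpoly g \<beta> = 0"
    using f g by (auto simp: is_minpoly_def)
  \<comment> \<open>The excluded \<open>c\<close> are those for which
    \<open>\<gamma> - c * b\<close> is a root of \<open>f\<close> for some root \<open>b\<close> of
    \<open>g\<close> other than \<beta>; for \<open>b = \<beta>\<close> the quotient is 0 by
    convention.\<close>
  define bad where "bad = (\<lambda>(a, b). (a - \<alpha>) / (\<beta> - b)) ` ({a. rpoly f a = 0} \<times> {b. rpoly g b = 0})"
  have "finite bad" unfolding bad_def using finite_rpoly_roots f0 g0 by blast
  moreover have "infinite (range (of_rat :: rat \<Rightarrow> complex))"
    by (rule infinite_range_of_rat)
  ultimately obtain c where c: "(of_rat c :: complex) \<notin> bad" by (metis finite_subset image_subsetI)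
  define \<gamma> where "\<gamma> = \<alpha> + of_rat c * \<beta>"
  have \<gamma>: "Polynomial.algebraic \<gamma>" unfolding \<gamma>_def by (rule algebraic_add_multiple[OF \<alpha> \<beta>])
  define k where "k = adj \<gamma>"
  have k: "is_subfield k" "\<rat> \<subseteq> k" "\<gamma> \<in> k"
    unfolding k_def using is_subfield_adj[OF \<gamma>] Rats_subset_adj self_in_adj by auto
  define G where "G = (map_poly of_rat g :: complex poly)"
  define H where "H = (map_poly of_rat f \<circ>\<^sub>p [:\<gamma>, - of_rat c:] :: complex poly)"
  have H_eval: "poly H x = rpoly f (\<gamma> - of_rat c * x)" for x
    by (simp add: H_def poly_pcompose rpoly_def algebra_simps)
  have G_eval: "poly G x = rpoly g x" for x by (simp add: G_def rpoly_def)
  have Gk: "poly.coeff G i \<in> k" for i using k(2) by (auto simp: G_def coeff_map_poly)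
  have Hk: "poly.coeff H i \<in> k" for i
  proof -
    have "poly.coeff (map_poly of_rat p \<circ>\<^sub>p [:\<gamma>, - of_rat c:]) i \<in> k" for p
    proof (induction p arbitrary: i)
      case (pCons a p)
      define L where "L = [:\<gamma>, - of_rat c:]"
      have ratk: "of_rat q \<in> k" for q using k(2) by auto
      have "poly.coeff L j \<in> k" for j
        using k(3) ratk is_subfieldD(1,6)[OF k(1)] by (auto simp: L_def coeff_pCons split: nat.splits)
      then have "poly.coeff (L * (map_poly of_rat p \<circ>\<^sub>p L)) i \<in> k"
        unfolding coeff_mult using pCons.IH
        by (intro is_subfield_sum[OF k(1)] is_subfieldD(4)[OF k(1)]) (auto simp: L_def)
      moreover have "poly.coeff [:of_rat a:] i \<in> k"
        using ratk is_subfieldD(1)[OF k(1)] by (auto simp: coeff_pCons split: nat.splits)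
      moreover have "map_poly of_rat (pCons a p) \<circ>\<^sub>p L = [:of_rat a:] + L * (map_poly of_rat p \<circ>\<^sub>p L)"
        using pCons.hyps by (simp add: map_poly_pCons pcompose_pCons)
      ultimately show ?case
        using is_subfieldD(7)[OF k(1)] unfolding L_def by (metis coeff_add)
    qed (use k in \<open>auto simp: is_subfieldD\<close>)
    then show ?thesis by (simp add: H_def)
  qed
  have common: "x = \<beta>" if "poly H x = 0" "poly G x = 0" for x
  proof (rule ccontr)
    assume "x \<noteq> \<beta>"
    have "(\<gamma> - of_rat c * x - \<alpha>) / (\<beta> - x) \<in> bad"
      using that unfolding bad_def H_eval G_eval by (intro image_eqI[of _ _ "(\<gamma> - of_rat c * x, x)"]) auto
    moreover have "(\<gamma> - of_rat c * x - \<alpha>) / (\<beta> - x) = of_rat c"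
      using \<open>x \<noteq> \<beta>\<close> by (simp add: \<gamma>_def field_simps)
    ultimately show False using c by simp
  qed
  have G0: "G \<noteq> 0" using g0(1) by (simp add: G_def)
  have "\<exists>u w. u * H + w * G = [:- \<beta>, 1:]"
  proof -
    define D where "D = gcd H G"
    have "D dvd G" "D dvd H" by (simp_all add: D_def)
    have "D \<noteq> 0" using G0 by (simp add: D_def)
    have root: "poly D x = 0 \<Longrightarrow> x = \<beta>" for x
      using \<open>D dvd G\<close> \<open>D dvd H\<close> by (intro common) (auto elim!: dvdE)
    have dvd: "[:- \<beta>, 1:] dvd D"
      unfolding D_def using f0 g0 by (intro gcd_greatest) (auto simp: H_eval G_eval \<gamma>_def simp flip: poly_eq_0_iff_dvd)
    then obtain E where E: "D = [:- \<beta>, 1:] * E" by (elim dvdE)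
    \<comment> \<open>Simplicity of the root \<beta> of \<open>G\<close> prevents a second factor in
      the gcd.\<close>
    have "\<not> [:- \<beta>, 1:] ^ 2 dvd G"
    proof -
      have "rsquarefree G" unfolding G_def by (rule minpoly_rsquarefree[OF g])
      then have "Polynomial.order \<beta> G = 0 \<or> Polynomial.order \<beta> G = 1"
        unfolding rsquarefree_def by blast
      moreover have "Polynomial.order \<beta> G \<noteq> 0"
        using g0 G0 order_root[of G \<beta>] by (simp add: G_eval)
      ultimately have "Polynomial.order \<beta> G = 1" by blast
      then show ?thesis using G0 order_divides[of \<beta> 2 G] by simp
    qed
    moreover have "[:- \<beta>, 1:] ^ 2 dvd G" if "poly E \<beta> = 0"
    proof -
      have "[:- \<beta>, 1:] dvd E" using that by (simp only: poly_eq_0_iff_dvd)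
      then have "[:- \<beta>, 1:] * [:- \<beta>, 1:] dvd D" unfolding E by (rule mult_dvd_mono[OF dvd_refl])
      then show ?thesis using dvd_trans[OF _ \<open>D dvd G\<close>] by (simp only: power2_eq_square)
    qed
    ultimately have "poly E \<beta> \<noteq> 0" by blast
    moreover have "poly E x \<noteq> 0" if "x \<noteq> \<beta>" for x
      using root[of x] that E by auto
    ultimately have "\<not> (\<exists>x. poly E x = 0)" by metis
    then have "Polynomial.degree E = 0"
      using fundamental_theorem_of_algebra[of E] by (auto simp: constant_degree)
    then obtain e where e: "E = [:e:]" by (metis degree_eq_zeroE)
    have "e \<noteq> 0" using \<open>D \<noteq> 0\<close> E e by auto
    then have "[:1 / e:] * D = [:- \<beta>, 1:]" unfolding E e by simp
    moreover have "[:1 / e:] * (fst (bezout_coefficients H G) * H + snd (bezout_coefficients H G) * G) = [:1 / e:] * D"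
      by (simp only: bezout_coefficients_fst_snd D_def)
    ultimately show ?thesis
      by (intro exI[of _ "[:1 / e:] * fst (bezout_coefficients H G)"] exI[of _ "[:1 / e:] * snd (bezout_coefficients H G)"])
         (simp only: distrib_left mult.assoc)
  qed
  then obtain u w where uw: "u * H + w * G = [:- \<beta>, 1:]" by blast
  define m where "m = Polynomial.degree u + Polynomial.degree w"
  define I where "I = Sum_Type.Plus {..m} {..m}"
  have finI: "finite I" by (simp add: I_def)
  define z where "z = case_sum (poly.coeff u) (poly.coeff w)"
  obtain z' where z': "\<forall>i\<in>I. z' i \<in> k"
    and rel: "\<forall>a b. (\<forall>i\<in>I. a i \<in> k) \<and> b \<in> k \<and> (\<Sum>i\<in>I. a i * z i) = b \<longrightarrow> (\<Sum>i\<in>I. a i * z' i) = b"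
    using linear_relations_descend[OF k(1) finI, of z] by (elim exE conjE)
  define u' w' where "u' = (\<Sum>i\<le>m. Polynomial.monom (z' (Inl i)) i)" and "w' = (\<Sum>i\<le>m. Polynomial.monom (z' (Inr i)) i)"
  define cf where "cf p i t = (if i \<le> t then poly.coeff p (t - i) else 0)" for p :: "complex poly" and i t :: nat
  have co: "poly.coeff ((\<Sum>i\<le>m. Polynomial.monom (s i) i) * p) t = (\<Sum>i\<le>m. cf p i t * s i)" for s p t
    unfolding sum_distrib_right coeff_sum by (rule sum.cong) (auto simp: coeff_monom_mult cf_def)
  have um: "u = (\<Sum>i\<le>m. Polynomial.monom (z (Inl i)) i)" "w = (\<Sum>i\<le>m. Polynomial.monom (z (Inr i)) i)"
    by (rule poly_eqI; auto simp: z_def m_def coeff_sum coeff_eq_0)+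
  define a where "a t = case_sum (\<lambda>i. cf H i t) (\<lambda>i. cf G i t)" for t
  have ak: "a t i \<in> k" for t i
    using Gk Hk is_subfieldD(1)[OF k(1)] by (cases i) (auto simp: a_def cf_def)
  have sumI: "(\<Sum>i\<in>I. a t i * y i) = (\<Sum>i\<le>m. cf H i t * y (Inl i)) + (\<Sum>i\<le>m. cf G i t * y (Inr i))" for t y
    unfolding I_def by (simp add: sum.Plus a_def)
  have lhs: "poly.coeff (u * H + w * G) t = (\<Sum>i\<in>I. a t i * z i)" for t
    unfolding sumI by (subst um(1), subst um(2)) (simp only: coeff_add co)
  have lhs': "poly.coeff (u' * H + w' * G) t = (\<Sum>i\<in>I. a t i * z' i)" for t
    unfolding sumI u'_def w'_def by (simp only: coeff_add co)
  \<comment> \<open>The constant coefficient is \<open>- \<beta>\<close>, whose membership in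
    \<open>k\<close> is the goal. So only the other coefficients are carried over, and evaluation at
    \<beta> identifies the constant coefficient \<open>b\<close> of the new combination.\<close>
  have eq: "poly.coeff (u' * H + w' * G) t = poly.coeff [:- \<beta>, 1:] t" if "t \<noteq> 0" for t
  proof -
    have "poly.coeff [:- \<beta>, 1:] t \<in> k"
      using that is_subfieldD(1,2)[OF k(1)] by (auto simp: coeff_pCons split: nat.splits)
    then have "(\<Sum>i\<in>I. a t i * z' i) = poly.coeff [:- \<beta>, 1:] t"
      using lhs[of t] ak by (intro rel[rule_format] conjI ballI) (simp_all only: uw)
    then show ?thesis by (simp only: lhs')
  qed
  define b where "b = poly.coeff (u' * H + w' * G) 0"
  have "b \<in> k"
    unfolding b_def lhs' using ak z' by (intro is_subfield_sum[OF k(1)] is_subfieldD(4)[OF k(1)]) auto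
  have "u' * H + w' * G = [:b, 1:]"
  proof (rule poly_eqI)
    fix t show "poly.coeff (u' * H + w' * G) t = poly.coeff [:b, 1:] t"
      using eq[of t] by (cases t) (auto simp: b_def)
  qed
  moreover have "poly (u' * H + w' * G) \<beta> = 0"
    using f0 g0 by (simp add: H_eval G_eval \<gamma>_def)
  ultimately have "b + \<beta> = 0" by simp
  then have "\<beta> = - b" by (simp add: add_eq_0_iff2)
  then have "\<beta> \<in> k" using \<open>b \<in> k\<close> is_subfieldD(6)[OF k(1)] by simp
  moreover have "\<alpha> = \<gamma> - of_rat c * \<beta>" by (simp add: \<gamma>_def)
  then have "\<alpha> \<in> k" using k \<open>\<beta> \<in> k\<close> by (auto intro!: is_subfieldD(3,4))
  ultimately show ?thesis using \<gamma> k_def by blast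
qed

lemma primitive_element:
  assumes "finite A" "\<And>a. a \<in> A \<Longrightarrow> Polynomial.algebraic a"
  shows "\<exists>\<theta>. Polynomial.algebraic \<theta> \<and> A \<subseteq> adj \<theta>"
  using assms
proof (induction A)
  case empty
  show ?case by (intro exI[of _ 0]) auto
next
  case (insert a A)
  then obtain \<theta> where \<theta>: "Polynomial.algebraic \<theta>" "A \<subseteq> adj \<theta>" by auto
  from insert.prems have "Polynomial.algebraic a" by simp
  then obtain \<gamma> where \<gamma>: "Polynomial.algebraic \<gamma>" "\<theta> \<in> adj \<gamma>" "a \<in> adj \<gamma>"
    using primitive_element_two[OF \<theta>(1)] by blast
  have "adj \<theta> \<subseteq> adj \<gamma>"
    by (rule adj_subset[OF is_subfield_adj[OF \<gamma>(1)] Rats_subset_adj \<gamma>(2)])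
  with \<theta> \<gamma> show ?case by blast
qed

section \<open>Archimedean places\<close>

lemma of_real_of_rat_complex: "of_real (of_rat q) = (of_rat q :: complex)"
  by (cases q) (simp add: of_rat_rat)

lemma norm_of_rat: "cmod (of_rat q) = \<bar>of_rat q\<bar>"
  by (metis norm_of_real of_real_of_rat_complex)

section \<open>Translation to the ring-theoretic notion of number field\<close>

lemma complex_ring_simps [simp]:
  "carrier complex_ring = UNIV" "x \<otimes>\<^bsub>complex_ring\<^esub> y = x * y" "\<one>\<^bsub>complex_ring\<^esub> = 1"
  "x \<oplus>\<^bsub>complex_ring\<^esub> y = x + y" "\<zero>\<^bsub>complex_ring\<^esub> = 0"
  by (simp_all add: complex_ring_def ring_of_type_algebra_def)

lemma field_complex_ring: "Ring.field complex_ring"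
  unfolding complex_ring_def by (rule field_from_type_algebra)

interpretation complex_ring: cring complex_ring
  by (rule domain.axioms(1)[OF Ring.field.axioms(1)[OF field_complex_ring]])

lemma inv_complex_ring: "x \<noteq> 0 \<Longrightarrow> inv\<^bsub>complex_ring\<^esub> x = inverse x"
  by (rule complex_ring.comm_inv_char) auto

lemma a_inv_complex_ring [simp]: "\<ominus>\<^bsub>complex_ring\<^esub> x = - x"
  by (rule complex_ring.minus_equality) auto

lemma subfield_complex_ring:
  assumes "is_subfield k"
  shows "subfield k complex_ring"
proof (rule field.subfieldI'[OF field_complex_ring])
  show "subring k complex_ring"
    by (rule complex_ring.subringI) (use is_subfieldD[OF assms] in auto)
  show "inv\<^bsub>complex_ring\<^esub> x \<in> k" if "x \<in> k - {\<zero>\<^bsub>complex_ring\<^esub>}" for x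
    using that is_subfieldD(5)[OF assms] by (auto simp: inv_complex_ring)
qed

lemma combine_complex_ring:
  "complex_ring.combine (map c [0..<n]) (map u [0..<n]) = (\<Sum>i<n. c i * u i)"
proof -
  have "complex_ring.combine (map c xs) (map u xs) = (\<Sum>i\<leftarrow>xs. c i * u i)" for xs :: "nat list"
    by (induction xs) auto
  then show ?thesis by (simp add: interv_sum_list_conv_sum_set_nat atLeast0LessThan)
qed

text \<open>Reduction modulo the minimal polynomial \<open>f\<close> shows that the powers of
  \<open>\<theta>\<close> below the degree of \<open>f\<close> span.\<close>

lemma number_field_adj:
  assumes "Polynomial.algebraic \<theta>"
  shows "number_field (adj \<theta>)"
proof -
  obtain f where f: "is_minpoly f \<theta>" using is_minpoly_exists[OF assms] by blast
  have f0: "f \<noteq> 0" "rpoly f \<theta> = 0" using f by (auto simp: is_minpoly_def)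
  define n where "n = Polynomial.degree f"
  define us where "us = map (\<lambda>i. \<theta> ^ i) [0..<n]"
  have Q: "subfield \<rat> complex_ring" by (rule subfield_complex_ring[OF is_subfield_Rats])
  have k: "is_subfield (adj \<theta>)" by (rule is_subfield_adj[OF assms])
  have "complex_ring.Span \<rat> us = adj \<theta>"
  proof
    show "complex_ring.Span \<rat> us \<subseteq> adj \<theta>"
    proof
      fix x assume "x \<in> complex_ring.Span \<rat> us"
      then obtain cs where cs: "set cs \<subseteq> \<rat>" "x = complex_ring.combine cs us"
        using complex_ring.Span_eq_combine_set[OF Q, of us] by auto
      have "complex_ring.combine cs vs \<in> adj \<theta>" if "set cs \<subseteq> \<rat>" "set vs \<subseteq> adj \<theta>" for cs vs
        using that
      proof (induction cs vs rule: complex_ring.combine.induct)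
        case (1 c cs v vs)
        then show ?case using Rats_subset_adj[of \<theta>] is_subfieldD(4,7)[OF k] by auto
      qed (use is_subfieldD(1)[OF k] in auto)
      moreover have "set us \<subseteq> adj \<theta>"
        using is_subfield_power[OF k self_in_adj] by (auto simp: us_def)
      ultimately show "x \<in> adj \<theta>" using cs by blast
    qed
    show "adj \<theta> \<subseteq> complex_ring.Span \<rat> us"
    proof
      fix x assume "x \<in> adj \<theta>"
      then obtain p where p: "x = rpoly p \<theta>" by (auto simp: adj_def)
      define r where "r = p mod f"
      have "rpoly (p div f * f + r) \<theta> = rpoly r \<theta>" using f0(2) by (simp only: rpoly_add rpoly_mult mult_zero_right add_0)
      then have "x = rpoly r \<theta>" by (simp add: p r_def)
      also have "\<dots> = (\<Sum>i<n. of_rat (poly.coeff r i) * \<theta> ^ i)"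
      proof (cases "r = 0")
        case False
        then have "Polynomial.degree r < n"
          using degree_mod_less[OF f0(1), of p] by (auto simp: r_def n_def)
        then show ?thesis unfolding rpoly_altdef
          by (intro sum.mono_neutral_left) (auto simp: coeff_eq_0)
      qed simp
      also have "\<dots> = complex_ring.combine (map (\<lambda>i. of_rat (poly.coeff r i)) [0..<n]) us"
        unfolding us_def by (rule combine_complex_ring[symmetric])
      also have "\<dots> \<in> complex_ring.Span \<rat> us"
        using complex_ring.Span_eq_combine_set[OF Q, of us] by force
      finally show "x \<in> complex_ring.Span \<rat> us" .
    qed
  qed
  then have "complex_ring.finite_dimension \<rat> (adj \<theta>)"
    using complex_ring.Span_finite_dimension[OF Q, of us] by simp
  then show ?thesis unfolding number_field_def using subfield_complex_ring[OF k] by simp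
qed

lemma field_degree_pos:
  assumes "number_field k"
  shows "field_degree k > 0"
proof -
  have Q: "subfield \<rat> complex_ring" by (rule subfield_complex_ring[OF is_subfield_Rats])
  have fd: "complex_ring.finite_dimension \<rat> k" and k: "subfield k complex_ring"
    using assms by (auto simp: number_field_def)
  have "complex_ring.dimension (field_degree k) \<rat> k"
    using complex_ring.finite_dimensionE[OF Q fd] by (simp add: over_def field_degree_def)
  moreover have "1 \<in> k" using subringE(3)[OF subfieldE(1)[OF k]] by simp
  ultimately show ?thesis
    using complex_ring.dimension_zero[OF Q, of k] by (cases "field_degree k = 0") auto
qed

text \<open>The field embedding that sends \<open>\<theta>\<close> to \<open>\<rho>\<close>. The
  polynomial representing \<open>x\<close> is not unique, but its value at a root
  \<open>\<rho>\<close> of the minimal polynomial is (\<open>emb_rpoly\<close>).\<close>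

definition emb :: "complex \<Rightarrow> complex \<Rightarrow> complex \<Rightarrow> complex" where
  "emb \<theta> \<rho> x = rpoly (SOME p. x = rpoly p \<theta>) \<rho>"

definition emb_place :: "complex \<Rightarrow> complex \<Rightarrow> complex \<Rightarrow> real" where
  "emb_place \<theta> \<rho> x = (if x \<in> adj \<theta> then cmod (emb \<theta> \<rho> x) else 0)"

context
  fixes \<theta> :: complex and f :: "rat poly"
  assumes f: "is_minpoly f \<theta>"
begin

lemma emb_rpoly:
  assumes "rpoly f \<rho> = 0"
  shows "emb \<theta> \<rho> (rpoly p \<theta>) = rpoly p \<rho>"
proof -
  define q where "q = (SOME q. rpoly p \<theta> = rpoly q \<theta>)"
  have "rpoly p \<theta> = rpoly q \<theta>" unfolding q_def by (rule someI[of _ p]) simp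
  then have "rpoly (q - p) \<theta> = 0" by (simp add: rpoly_diff)
  then have "rpoly (q - p) \<rho> = 0" using is_minpoly_rpoly_eq_0_iff[OF f assms] by blast
  then show ?thesis by (simp add: emb_def q_def rpoly_diff)
qed

lemma emb_hom:
  assumes \<rho>: "rpoly f \<rho> = 0" and "x \<in> adj \<theta>" "y \<in> adj \<theta>"
  shows "emb \<theta> \<rho> (x + y) = emb \<theta> \<rho> x + emb \<theta> \<rho> y" "emb \<theta> \<rho> (x * y) = emb \<theta> \<rho> x * emb \<theta> \<rho> y"
    "emb \<theta> \<rho> (x - y) = emb \<theta> \<rho> x - emb \<theta> \<rho> y"
proof -
  obtain p q where "x = rpoly p \<theta>" "y = rpoly q \<theta>" using assms(2,3) by (auto simp: adj_def)
  then show "emb \<theta> \<rho> (x + y) = emb \<theta> \<rho> x + emb \<theta> \<rho> y" "emb \<theta> \<rho> (x * y) = emb \<theta> \<rho> x * emb \<theta> \<rho> y"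
    "emb \<theta> \<rho> (x - y) = emb \<theta> \<rho> x - emb \<theta> \<rho> y"
    using emb_rpoly[OF \<rho>, of "p + q"] emb_rpoly[OF \<rho>, of "p * q"] emb_rpoly[OF \<rho>, of "p - q"]
    by (simp_all add: emb_rpoly[OF \<rho>] rpoly_add rpoly_mult rpoly_diff)
qed

lemma emb_of_rat: "rpoly f \<rho> = 0 \<Longrightarrow> emb \<theta> \<rho> (of_rat q) = of_rat q"
  using emb_rpoly[of \<rho> "[:q:]"] by simp

lemma emb_self: "rpoly f \<rho> = 0 \<Longrightarrow> emb \<theta> \<rho> \<theta> = \<rho>"
  using emb_rpoly[of \<rho> "[:0, 1:]"] by simp

lemma emb_eq_0_iff:
  assumes \<rho>: "rpoly f \<rho> = 0" and "x \<in> adj \<theta>"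
  shows "emb \<theta> \<rho> x = 0 \<longleftrightarrow> x = 0"
proof -
  obtain p where "x = rpoly p \<theta>" using assms(2) by (auto simp: adj_def)
  then show ?thesis using is_minpoly_rpoly_eq_0_iff[OF f \<rho>] by (simp add: emb_rpoly[OF \<rho>])
qed

lemma emb_sum:
  assumes "rpoly f \<rho> = 0" "is_subfield (adj \<theta>)" "\<And>a. a \<in> A \<Longrightarrow> g a \<in> adj \<theta>"
  shows "emb \<theta> \<rho> (\<Sum>a\<in>A. g a) = (\<Sum>a\<in>A. emb \<theta> \<rho> (g a))"
  using assms(3)
proof (induction A rule: infinite_finite_induct)
  case (insert a A)
  moreover have "sum g A \<in> adj \<theta>" using insert.prems by (intro is_subfield_sum[OF assms(2)]) auto
  ultimately show ?case using emb_hom(1)[OF assms(1), of "g a" "sum g A"] by simp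
qed (use emb_of_rat[OF assms(1), of 0] in auto)

lemma rpoly_cnj: "rpoly p (cnj z) = cnj (rpoly p z)"
proof -
  have "cnj (of_rat a) = of_rat a" for a
    by (metis Rats_of_rat complex_cnj_complex_of_real of_real_of_rat_complex)
  then show ?thesis by (induction p) auto
qed

lemma emb_cnj:
  assumes "rpoly f \<rho> = 0" "x \<in> adj \<theta>"
  shows "emb \<theta> (cnj \<rho>) x = cnj (emb \<theta> \<rho> x)"
  using assms by (auto simp: adj_def emb_rpoly rpoly_cnj)

lemma emb_place_arch:
  assumes \<rho>: "rpoly f \<rho> = 0" and k: "is_subfield (adj \<theta>)"
  shows "emb_place \<theta> \<rho> \<in> arch_places (adj \<theta>)"
  unfolding arch_places_def absolute_value_on_def
proof (intro CollectI conjI ballI allI impI)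
  fix q :: rat
  have "of_rat q \<in> adj \<theta>" using rpoly_in_adj[of "[:q:]" \<theta>] by simp
  then show "emb_place \<theta> \<rho> (of_rat q) = \<bar>of_rat q\<bar>"
    by (simp only: emb_place_def emb_of_rat[OF \<rho>] if_True norm_of_rat)
next
  fix x assume x: "x \<in> adj \<theta>"
  show "emb_place \<theta> \<rho> x \<ge> 0" "emb_place \<theta> \<rho> x = 0 \<longleftrightarrow> x = 0"
    using x emb_eq_0_iff[OF \<rho> x] by (auto simp: emb_place_def)
  fix y assume y: "y \<in> adj \<theta>"
  show "emb_place \<theta> \<rho> (x * y) = emb_place \<theta> \<rho> x * emb_place \<theta> \<rho> y"
    "emb_place \<theta> \<rho> (x + y) \<le> emb_place \<theta> \<rho> x + emb_place \<theta> \<rho> y"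
    using x y is_subfieldD(4,7)[OF k x y]
    by (auto simp: emb_place_def emb_hom[OF \<rho> x y] norm_mult norm_triangle_ineq)
qed (simp add: emb_place_def)

end

section \<open>Absolute values on a subfield\<close>

lemma absolute_value_onD:
  assumes v: "absolute_value_on k v" and k: "is_subfield k"
  shows "x \<in> k \<Longrightarrow> v x \<ge> 0" "x \<in> k \<Longrightarrow> v x = 0 \<longleftrightarrow> x = 0" "v 0 = 0" "v 1 = 1"
    "x \<in> k \<Longrightarrow> y \<in> k \<Longrightarrow> v (x * y) = v x * v y" "x \<in> k \<Longrightarrow> y \<in> k \<Longrightarrow> v (x + y) \<le> v x + v y"
    "x \<in> k \<Longrightarrow> v (- x) = v x" "x \<in> k \<Longrightarrow> y \<in> k \<Longrightarrow> v (x - y) \<le> v x + v y"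
    "x \<in> k \<Longrightarrow> y \<in> k \<Longrightarrow> \<bar>v x - v y\<bar> \<le> v (x - y)" "x \<in> k \<Longrightarrow> v (x ^ n) = v x ^ n"
    "x \<in> k \<Longrightarrow> v (inverse x) = inverse (v x)"
proof -
  note kD = is_subfieldD[OF k]
  show 1: "x \<in> k \<Longrightarrow> v x \<ge> 0" "x \<in> k \<Longrightarrow> v x = 0 \<longleftrightarrow> x = 0"
    "x \<in> k \<Longrightarrow> y \<in> k \<Longrightarrow> v (x * y) = v x * v y" "x \<in> k \<Longrightarrow> y \<in> k \<Longrightarrow> v (x + y) \<le> v x + v y" for x y
    using v by (auto simp: absolute_value_on_def)
  show 0: "v 0 = 0" using 1(2)[of 0] kD by simp
  show v1: "v 1 = 1" using 1(2)[of 1] 1(3)[of 1 1] kD(2) by simp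
  have "- 1 \<in> k" using kD by simp
  then have "v (- 1) * v (- 1) = 1" "v (- 1) \<ge> 0" using 1(3)[of "- 1" "- 1"] 1(1) v1 by auto
  then have "v (- 1) = 1" by (simp add: square_eq_1_iff)
  then show neg: "x \<in> k \<Longrightarrow> v (- x) = v x" for x using 1(3)[of "- 1" x] \<open>- 1 \<in> k\<close> by simp
  show "x \<in> k \<Longrightarrow> y \<in> k \<Longrightarrow> v (x - y) \<le> v x + v y"
    using 1(4)[of x "- y"] neg kD(6) by simp
  show "x \<in> k \<Longrightarrow> y \<in> k \<Longrightarrow> \<bar>v x - v y\<bar> \<le> v (x - y)"
  proof -
    assume xy: "x \<in> k" "y \<in> k"
    have "v x \<le> v (x - y) + v y" using 1(4)[of "x - y" y] xy kD(3) by simp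
    moreover have "v y \<le> v (y - x) + v x" using 1(4)[of "y - x" x] xy kD(3) by simp
    moreover have "v (y - x) = v (x - y)" using neg[of "x - y"] xy kD(3) by simp
    ultimately show ?thesis by linarith
  qed
  show "x \<in> k \<Longrightarrow> v (x ^ n) = v x ^ n"
  proof (induction n)
    case (Suc n)
    then show ?case using 1(3)[of x "x ^ n"] is_subfield_power[OF k] by simp
  qed (simp add: v1)
  show "v (inverse x) = inverse (v x)" if "x \<in> k"
  proof (cases "x = 0")
    case False
    then have "v x * v (inverse x) = 1" using 1(3)[of x "inverse x"] that kD(5) v1 by simp
    then show ?thesis using 1(2)[OF that] False by (simp add: field_simps)
  qed (simp add: 0)
qed

text \<open>The field of Gaussian rationals. By \<open>arch_place_gauss_rats\<close> all archimedean
  places agree with \<open>cmod\<close> on it, and it is dense, so it serves to approximate complex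
  numbers and elements of \<open>k\<close> at the same time.\<close>

definition gauss_rats :: "complex set" where
  "gauss_rats = {of_rat a + of_rat b * \<i> | a b. True}"

lemma gauss_ratsI: "of_rat a + of_rat b * \<i> \<in> gauss_rats"
  by (auto simp: gauss_rats_def)

lemma gauss_rats_closed:
  assumes "x \<in> gauss_rats" "y \<in> gauss_rats"
  shows "x + y \<in> gauss_rats" "x * y \<in> gauss_rats" "- x \<in> gauss_rats" "cnj x \<in> gauss_rats"
proof -
  obtain a b c d where x: "x = of_rat a + of_rat b * \<i>" and y: "y = of_rat c + of_rat d * \<i>"
    using assms by (auto simp: gauss_rats_def)
  have "x + y = of_rat (a + c) + of_rat (b + d) * \<i>" by (simp add: x y of_rat_add algebra_simps)
  then show "x + y \<in> gauss_rats" using gauss_ratsI by metis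
  have "x * y = of_rat (a * c - b * d) + of_rat (a * d + b * c) * \<i>"
    by (simp add: x y of_rat_add of_rat_diff of_rat_mult algebra_simps)
  then show "x * y \<in> gauss_rats" using gauss_ratsI by metis
  have "- x = of_rat (- a) + of_rat (- b) * \<i>" by (simp add: x of_rat_minus)
  then show "- x \<in> gauss_rats" using gauss_ratsI by metis
  have "cnj (of_rat a) = of_rat a" for a
    by (metis complex_cnj_complex_of_real of_real_of_rat_complex)
  then have "cnj x = of_rat a + of_rat (- b) * \<i>" by (simp add: x of_rat_minus)
  then show "cnj x \<in> gauss_rats" using gauss_ratsI by metis
qed

lemmas gauss_rats_uminus = gauss_rats_closed(3)[OF _ gauss_ratsI[of 0 0]]
  and gauss_rats_cnj = gauss_rats_closed(4)[OF _ gauss_ratsI[of 0 0]]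

lemma Rats_subset_gauss_rats: "\<rat> \<subseteq> gauss_rats"
proof
  fix x :: complex assume "x \<in> \<rat>"
  then obtain q where "x = of_rat q" by (elim Rats_cases)
  then show "x \<in> gauss_rats" using gauss_ratsI[of q 0] by simp
qed

section \<open>Approximation by rational and Gaussian rational numbers\<close>

lemma rat_sequence_tendsto:
  fixes x :: real
  shows "\<exists>q :: nat \<Rightarrow> rat. (\<lambda>n. of_rat (q n) :: complex) \<longlonglongrightarrow> of_real x"
proof -
  have "\<forall>n. \<exists>q. x < of_rat q \<and> of_rat q < x + 1 / real (Suc n)"
    by (intro allI of_rat_dense) simp
  then obtain q where q: "\<And>n. x < of_rat (q n)" "\<And>n. of_rat (q n) < x + 1 / real (Suc n)" by metis
  have "(\<lambda>n. of_rat (q n) :: real) \<longlonglongrightarrow> x"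
  proof (rule tendsto_sandwich[of "\<lambda>_. x" _ _ "\<lambda>n. x + 1 / real (Suc n)"])
    show "(\<lambda>n. x + 1 / real (Suc n)) \<longlonglongrightarrow> x"
      using tendsto_add[OF tendsto_const lim_inverse_n'[THEN LIMSEQ_Suc], of x] by simp
  qed (use q in \<open>auto intro!: always_eventually less_imp_le\<close>)
  then have "(\<lambda>n. of_real (of_rat (q n)) :: complex) \<longlonglongrightarrow> of_real x" by (rule tendsto_of_real)
  then show ?thesis by (intro exI[of _ q]) (simp only: of_real_of_rat_complex)
qed

lemma gauss_rats_sequence_tendsto: "\<exists>g. (\<forall>n. g n \<in> gauss_rats) \<and> g \<longlonglongrightarrow> z"
proof -
  obtain a b where ab: "(\<lambda>n. of_rat (a n) :: complex) \<longlonglongrightarrow> of_real (Re z)"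
    "(\<lambda>n. of_rat (b n) :: complex) \<longlonglongrightarrow> of_real (Im z)"
    using rat_sequence_tendsto by blast
  have "(\<lambda>n. of_rat (a n) + of_rat (b n) * \<i>) \<longlonglongrightarrow> of_real (Re z) + of_real (Im z) * \<i>"
    by (intro tendsto_intros ab)
  also have "of_real (Re z) + of_real (Im z) * \<i> = z" by (simp add: complex_eq_iff)
  finally show ?thesis
    by (intro exI[of _ "\<lambda>n. of_rat (a n) + of_rat (b n) * \<i>"] conjI allI gauss_ratsI)
qed

text \<open>Tensor power trick: a ratio above 1 would have powers exceeding any constant
  \<open>C\<close>.\<close>

lemma power_le_multiple_imp_le:
  fixes a b :: real
  assumes "a \<ge> 0" "b > 0" "\<And>n. a ^ n \<le> C * b ^ n"
  shows "a \<le> b"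
proof (rule ccontr)
  assume "\<not> a \<le> b"
  then have "1 < a / b" using assms(2) by simp
  then obtain n where "C < (a / b) ^ n" using real_arch_pow by blast
  then show False using assms(3)[of n] assms(2) by (simp add: power_divide field_simps)
qed

lemma gauss_rats_subset:
  assumes "is_subfield k" "\<rat> \<subseteq> k" "\<i> \<in> k"
  shows "gauss_rats \<subseteq> k"
  using assms by (auto simp: gauss_rats_def intro!: is_subfieldD(4,7))

lemma rpoly_gauss_rats: "z \<in> gauss_rats \<Longrightarrow> rpoly p z \<in> gauss_rats"
proof (induction p)
  case (pCons a p)
  have "of_rat a \<in> gauss_rats" using Rats_subset_gauss_rats by auto
  then show ?case using pCons gauss_rats_closed by simp
qed (use Rats_subset_gauss_rats in auto)

text \<open>Real and imaginary parts give \<open>v z \<le> 2 * cmod z\<close>, and passing to powers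
  removes the factor 2. Applied to the conjugate, whose product with \<open>z\<close> is rational,
  this yields the reverse inequality.\<close>

lemma arch_place_gauss_rats:
  assumes k: "is_subfield k" "\<i> \<in> k" and v: "v \<in> arch_places k" and z: "z \<in> gauss_rats"
  shows "v z = cmod z"
proof -
  have av: "absolute_value_on k v" and vq: "\<And>q. v (of_rat q) = \<bar>of_rat q\<bar>" and v0: "\<And>x. x \<notin> k \<Longrightarrow> v x = 0"
    using v by (auto simp: arch_places_def)
  note vD = absolute_value_onD[OF av k(1)]
  \<comment> \<open>Outside \<open>k\<close> a place is 0, but on rationals it is the usual absolute
    value.\<close>
  have Q: "of_rat q \<in> k" for q
  proof (rule ccontr)
    assume "of_rat q \<notin> k"
    moreover from this have "q \<noteq> 0" using is_subfieldD(1)[OF k(1)] by auto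
    ultimately show False using v0[of "of_rat q"] vq[of q] by simp
  qed
  then have GQ: "gauss_rats \<subseteq> k" by (intro gauss_rats_subset k) (auto elim!: Rats_cases)
  have "v (- 1) = 1" using vq[of "- 1"] by simp
  then have "v \<i> * v \<i> = 1" using vD(5)[of \<i> \<i>] k(2) by simp
  then have vi: "v \<i> = 1" using vD(1)[of \<i>] k(2) by (simp add: square_eq_1_iff)
  have 1: "v z \<le> 2 * cmod z" if "z \<in> gauss_rats" for z
  proof -
    from that obtain a b where z: "z = of_rat a + of_rat b * \<i>" by (auto simp: gauss_rats_def)
    have "v z \<le> v (of_rat a) + v (of_rat b * \<i>)"
      unfolding z using Q k(2) is_subfieldD(4)[OF k(1)] by (intro vD(6)) auto
    also have "v (of_rat b * \<i>) = v (of_rat b)" using vD(5)[of "of_rat b" \<i>] Q k(2) vi by simp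
    also have "v (of_rat a) = \<bar>Re z\<bar>"
      unfolding z vq by (simp add: of_real_of_rat_complex [symmetric] del: of_real_of_rat_complex)
    also have "v (of_rat b) = \<bar>Im z\<bar>"
      unfolding z vq by (simp add: of_real_of_rat_complex [symmetric] del: of_real_of_rat_complex)
    also have "\<bar>Re z\<bar> + \<bar>Im z\<bar> \<le> 2 * cmod z" using abs_Re_le_cmod[of z] abs_Im_le_cmod[of z] by linarith
    finally show ?thesis .
  qed
  have le: "v z \<le> cmod z" if z: "z \<in> gauss_rats" for z
  proof (cases "z = 0")
    case False
    have zn: "z ^ n \<in> gauss_rats" for n
      using z Rats_subset_gauss_rats by (induction n) (auto intro: gauss_rats_closed)
    show ?thesis
    proof (rule power_le_multiple_imp_le[of _ _ 2])
      show "v z ^ n \<le> 2 * cmod z ^ n" for n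
        using 1[OF zn, of n] vD(10)[of z n] z GQ by (auto simp: norm_power)
    qed (use False z GQ vD(1) in auto)
  qed (simp add: vD(3))
  show ?thesis
  proof (cases "z = 0")
    case False
    have c: "cnj z \<in> gauss_rats" using z by (rule gauss_rats_cnj)
    obtain a b where zab: "z = of_rat a + of_rat b * \<i>" using z by (auto simp: gauss_rats_def)
    have "z * cnj z = of_rat (a * a + b * b)"
      unfolding zab by (simp add: complex_eq_iff of_real_of_rat_complex [symmetric] of_rat_add of_rat_mult del: of_real_of_rat_complex)
    then have zz: "of_rat (a * a + b * b) = z * cnj z" by simp
    have zk: "z \<in> k" "cnj z \<in> k" using z c GQ by auto
    have "cmod z * cmod z = cmod (z * cnj z)" by (simp only: norm_mult complex_mod_cnj)
    also have "\<dots> = v (z * cnj z)" unfolding zz [symmetric] by (simp only: vq norm_of_rat)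
    also have "\<dots> = v z * v (cnj z)" by (rule vD(5)[OF zk])
    also have "v z * v (cnj z) \<le> v z * cmod z"
      using le[OF c] vD(1)[of z] z GQ by (intro mult_left_mono) auto
    finally have "cmod z \<le> v z" using False by simp
    then show ?thesis using le[OF z] by simp
  qed (simp add: vD(3))
qed

section \<open>Classification of the archimedean places\<close>

context
  fixes \<theta> :: complex and f :: "rat poly" and v :: "complex \<Rightarrow> real"
  assumes f: "is_minpoly f \<theta>" and k: "is_subfield (adj \<theta>)" and i: "\<i> \<in> adj \<theta>"
    and v: "v \<in> arch_places (adj \<theta>)"
begin

lemma arch_place_absolute_value: "absolute_value_on (adj \<theta>) v"
  using v by (simp add: arch_places_def)

lemmas arch_place_rules = absolute_value_onD[OF arch_place_absolute_value k]

lemma gauss_rats_subset_adj: "gauss_rats \<subseteq> adj \<theta>"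
  by (rule gauss_rats_subset[OF k Rats_subset_adj i])

lemma arch_place_gauss_rat: "z \<in> gauss_rats \<Longrightarrow> v z = cmod z"
  by (rule arch_place_gauss_rats[OF k i v])

lemma rpoly_tendsto: "(g \<longlongrightarrow> z) F \<Longrightarrow> ((\<lambda>n. rpoly p (g n)) \<longlongrightarrow> rpoly p z) F"
  unfolding rpoly_def by (rule tendsto_poly)

text \<open>As the product of the \<open>\<theta> - \<rho>\<close> over all roots \<open>\<rho>\<close> vanishes, Gaussian rationals close to some
  root \<open>\<rho>\<close> are \<open>v\<close>-adically close to \<open>\<theta>\<close>.\<close>

lemma exists_close_root:
  "\<exists>\<rho> g. rpoly f \<rho> = 0 \<and> (\<forall>n. g n \<in> gauss_rats) \<and> g \<longlonglongrightarrow> \<rho> \<and> (\<lambda>n. v (\<theta> - g n)) \<longlonglongrightarrow> 0"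
proof -
  have f0: "f \<noteq> 0" "rpoly f \<theta> = 0" using f by (auto simp: is_minpoly_def)
  define R where "R = {\<rho>. rpoly f \<rho> = 0}"
  have fin: "finite R" unfolding R_def by (rule finite_rpoly_roots[OF f0(1)])
  obtain g where g: "\<And>\<rho> n. g \<rho> n \<in> gauss_rats" "\<And>\<rho>. g \<rho> \<longlonglongrightarrow> \<rho>"
    using gauss_rats_sequence_tendsto by metis
  have in_k: "\<theta> - g \<rho> n \<in> adj \<theta>" for \<rho> n
    using g gauss_rats_subset_adj self_in_adj by (auto intro!: is_subfieldD(3)[OF k])
  \<comment> \<open>On differences of Gaussian rationals \<open>v\<close> equals
    \<open>cmod\<close>, so these real sequences are Cauchy.\<close>
  have "\<exists>L. (\<lambda>n. v (\<theta> - g \<rho> n)) \<longlonglongrightarrow> L" for \<rho>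
  proof -
    have "\<bar>v (\<theta> - g \<rho> m) - v (\<theta> - g \<rho> n)\<bar> \<le> cmod (g \<rho> m - g \<rho> n)" for m n
    proof -
      have "\<bar>v (\<theta> - g \<rho> m) - v (\<theta> - g \<rho> n)\<bar> \<le> v ((\<theta> - g \<rho> m) - (\<theta> - g \<rho> n))"
        by (rule arch_place_rules(9)[OF in_k in_k])
      also have "(\<theta> - g \<rho> m) - (\<theta> - g \<rho> n) = g \<rho> n + - g \<rho> m" by simp
      also have "v \<dots> = cmod (g \<rho> n + - g \<rho> m)" using g(1) by (intro arch_place_gauss_rat gauss_rats_closed(1) gauss_rats_uminus)
      also have "\<dots> = cmod (g \<rho> m - g \<rho> n)" by (simp add: norm_minus_commute)
      finally show ?thesis .
    qed
    moreover have "Cauchy (g \<rho>)" using g(2) convergent_def convergent_Cauchy by blast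
    ultimately have "Cauchy (\<lambda>n. v (\<theta> - g \<rho> n))"
      unfolding Cauchy_def dist_norm real_norm_def by (meson le_less_trans)
    then show ?thesis using Cauchy_convergent convergent_def by blast
  qed
  then obtain L where L: "\<And>\<rho>. (\<lambda>n. v (\<theta> - g \<rho> n)) \<longlonglongrightarrow> L \<rho>" by metis
  \<comment> \<open>The coefficients of this product depend continuously on \<open>h\<close>, and
    they are Gaussian rationals when the values of \<open>h\<close> are, so that \<open>v\<close> is
    known on them.\<close>
  define P where "P A h = (\<Prod>\<rho>\<in>A. [:- h \<rho>, 1:])" for A and h :: "complex \<Rightarrow> complex"
  have P_insert: "poly.coeff (P (insert \<rho> A) h) m = (case m of 0 \<Rightarrow> 0 | Suc j \<Rightarrow> poly.coeff (P A h) j) - h \<rho> * poly.coeff (P A h) m"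
    if "finite A" "\<rho> \<notin> A" for \<rho> A h m
    using that by (simp add: P_def coeff_pCons split: nat.splits)
  have P_lim: "(\<lambda>n. poly.coeff (P A (\<lambda>\<rho>. g \<rho> n)) m) \<longlonglongrightarrow> poly.coeff (P A (\<lambda>\<rho>. \<rho>)) m" if "finite A" for A m
    using that
  proof (induction A arbitrary: m)
    case (insert \<rho> A)
    then show ?case
      unfolding P_insert[OF insert.hyps] by (cases m) (auto intro!: tendsto_intros g)
  qed (simp add: P_def)
  have P_gauss: "poly.coeff (P A (\<lambda>\<rho>. g \<rho> n)) m \<in> gauss_rats" if "finite A" for A n m
    using that
  proof (induction A arbitrary: m)
    case (insert \<rho> A)
    have "0 \<in> gauss_rats" using Rats_subset_gauss_rats by auto
    then have "(case m of 0 \<Rightarrow> 0 | Suc j \<Rightarrow> poly.coeff (P A (\<lambda>\<rho>. g \<rho> n)) j) + - (g \<rho> n * poly.coeff (P A (\<lambda>\<rho>. g \<rho> n)) m) \<in> gauss_rats"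
      using insert g(1) by (intro gauss_rats_closed(1,2) gauss_rats_uminus) (auto split: nat.splits)
    then show ?case unfolding P_insert[OF insert.hyps] by simp
  qed (use Rats_subset_gauss_rats in \<open>auto simp: P_def\<close>)
  define c c0 where "c n m = poly.coeff (P R (\<lambda>\<rho>. g \<rho> n)) m" and "c0 m = poly.coeff (P R (\<lambda>\<rho>. \<rho>)) m" for n m
  define d where "d = card R"
  have degP: "Polynomial.degree (P R h) \<le> d" for h
    unfolding P_def d_def by (rule order_trans[OF degree_prod_sum_le[OF fin]]) simp
  have P_eval: "poly (P R h) x = (\<Sum>m\<le>d. poly.coeff (P R h) m * x ^ m)" for h x
    unfolding poly_altdef using degP by (intro sum.mono_neutral_left) (auto simp: coeff_eq_0)
  have "\<exists>l. l \<noteq> 0 \<and> map_poly of_rat f = Polynomial.smult (of_rat l) (P R (\<lambda>\<rho>. \<rho>))"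
  proof (intro exI conjI)
    show "poly.coeff f (Polynomial.degree f) \<noteq> 0" using f0(1) by simp
    show "map_poly of_rat f = Polynomial.smult (of_rat (poly.coeff f (Polynomial.degree f))) (P R (\<lambda>\<rho>. \<rho>))"
      using complex_poly_decompose_rsquarefree[OF minpoly_rsquarefree[OF f]]
      by (simp add: P_def R_def rpoly_def coeff_map_poly)
  qed
  then obtain l where l: "l \<noteq> 0" "map_poly of_rat f = Polynomial.smult (of_rat l) (P R (\<lambda>\<rho>. \<rho>))" by blast
  \<comment> \<open>The limit coefficients are those of \<open>f\<close> up to the rational factor
    \<open>l\<close>; hence \<open>v\<close> is also known on the differences
    \<open>c n m - c0 m\<close>, which tend to 0.\<close>
  have PQ: "c0 m \<in> gauss_rats" for m
  proof -
    have "of_rat (poly.coeff f m) = of_rat l * c0 m"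
      using arg_cong[OF l(2), of "\<lambda>p. poly.coeff p m"] by (simp add: coeff_map_poly c0_def)
    then have "c0 m = of_rat (poly.coeff f m / l)"
      using l(1) by (simp add: of_rat_divide field_simps)
    then show ?thesis using Rats_subset_gauss_rats by auto
  qed
  have "poly (P R (\<lambda>\<rho>. \<rho>)) \<theta> = 0"
    using f0(2) l by (simp add: rpoly_def)
  \<comment> \<open>Subtracting the vanishing product over the exact roots leaves a polynomial in
    \<open>\<theta>\<close> with small coefficients.\<close>
  then have diff: "poly (P R (\<lambda>\<rho>. g \<rho> n)) \<theta> = (\<Sum>m\<le>d. (c n m + - c0 m) * \<theta> ^ m)" for n
    unfolding P_eval c_def c0_def by (simp add: algebra_simps sum_subtractf)
  have vsum: "v (\<Sum>a\<in>A. h a) \<le> (\<Sum>a\<in>A. v (h a))" if "finite A" "\<And>a. h a \<in> adj \<theta>" for A :: "nat set" and h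
    using that(1)
  proof (induction A)
    case (insert a A)
    then have "v (\<Sum>a\<in>insert a A. h a) \<le> v (h a) + v (\<Sum>a\<in>A. h a)"
      using that(2) is_subfield_sum[OF k, of A h] by (simp add: arch_place_rules(6))
    with insert show ?case by simp
  qed (simp add: arch_place_rules(3))
  have "v (poly (P R (\<lambda>\<rho>. g \<rho> n)) \<theta>) \<le> (\<Sum>m\<le>d. cmod (c n m - c0 m) * v (\<theta> ^ m))" for n
  proof -
    have gm: "c n m + - c0 m \<in> gauss_rats" for m
      unfolding c_def by (intro gauss_rats_closed(1) gauss_rats_uminus P_gauss[OF fin] PQ)
    have tm: "\<theta> ^ m \<in> adj \<theta>" for m using self_in_adj by (rule is_subfield_power[OF k])
    have "v (poly (P R (\<lambda>\<rho>. g \<rho> n)) \<theta>) \<le> (\<Sum>m\<le>d. v ((c n m + - c0 m) * \<theta> ^ m))"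
      unfolding diff using gm gauss_rats_subset_adj tm by (intro vsum is_subfieldD(4)[OF k]) auto
    also have "\<dots> = (\<Sum>m\<le>d. cmod (c n m - c0 m) * v (\<theta> ^ m))"
      using arch_place_rules(5)[OF subsetD[OF gauss_rats_subset_adj gm] tm] arch_place_gauss_rat[OF gm] by simp
    finally show ?thesis .
  qed
  moreover have "(\<lambda>n. \<Sum>m\<le>d. cmod (c n m - c0 m) * v (\<theta> ^ m)) \<longlonglongrightarrow>
      (\<Sum>m\<le>d. cmod (c0 m - c0 m) * v (\<theta> ^ m))"
    unfolding c_def c0_def by (intro tendsto_intros P_lim[OF fin])
  then have "(\<lambda>n. \<Sum>m\<le>d. cmod (c n m - c0 m) * v (\<theta> ^ m)) \<longlonglongrightarrow> 0"
    by simp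
  moreover have vP: "v (poly (P R (\<lambda>\<rho>. g \<rho> n)) \<theta>) = (\<Prod>\<rho>\<in>R. v (\<theta> - g \<rho> n))" for n
  proof -
    have "v (\<Prod>\<rho>\<in>A. \<theta> - g \<rho> n) = (\<Prod>\<rho>\<in>A. v (\<theta> - g \<rho> n))" if "finite A" for A
      using that
    proof (induction A)
      case (insert \<rho> A)
      have "(\<Prod>\<rho>\<in>A. \<theta> - g \<rho> n) \<in> adj \<theta>" using in_k by (intro is_subfield_prod[OF k])
      then show ?case using insert arch_place_rules(5)[OF in_k] by simp
    qed (simp add: arch_place_rules(4))
    then show ?thesis using fin by (simp add: P_def poly_prod)
  qed
  ultimately have "(\<lambda>n. \<Prod>\<rho>\<in>R. v (\<theta> - g \<rho> n)) \<longlonglongrightarrow> 0"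
  proof -
    assume le: "\<And>n. v (poly (P R (\<lambda>\<rho>. g \<rho> n)) \<theta>) \<le> (\<Sum>m\<le>d. cmod (c n m - c0 m) * v (\<theta> ^ m))"
      and lim: "(\<lambda>n. \<Sum>m\<le>d. cmod (c n m - c0 m) * v (\<theta> ^ m)) \<longlonglongrightarrow> 0"
    show ?thesis
    proof (rule tendsto_sandwich[OF _ _ tendsto_const lim]; intro always_eventually allI)
      fix n
      show "0 \<le> (\<Prod>\<rho>\<in>R. v (\<theta> - g \<rho> n))" using arch_place_rules(1)[OF in_k] by (intro prod_nonneg) auto
      show "(\<Prod>\<rho>\<in>R. v (\<theta> - g \<rho> n)) \<le> (\<Sum>m\<le>d. cmod (c n m - c0 m) * v (\<theta> ^ m))"
        using le[of n] by (simp only: vP)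
    qed
  qed
  moreover have "(\<lambda>n. \<Prod>\<rho>\<in>R. v (\<theta> - g \<rho> n)) \<longlonglongrightarrow> (\<Prod>\<rho>\<in>R. L \<rho>)"
    by (intro tendsto_prod L)
  ultimately have "(\<Prod>\<rho>\<in>R. L \<rho>) = 0" by (rule LIMSEQ_unique[symmetric])
  then obtain \<rho> where "\<rho> \<in> R" "L \<rho> = 0" using fin by auto
  then show ?thesis
    using L[of \<rho>] g by (intro exI[of _ \<rho>] exI[of _ "g \<rho>"]) (auto simp: R_def)
qed

text \<open>For Gaussian rationals \<open>g n\<close> that approach \<open>\<rho>\<close> in the
  complex plane and \<open>\<theta>\<close> with respect to \<open>v\<close>, the values
  \<open>v (rpoly p (g n))\<close> tend both to \<open>v (rpoly p \<theta>)\<close> and to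
  \<open>cmod (rpoly p \<rho>)\<close>.\<close>

lemma arch_place_eq_emb_place:
  "\<exists>\<rho>. rpoly f \<rho> = 0 \<and> v = emb_place \<theta> \<rho>"
proof -
  obtain \<rho> g where \<rho>: "rpoly f \<rho> = 0" and g: "\<And>n. g n \<in> gauss_rats" "g \<longlonglongrightarrow> \<rho>" "(\<lambda>n. v (\<theta> - g n)) \<longlonglongrightarrow> 0"
    using exists_close_root by blast
  have gk: "rpoly p (g n) \<in> adj \<theta>" for p n using rpoly_gauss_rats[OF g(1)] gauss_rats_subset_adj by blast
  have tk: "\<theta> - g n \<in> adj \<theta>" for n using g(1) gauss_rats_subset_adj self_in_adj by (auto intro!: is_subfieldD(3)[OF k])
  have dk: "rpoly p \<theta> - rpoly p (g n) \<in> adj \<theta>" for p n by (intro is_subfieldD(3)[OF k] gk rpoly_in_adj)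
  have lim: "(\<lambda>n. v (rpoly p \<theta> - rpoly p (g n))) \<longlonglongrightarrow> 0" for p
  proof (induction p)
    case 0
    then show ?case by (simp add: arch_place_rules(3))
  next
    case (pCons a p)
    have le: "v (rpoly (pCons a p) \<theta> - rpoly (pCons a p) (g n)) \<le>
        v \<theta> * v (rpoly p \<theta> - rpoly p (g n)) + v (\<theta> - g n) * cmod (rpoly p (g n))" for n
    proof -
      have "rpoly (pCons a p) \<theta> - rpoly (pCons a p) (g n) =
          \<theta> * (rpoly p \<theta> - rpoly p (g n)) + (\<theta> - g n) * rpoly p (g n)" by (simp add: algebra_simps)
      also have "v \<dots> \<le> v (\<theta> * (rpoly p \<theta> - rpoly p (g n))) + v ((\<theta> - g n) * rpoly p (g n))"
        by (intro arch_place_rules(6) is_subfieldD(4)[OF k] dk tk gk self_in_adj)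
      also have "\<dots> = v \<theta> * v (rpoly p \<theta> - rpoly p (g n)) + v (\<theta> - g n) * v (rpoly p (g n))"
        using arch_place_rules(5)[OF self_in_adj dk] arch_place_rules(5)[OF tk gk] by simp
      finally show ?thesis using arch_place_gauss_rat[OF rpoly_gauss_rats[OF g(1)]] by simp
    qed
    have "(\<lambda>n. v \<theta> * v (rpoly p \<theta> - rpoly p (g n)) + v (\<theta> - g n) * cmod (rpoly p (g n))) \<longlonglongrightarrow>
        v \<theta> * 0 + 0 * cmod (rpoly p \<rho>)"
      by (intro tendsto_intros pCons.IH g rpoly_tendsto)
    then have "(\<lambda>n. v \<theta> * v (rpoly p \<theta> - rpoly p (g n)) + v (\<theta> - g n) * cmod (rpoly p (g n))) \<longlonglongrightarrow> 0"
      by simp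
    then show ?case
      by (rule tendsto_sandwich[OF _ _ tendsto_const, rotated 2]; intro always_eventually allI le arch_place_rules(1)[OF dk])
  qed
  have eq: "v (rpoly p \<theta>) = cmod (rpoly p \<rho>)" for p
  proof -
    have "(\<lambda>n. v (rpoly p (g n)) - v (rpoly p \<theta>)) \<longlonglongrightarrow> 0"
    proof (rule tendsto_rabs_zero_cancel, rule tendsto_sandwich[OF _ _ tendsto_const lim])
      show "\<forall>\<^sub>F n in sequentially. \<bar>v (rpoly p (g n)) - v (rpoly p \<theta>)\<bar> \<le> v (rpoly p \<theta> - rpoly p (g n))"
        using arch_place_rules(9)[OF rpoly_in_adj gk] by (auto simp: abs_minus_commute intro!: always_eventually)
    qed auto
    then have "(\<lambda>n. v (rpoly p (g n))) \<longlonglongrightarrow> v (rpoly p \<theta>)" by (rule LIM_zero_cancel)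
    moreover have "(\<lambda>n. v (rpoly p (g n))) \<longlonglongrightarrow> cmod (rpoly p \<rho>)"
      using arch_place_gauss_rat[OF rpoly_gauss_rats[OF g(1)]] by (simp add: tendsto_norm[OF rpoly_tendsto[OF g(2)]])
    ultimately show ?thesis by (rule LIMSEQ_unique)
  qed
  have "v x = emb_place \<theta> \<rho> x" for x
  proof (cases "x \<in> adj \<theta>")
    case True
    then obtain p where p: "x = rpoly p \<theta>" by (auto simp: adj_def)
    then show ?thesis using True eq[of p] by (simp add: emb_place_def emb_rpoly[OF f \<rho>])
  next
    case False
    then show ?thesis using v by (simp add: arch_places_def emb_place_def)
  qed
  with \<rho> show ?thesis by blast
qed

end

section \<open>The product over the archimedean places\<close>

context
  fixes \<theta> :: complex and f :: "rat poly"
  assumes f: "is_minpoly f \<theta>" and k: "is_subfield (adj \<theta>)" and i: "\<i> \<in> adj \<theta>"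
begin

lemma emb_ii:
  assumes \<rho>: "rpoly f \<rho> = 0"
  shows "emb \<theta> \<rho> \<i> = \<i> \<or> emb \<theta> \<rho> \<i> = - \<i>"
proof -
  have "emb \<theta> \<rho> (\<i> * \<i>) = emb \<theta> \<rho> (of_rat (- 1))" by simp
  then have "emb \<theta> \<rho> \<i> * emb \<theta> \<rho> \<i> = - 1"
    unfolding emb_hom(2)[OF f \<rho> i i] emb_of_rat[OF f \<rho>] by simp
  then have "(emb \<theta> \<rho> \<i> - \<i>) * (emb \<theta> \<rho> \<i> + \<i>) = 0" by (simp add: algebra_simps)
  then show ?thesis by (auto simp: add_eq_0_iff2)
qed

text \<open>One root from each conjugate pair: the embeddings for \<open>\<rho>\<close> and its
  conjugate induce the same place but send \<i> to opposite values.\<close>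

definition roots_ii :: "complex set" where
  "roots_ii = {\<rho>. rpoly f \<rho> = 0 \<and> emb \<theta> \<rho> \<i> = \<i>}"

lemma emb_gauss_rats:
  assumes "\<rho> \<in> roots_ii" "z \<in> gauss_rats"
  shows "emb \<theta> \<rho> z = z"
proof -
  have \<rho>: "rpoly f \<rho> = 0" "emb \<theta> \<rho> \<i> = \<i>" using assms(1) by (auto simp: roots_ii_def)
  obtain a b where z: "z = of_rat a + of_rat b * \<i>" using assms(2) by (auto simp: gauss_rats_def)
  have q: "of_rat a \<in> adj \<theta>" "of_rat b \<in> adj \<theta>" "of_rat b * \<i> \<in> adj \<theta>"
    using Rats_subset_adj[of \<theta>] i by (auto intro!: is_subfieldD(4)[OF k])
  show ?thesis
    unfolding z emb_hom(1)[OF f \<rho>(1) q(1,3)] emb_hom(2)[OF f \<rho>(1) q(2) i] emb_of_rat[OF f \<rho>(1)] \<rho>(2) ..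
qed

lemma cnj_root: "rpoly f \<rho> = 0 \<Longrightarrow> rpoly f (cnj \<rho>) = 0"
  by (simp add: rpoly_cnj[OF f])

lemma emb_place_cnj: "rpoly f \<rho> = 0 \<Longrightarrow> emb_place \<theta> (cnj \<rho>) = emb_place \<theta> \<rho>"
  by (auto simp: emb_place_def fun_eq_iff emb_cnj[OF f])

lemma roots_split: "{\<rho>. rpoly f \<rho> = 0} = roots_ii \<union> cnj ` roots_ii" "roots_ii \<inter> cnj ` roots_ii = {}"
proof -
  have c: "emb \<theta> (cnj \<rho>) \<i> = cnj (emb \<theta> \<rho> \<i>)" if "rpoly f \<rho> = 0" for \<rho>
    using emb_cnj[OF f that i] .
  show "{\<rho>. rpoly f \<rho> = 0} = roots_ii \<union> cnj ` roots_ii"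
  proof (intro equalityI subsetI)
    fix \<rho> assume "\<rho> \<in> {\<rho>. rpoly f \<rho> = 0}"
    then have \<rho>: "rpoly f \<rho> = 0" by simp
    show "\<rho> \<in> roots_ii \<union> cnj ` roots_ii"
    proof (cases "emb \<theta> \<rho> \<i> = \<i>")
      case False
      then have "emb \<theta> \<rho> \<i> = - \<i>" using emb_ii[OF \<rho>] by simp
      then have "cnj \<rho> \<in> roots_ii" using c[OF \<rho>] cnj_root[OF \<rho>] by (simp add: roots_ii_def)
      then have "cnj (cnj \<rho>) \<in> cnj ` roots_ii" by (rule imageI)
      then show ?thesis by simp
    qed (use \<rho> in \<open>simp add: roots_ii_def\<close>)
  qed (use cnj_root in \<open>auto simp: roots_ii_def\<close>)
  show "roots_ii \<inter> cnj ` roots_ii = {}"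
    using c by (auto simp: roots_ii_def complex_eq_iff)
qed

lemma finite_roots_ii: "finite roots_ii"
proof -
  have "f \<noteq> 0" using f by (simp add: is_minpoly_def)
  then show ?thesis by (intro finite_subset[OF _ finite_rpoly_roots[of f]]) (auto simp: roots_ii_def)
qed

text \<open>Injectivity: the place determines the distances of \<open>\<rho>\<close> to all Gaussian
  rationals, hence \<open>\<rho>\<close>. Surjectivity: the classification yields some root, which
  conjugation moves into \<open>roots_ii\<close> without changing the place.\<close>

lemma bij_betw_emb_place: "bij_betw (emb_place \<theta>) roots_ii (arch_places (adj \<theta>))"
  unfolding bij_betw_def
proof
  show "inj_on (emb_place \<theta>) roots_ii"
  proof (rule inj_onI)
    fix \<rho> \<sigma> assume \<rho>: "\<rho> \<in> roots_ii" and \<sigma>: "\<sigma> \<in> roots_ii" and eq: "emb_place \<theta> \<rho> = emb_place \<theta> \<sigma>"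
    obtain g where g: "\<And>n. g n \<in> gauss_rats" "g \<longlonglongrightarrow> \<rho>" using gauss_rats_sequence_tendsto by metis
    have gk: "g n \<in> adj \<theta>" for n
      using g(1) gauss_rats_subset[OF k Rats_subset_adj i] by blast
    have emb: "emb \<theta> \<tau> (\<theta> - g n) = \<tau> - g n" if "\<tau> \<in> roots_ii" for \<tau> n
    proof -
      have "rpoly f \<tau> = 0" using that by (simp add: roots_ii_def)
      then show ?thesis
        using emb_hom(3)[OF f _ self_in_adj gk] emb_self[OF f] emb_gauss_rats[OF that g(1)] by simp
    qed
    have "cmod (\<rho> - g n) = cmod (\<sigma> - g n)" for n
      using fun_cong[OF eq, of "\<theta> - g n"] is_subfieldD(3)[OF k self_in_adj gk]
      by (simp add: emb_place_def emb \<rho> \<sigma>)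
    then have "(\<lambda>n. cmod (\<rho> - g n)) \<longlonglongrightarrow> cmod (\<sigma> - \<rho>)"
      by (simp only:) (intro tendsto_intros g)
    moreover have "(\<lambda>n. cmod (\<rho> - g n)) \<longlonglongrightarrow> cmod (\<rho> - \<rho>)" by (intro tendsto_intros g)
    ultimately have "cmod (\<sigma> - \<rho>) = cmod (\<rho> - \<rho>)" by (rule LIMSEQ_unique)
    then show "\<rho> = \<sigma>" by simp
  qed
  show "emb_place \<theta> ` roots_ii = arch_places (adj \<theta>)"
  proof
    show "emb_place \<theta> ` roots_ii \<subseteq> arch_places (adj \<theta>)"
      using emb_place_arch[OF f _ k] by (auto simp: roots_ii_def)
    show "arch_places (adj \<theta>) \<subseteq> emb_place \<theta> ` roots_ii"
    proof
      fix v assume "v \<in> arch_places (adj \<theta>)"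
      then obtain \<rho> where \<rho>: "rpoly f \<rho> = 0" "v = emb_place \<theta> \<rho>"
        using arch_place_eq_emb_place[OF f k i] by blast
      then have "\<rho> \<in> roots_ii \<union> cnj ` roots_ii" using roots_split(1) by blast
      then show "v \<in> emb_place \<theta> ` roots_ii"
      proof
        assume "\<rho> \<in> cnj ` roots_ii"
        then obtain \<sigma> where "\<sigma> \<in> roots_ii" "\<rho> = cnj \<sigma>" by blast
        moreover from this have "v = emb_place \<theta> \<sigma>"
          using \<rho>(2) emb_place_cnj[of \<sigma>] by (simp add: roots_ii_def)
        ultimately show ?thesis by blast
      qed (use \<rho> in blast)
    qed
  qed
qed

lemma finite_arch_places: "finite (arch_places (adj \<theta>))"
  using bij_betw_finite[OF bij_betw_emb_place] finite_roots_ii by simp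

lemma arch_places_nonempty: "arch_places (adj \<theta>) \<noteq> {}"
proof -
  have "rpoly f \<theta> = 0" using f by (simp add: is_minpoly_def)
  then show ?thesis using emb_place_arch[OF f _ k] by blast
qed

text \<open>Every archimedean place is counted by a root and by its conjugate, hence the
  square.\<close>

lemma prod_roots_eq_prod_arch_places:
  assumes x: "x \<in> adj \<theta>"
  shows "(\<Prod>\<rho> | rpoly f \<rho> = 0. cmod (emb \<theta> \<rho> x)) = (\<Prod>v\<in>arch_places (adj \<theta>). v x)\<^sup>2"
proof -
  have "(\<Prod>\<rho> | rpoly f \<rho> = 0. cmod (emb \<theta> \<rho> x)) =
      (\<Prod>\<rho>\<in>roots_ii. cmod (emb \<theta> \<rho> x)) * (\<Prod>\<rho>\<in>cnj ` roots_ii. cmod (emb \<theta> \<rho> x))"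
    unfolding roots_split(1) using finite_roots_ii roots_split(2) by (intro prod.union_disjoint) auto
  also have "(\<Prod>\<rho>\<in>cnj ` roots_ii. cmod (emb \<theta> \<rho> x)) = (\<Prod>\<rho>\<in>roots_ii. cmod (emb \<theta> (cnj \<rho>) x))"
    by (subst prod.reindex) (auto simp: inj_on_def)
  also have "\<dots> = (\<Prod>\<rho>\<in>roots_ii. cmod (emb \<theta> \<rho> x))"
    by (rule prod.cong) (auto simp: roots_ii_def emb_cnj[OF f _ x])
  also have "(\<Prod>\<rho>\<in>roots_ii. cmod (emb \<theta> \<rho> x)) = (\<Prod>\<rho>\<in>roots_ii. emb_place \<theta> \<rho> x)"
    using x by (simp add: emb_place_def)
  also have "\<dots> = (\<Prod>v\<in>arch_places (adj \<theta>). v x)"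
    by (rule prod.reindex_bij_betw[OF bij_betw_emb_place])
  finally show ?thesis by (simp add: power2_eq_square)
qed

text \<open>The norm of the cofactor \<open>K = R / G\<close> is a polynomial with rational coefficients, so at integral
  points its values have bounded denominators and cannot be small.\<close>

lemma prod_arch_places_bounded:
  fixes G K R :: "'n::finite mpoly"
  assumes GK: "G * K = R" and Gk: "coeffs_in (adj \<theta>) G" and RQ: "coeffs_in \<rat> R"
  shows "\<exists>C. \<forall>z. mp_eval R (int_vec z) \<noteq> 0 \<longrightarrow> cmod (mp_eval R (int_vec z)) \<le> B \<longrightarrow>
    (\<Prod>v\<in>arch_places (adj \<theta>). v (mp_eval G (int_vec z))) \<le> C"
proof -
  define M where "M = Poly_Mapping.keys K"
  have finM: "finite M" by (simp add: M_def)
  obtain \<kappa> where \<kappa>: "\<forall>m\<in>M. \<kappa> m \<in> adj \<theta>"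
    and rel: "\<forall>a b. (\<forall>m\<in>M. a m \<in> adj \<theta>) \<and> b \<in> adj \<theta> \<and> (\<Sum>m\<in>M. a m * Poly_Mapping.lookup K m) = b \<longrightarrow> (\<Sum>m\<in>M. a m * \<kappa> m) = b"
    using linear_relations_descend[OF k finM, of "Poly_Mapping.lookup K"] by (elim exE conjE)
  \<comment> \<open>\<open>L\<close> is the cofactor with its coefficients moved into
    \<open>adj \<theta>\<close>; its product with \<open>G\<close> still equals \<open>R\<close> at
    integral points.\<close>
  define L where "L x = (\<Sum>m\<in>M. mon_val x m * \<kappa> m)" for x :: "complex ^ 'n"
  define \<R> where "\<R> = {\<rho>. rpoly f \<rho> = 0}"
  have f0: "f \<noteq> 0" using f by (simp add: is_minpoly_def)
  have fin\<R>: "finite \<R>" unfolding \<R>_def by (rule finite_rpoly_roots[OF f0])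
  \<comment> \<open>The norm of \<open>L\<close>. Its coefficients are complex a priori, but its
    values at integral points are rational, so a second descent, now to the rationals, gives values
    with a common denominator \<open>A\<close>.\<close>
  define Q where "Q = (\<Prod>\<rho>\<in>\<R>. \<Sum>m\<in>M. Poly_Mapping.single m (emb \<theta> \<rho> (\<kappa> m)))"
  have Qk: "\<rat> \<subseteq> adj \<theta>" by (rule Rats_subset_adj)
  have monQ: "mon_val (int_vec z) m \<in> \<rat>" for z :: "'n \<Rightarrow> int" and m by (rule mon_val_Rats) simp
  have Lk: "L (int_vec z) \<in> adj \<theta>" for z
    unfolding L_def using monQ Qk \<kappa> by (intro is_subfield_sum[OF k] is_subfieldD(4)[OF k]) auto
  have Gk': "mp_eval G (int_vec z) \<in> adj \<theta>" for z
    by (rule mp_eval_in_subfield[OF k Gk]) (use Qk in auto)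
  have RQ': "mp_eval R (int_vec z) \<in> \<rat>" for z
    by (rule mp_eval_in_subfield[OF is_subfield_Rats RQ]) auto
  have GL: "mp_eval G (int_vec z) * L (int_vec z) = mp_eval R (int_vec z)" for z
  proof -
    have "(\<Sum>m\<in>M. (mp_eval G (int_vec z) * mon_val (int_vec z) m) * Poly_Mapping.lookup K m) = mp_eval R (int_vec z)"
      unfolding GK [symmetric] mp_eval_mult
      by (simp add: mp_eval_def[of K] M_def sum_distrib_left mult_ac)
    then have "(\<Sum>m\<in>M. (mp_eval G (int_vec z) * mon_val (int_vec z) m) * \<kappa> m) = mp_eval R (int_vec z)"
      using monQ Qk Gk' RQ' by (intro rel[rule_format] conjI ballI is_subfieldD(4)[OF k]) auto
    then show ?thesis by (simp add: L_def sum_distrib_left mult_ac)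
  qed
  have embL: "emb \<theta> \<rho> (L (int_vec z)) = (\<Sum>m\<in>M. emb \<theta> \<rho> (\<kappa> m) * mon_val (int_vec z) m)" if "\<rho> \<in> \<R>" for \<rho> z
  proof -
    have \<rho>: "rpoly f \<rho> = 0" using that by (simp add: \<R>_def)
    have "emb \<theta> \<rho> (mon_val (int_vec z) m * \<kappa> m) = emb \<theta> \<rho> (\<kappa> m) * mon_val (int_vec z) m" if "m \<in> M" for m
    proof -
      obtain q where q: "mon_val (int_vec z) m = of_rat q" using monQ[of z m] by (elim Rats_cases)
      show ?thesis
        unfolding q using emb_hom(2)[OF f \<rho>, of "of_rat q" "\<kappa> m"] emb_of_rat[OF f \<rho>] \<kappa> that
          rpoly_in_adj[of "[:q:]" \<theta>] by simp
    qed
    moreover have "mon_val (int_vec z) m * \<kappa> m \<in> adj \<theta>" if "m \<in> M" for m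
      using that \<kappa> monQ Qk by (intro is_subfieldD(4)[OF k]) auto
    ultimately show ?thesis unfolding L_def by (subst emb_sum[OF f \<rho> k]) auto
  qed
  have Q_eval: "mp_eval Q (int_vec z) = (\<Prod>\<rho>\<in>\<R>. emb \<theta> \<rho> (L (int_vec z)))" for z
    using embL by (simp add: Q_def mp_eval_prod mp_eval_sum)
  have Q_rat: "mp_eval Q (int_vec z) \<in> \<rat>" for z
  proof -
    obtain p where p: "L (int_vec z) = rpoly p \<theta>" using Lk[of z] by (auto simp: adj_def)
    have "(\<Prod>\<rho>\<in>\<R>. emb \<theta> \<rho> (L (int_vec z))) = (\<Prod>\<rho>\<in>\<R>. rpoly p \<rho>)"
      unfolding p by (rule prod.cong) (auto simp: \<R>_def emb_rpoly[OF f])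
    then show ?thesis using norm_rational[OF f, of p] by (simp add: Q_eval \<R>_def)
  qed
  obtain q where q: "\<forall>m\<in>Poly_Mapping.keys Q. q m \<in> \<rat>"
    and qrel: "\<forall>a b. (\<forall>m\<in>Poly_Mapping.keys Q. a m \<in> \<rat>) \<and> b \<in> \<rat> \<and> (\<Sum>m\<in>Poly_Mapping.keys Q. a m * Poly_Mapping.lookup Q m) = b \<longrightarrow> (\<Sum>m\<in>Poly_Mapping.keys Q. a m * q m) = b"
    using linear_relations_descend[OF is_subfield_Rats finite_keys[of Q], of "Poly_Mapping.lookup Q"] by (elim exE conjE)
  obtain A where A: "A > 0" "\<forall>m\<in>Poly_Mapping.keys Q. of_int A * q m \<in> \<int>"
    using Rats_finite_common_denominator[OF finite_keys[of Q], of q] q by auto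
  have Q_int: "of_int A * mp_eval Q (int_vec z) \<in> \<int>" for z
  proof -
    have "(\<Sum>m\<in>Poly_Mapping.keys Q. mon_val (int_vec z) m * Poly_Mapping.lookup Q m) = mp_eval Q (int_vec z)"
      by (simp add: mp_eval_def mult.commute)
    then have "(\<Sum>m\<in>Poly_Mapping.keys Q. mon_val (int_vec z) m * q m) = mp_eval Q (int_vec z)"
      using monQ Q_rat by (intro qrel[rule_format] conjI ballI) auto
    then have "of_int A * mp_eval Q (int_vec z) = (\<Sum>m\<in>Poly_Mapping.keys Q. mon_val (int_vec z) m * (of_int A * q m))"
      by (simp add: sum_distrib_left mult_ac flip: \<open>(\<Sum>m\<in>Poly_Mapping.keys Q. mon_val (int_vec z) m * q m) = mp_eval Q (int_vec z)\<close>)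
    also have "\<dots> \<in> \<int>"
    proof (rule Ints_sum)
      fix m assume "m \<in> Poly_Mapping.keys Q"
      then have "of_int A * q m \<in> \<int>" using A(2) by blast
      moreover have "mon_val (int_vec z) m = of_int (\<Prod>i\<in>UNIV. z i ^ Poly_Mapping.lookup m i)" by simp
      then have "mon_val (int_vec z) m \<in> \<int>" by (metis Ints_of_int)
      ultimately show "mon_val (int_vec z) m * (of_int A * q m) \<in> \<int>" by (rule Ints_mult[rotated])
    qed
    finally show ?thesis .
  qed
  \<comment> \<open>At the points in question \<open>A\<close> times the norm of \<open>L\<close> is
    a nonzero integer, so the conjugates of the value of \<open>L\<close> have product at least
    \<open>1 / A\<close> in absolute value, and those of the value of \<open>G\<close> at most
    \<open>A * B ^ card \<R>\<close>; the square root passes from roots to places.\<close>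
  define C where "C = sqrt (of_int A * B ^ card \<R>)"
  show ?thesis
  proof (intro exI[of _ C] allI impI)
    fix z assume nz: "mp_eval R (int_vec z) \<noteq> 0" and le: "cmod (mp_eval R (int_vec z)) \<le> B"
    define \<gamma> where "\<gamma> = mp_eval G (int_vec z)"
    define \<delta> where "\<delta> = L (int_vec z)"
    define r where "r = cmod (mp_eval R (int_vec z))"
    have gd: "\<gamma> * \<delta> = mp_eval R (int_vec z)" unfolding \<gamma>_def \<delta>_def by (rule GL)
    have "\<gamma> \<in> adj \<theta>" "\<delta> \<in> adj \<theta>" unfolding \<gamma>_def \<delta>_def by (rule Gk', rule Lk)
    obtain t where t: "mp_eval R (int_vec z) = of_rat t" using RQ'[of z] by (elim Rats_cases)
    have "cmod (emb \<theta> \<rho> \<gamma>) * cmod (emb \<theta> \<rho> \<delta>) = r" if "\<rho> \<in> \<R>" for \<rho>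
    proof -
      have \<rho>: "rpoly f \<rho> = 0" using that by (simp add: \<R>_def)
      have "emb \<theta> \<rho> \<gamma> * emb \<theta> \<rho> \<delta> = emb \<theta> \<rho> (\<gamma> * \<delta>)"
        using emb_hom(2)[OF f \<rho> \<open>\<gamma> \<in> adj \<theta>\<close> \<open>\<delta> \<in> adj \<theta>\<close>] by simp
      also have "\<dots> = mp_eval R (int_vec z)" unfolding gd t by (rule emb_of_rat[OF f \<rho>])
      finally show ?thesis by (simp add: r_def flip: norm_mult)
    qed
    then have "(\<Prod>\<rho>\<in>\<R>. cmod (emb \<theta> \<rho> \<gamma>) * cmod (emb \<theta> \<rho> \<delta>)) = (\<Prod>\<rho>\<in>\<R>. r)"
      by (rule prod.cong[OF refl])
    then have prod: "(\<Prod>\<rho>\<in>\<R>. cmod (emb \<theta> \<rho> \<gamma>)) * (\<Prod>\<rho>\<in>\<R>. cmod (emb \<theta> \<rho> \<delta>)) = r ^ card \<R>"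
      by (simp add: prod.distrib)
    have "\<delta> \<noteq> 0" using gd nz by auto
    then have "emb \<theta> \<rho> \<delta> \<noteq> 0" if "\<rho> \<in> \<R>" for \<rho>
      using that emb_eq_0_iff[OF f _ \<open>\<delta> \<in> adj \<theta>\<close>] by (simp add: \<R>_def)
    then have "of_int A * mp_eval Q (int_vec z) \<noteq> 0"
      using A(1) fin\<R> by (simp add: Q_eval flip: \<delta>_def)
    moreover obtain s where s: "of_int A * mp_eval Q (int_vec z) = of_int s" using Q_int[of z] by (elim Ints_cases)
    ultimately have "cmod (of_int A * mp_eval Q (int_vec z)) \<ge> 1" by (simp add: s)
    then have "of_int A * (\<Prod>\<rho>\<in>\<R>. cmod (emb \<theta> \<rho> \<delta>)) \<ge> 1"
      using A(1) by (simp add: norm_mult Q_eval prod_norm flip: \<delta>_def)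
    moreover have nn: "(\<Prod>\<rho>\<in>\<R>. cmod (emb \<theta> \<rho> \<gamma>)) \<ge> 0" by (simp add: prod_nonneg)
    ultimately have "(\<Prod>\<rho>\<in>\<R>. cmod (emb \<theta> \<rho> \<gamma>)) * 1 \<le> (\<Prod>\<rho>\<in>\<R>. cmod (emb \<theta> \<rho> \<gamma>)) * (of_int A * (\<Prod>\<rho>\<in>\<R>. cmod (emb \<theta> \<rho> \<delta>)))"
      by (intro mult_left_mono)
    also have "\<dots> = of_int A * r ^ card \<R>" by (simp add: algebra_simps flip: prod)
    also have "\<dots> \<le> of_int A * B ^ card \<R>"
      using A(1) le by (intro mult_left_mono power_mono) (auto simp: r_def)
    finally have "(\<Prod>v\<in>arch_places (adj \<theta>). v \<gamma>)\<^sup>2 \<le> of_int A * B ^ card \<R>"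
      using prod_roots_eq_prod_arch_places[OF \<open>\<gamma> \<in> adj \<theta>\<close>] by (simp add: \<R>_def)
    then show "(\<Prod>v\<in>arch_places (adj \<theta>). v (mp_eval G (int_vec z))) \<le> C"
      unfolding C_def \<gamma>_def [symmetric] by (rule real_le_rsqrt)
  qed
qed

end

section \<open>Completions\<close>

context
  fixes k :: "complex set" and v :: "complex \<Rightarrow> real"
  assumes k: "is_subfield k" and av: "absolute_value_on k v"
begin

lemmas absolute_value_rules = absolute_value_onD[OF av k]

lemma cauchy_ring_simps [simp]:
  "s \<otimes>\<^bsub>cauchy_ring k v\<^esub> t = (\<lambda>n. s n * t n)" "\<one>\<^bsub>cauchy_ring k v\<^esub> = (\<lambda>_. 1)"
  "s \<oplus>\<^bsub>cauchy_ring k v\<^esub> t = (\<lambda>n. s n + t n)" "\<zero>\<^bsub>cauchy_ring k v\<^esub> = (\<lambda>_. 0)"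
  by (simp_all add: cauchy_ring_def)

lemma cauchy_ring_carrier:
  "s \<in> carrier (cauchy_ring k v) \<longleftrightarrow> (\<forall>n. s n \<in> k) \<and> (\<forall>e>0. \<exists>M. \<forall>m\<ge>M. \<forall>n\<ge>M. v (s m - s n) < e)"
  by (simp add: cauchy_ring_def)

lemma cauchy_in: "s \<in> carrier (cauchy_ring k v) \<Longrightarrow> s n \<in> k"
  by (simp add: cauchy_ring_carrier)

lemma cauchy_bounded:
  assumes "s \<in> carrier (cauchy_ring k v)"
  shows "\<exists>B>0. \<forall>n. v (s n) \<le> B"
proof -
  note sk = cauchy_in[OF assms]
  obtain M where M: "\<And>m n. m \<ge> M \<Longrightarrow> n \<ge> M \<Longrightarrow> v (s m - s n) < 1"
    using assms unfolding cauchy_ring_carrier by (meson zero_less_one)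
  define B where "B = (\<Sum>j\<le>M. v (s j)) + 1"
  have nn: "v (s j) \<ge> 0" for j by (rule absolute_value_rules(1)[OF sk])
  have le: "v (s j) \<le> B - 1" if "j \<le> M" for j
    unfolding B_def using nn that member_le_sum[of j "{..M}" "\<lambda>j. v (s j)"] by simp
  have "v (s n) \<le> B" for n
  proof (cases "n \<le> M")
    case True
    then show ?thesis using le[of n] by simp
  next
    case False
    have "v (s n) = v ((s n - s M) + s M)" by simp
    also have "\<dots> \<le> v (s n - s M) + v (s M)" using sk by (intro absolute_value_rules(6) is_subfieldD(3)[OF k])
    also have "\<dots> \<le> 1 + (B - 1)" using M[of n M] le[of M] False by (intro add_mono) auto
    finally show ?thesis by simp
  qed
  moreover have "B > 0" unfolding B_def using nn by (simp add: add_nonneg_pos sum_nonneg)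
  ultimately show ?thesis by blast
qed

lemma cauchy_add:
  assumes s: "s \<in> carrier (cauchy_ring k v)" and t: "t \<in> carrier (cauchy_ring k v)"
  shows "(\<lambda>n. s n + t n) \<in> carrier (cauchy_ring k v)"
  unfolding cauchy_ring_carrier
proof (intro conjI allI impI)
  note sk = cauchy_in[OF s] and tk = cauchy_in[OF t]
  show "s n + t n \<in> k" for n using sk tk by (rule is_subfieldD(7)[OF k])
  fix e :: real assume "e > 0"
  then have e: "e / 2 > 0" by simp
  obtain M1 where M1: "\<And>m n. m \<ge> M1 \<Longrightarrow> n \<ge> M1 \<Longrightarrow> v (s m - s n) < e / 2"
    using s e unfolding cauchy_ring_carrier by meson
  obtain M2 where M2: "\<And>m n. m \<ge> M2 \<Longrightarrow> n \<ge> M2 \<Longrightarrow> v (t m - t n) < e / 2"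
    using t e unfolding cauchy_ring_carrier by meson
  show "\<exists>M. \<forall>m\<ge>M. \<forall>n\<ge>M. v (s m + t m - (s n + t n)) < e"
  proof (intro exI[of _ "max M1 M2"] allI impI)
    fix m n assume "m \<ge> max M1 M2" "n \<ge> max M1 M2"
    then have "v (s m - s n) + v (t m - t n) < e" using M1[of m n] M2[of m n] by simp
    moreover have "v ((s m - s n) + (t m - t n)) \<le> v (s m - s n) + v (t m - t n)"
      using sk tk by (intro absolute_value_rules(6) is_subfieldD(3)[OF k])
    ultimately show "v (s m + t m - (s n + t n)) < e" by (simp add: algebra_simps)
  qed
qed

lemma cauchy_mult:
  assumes s: "s \<in> carrier (cauchy_ring k v)" and t: "t \<in> carrier (cauchy_ring k v)"
  shows "(\<lambda>n. s n * t n) \<in> carrier (cauchy_ring k v)"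
  unfolding cauchy_ring_carrier
proof (intro conjI allI impI)
  note sk = cauchy_in[OF s] and tk = cauchy_in[OF t]
  show "s n * t n \<in> k" for n using sk tk by (rule is_subfieldD(4)[OF k])
  obtain B C where B: "B > 0" "\<And>n. v (s n) \<le> B" and C: "C > 0" "\<And>n. v (t n) \<le> C"
    using cauchy_bounded[OF s] cauchy_bounded[OF t] by blast
  fix e :: real assume "e > 0"
  then have e: "e / (2 * C) > 0" "e / (2 * B) > 0" using B C by auto
  obtain M1 where M1: "\<And>m n. m \<ge> M1 \<Longrightarrow> n \<ge> M1 \<Longrightarrow> v (s m - s n) < e / (2 * C)"
    using s e unfolding cauchy_ring_carrier by meson
  obtain M2 where M2: "\<And>m n. m \<ge> M2 \<Longrightarrow> n \<ge> M2 \<Longrightarrow> v (t m - t n) < e / (2 * B)"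
    using t e unfolding cauchy_ring_carrier by meson
  show "\<exists>M. \<forall>m\<ge>M. \<forall>n\<ge>M. v (s m * t m - s n * t n) < e"
  proof (intro exI[of _ "max M1 M2"] allI impI)
    fix m n assume mn: "m \<ge> max M1 M2" "n \<ge> max M1 M2"
    have dk: "s m - s n \<in> k" "t m - t n \<in> k" using sk tk by (auto intro!: is_subfieldD(3)[OF k])
    have "s m * t m - s n * t n = (s m - s n) * t m + s n * (t m - t n)" by (simp add: algebra_simps)
    then have "v (s m * t m - s n * t n) \<le> v ((s m - s n) * t m) + v (s n * (t m - t n))"
      using absolute_value_rules(6)[of "(s m - s n) * t m" "s n * (t m - t n)"] is_subfieldD(4)[OF k] dk sk tk by simp
    also have "\<dots> = v (s m - s n) * v (t m) + v (s n) * v (t m - t n)"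
      using absolute_value_rules(5) dk sk tk by simp
    also have "\<dots> \<le> v (s m - s n) * C + B * v (t m - t n)"
      using B C absolute_value_rules(1) dk by (intro add_mono mult_left_mono mult_right_mono) auto
    also have "\<dots> < (e / (2 * C)) * C + B * (e / (2 * B))"
      using M1[of m n] M2[of m n] mn B(1) C(1) by (intro add_strict_mono mult_strict_left_mono mult_strict_right_mono) auto
    also have "\<dots> = e" using B(1) C(1) by simp
    finally show "v (s m * t m - s n * t n) < e" .
  qed
qed

lemma cauchy_const:
  assumes "c \<in> k"
  shows "(\<lambda>_. c) \<in> carrier (cauchy_ring k v)"
  using assms by (simp add: cauchy_ring_carrier absolute_value_rules(3))

lemma cauchy_uminus:
  assumes s: "s \<in> carrier (cauchy_ring k v)"
  shows "(\<lambda>n. - s n) \<in> carrier (cauchy_ring k v)"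
proof -
  have "- 1 \<in> k" using is_subfieldD(2,6)[OF k] by blast
  from cauchy_mult[OF cauchy_const[OF this] s] show ?thesis by simp
qed

lemma cring_cauchy_ring: "cring (cauchy_ring k v)"
proof (rule cringI)
  show "abelian_group (cauchy_ring k v)"
  proof (rule abelian_groupI)
    fix s assume "s \<in> carrier (cauchy_ring k v)"
    then show "\<exists>t\<in>carrier (cauchy_ring k v). t \<oplus>\<^bsub>cauchy_ring k v\<^esub> s = \<zero>\<^bsub>cauchy_ring k v\<^esub>"
      by (intro bexI[of _ "\<lambda>n. - s n"] cauchy_uminus) simp_all
  qed (auto simp: cauchy_add cauchy_const is_subfieldD(1)[OF k] algebra_simps)
  show "comm_monoid (cauchy_ring k v)"
    by (rule comm_monoidI) (auto simp: cauchy_mult cauchy_const is_subfieldD(2)[OF k] algebra_simps)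
qed (auto simp: algebra_simps)

interpretation CR: cring "cauchy_ring k v"
  by (rule cring_cauchy_ring)

lemma CR_a_inv:
  assumes "s \<in> carrier (cauchy_ring k v)"
  shows "\<ominus>\<^bsub>cauchy_ring k v\<^esub> s = (\<lambda>n. - s n)"
  by (rule CR.minus_equality) (use assms cauchy_uminus in auto)

lemma null_add:
  assumes "s \<in> null_sequences k v" "t \<in> null_sequences k v"
  shows "(\<lambda>n. s n + t n) \<in> null_sequences k v"
proof -
  have s: "s \<in> carrier (cauchy_ring k v)" "(\<lambda>n. v (s n)) \<longlonglongrightarrow> 0"
    and t: "t \<in> carrier (cauchy_ring k v)" "(\<lambda>n. v (t n)) \<longlonglongrightarrow> 0"
    using assms by (auto simp: null_sequences_def)
  have lim: "(\<lambda>n. v (s n) + v (t n)) \<longlonglongrightarrow> 0" using tendsto_add[OF s(2) t(2)] by simp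
  have "(\<lambda>n. v (s n + t n)) \<longlonglongrightarrow> 0"
    by (rule tendsto_sandwich[OF _ _ tendsto_const lim]; intro always_eventually allI)
       (use cauchy_in[OF s(1)] cauchy_in[OF t(1)] absolute_value_rules(1,6) is_subfieldD(7)[OF k] in auto)
  then show ?thesis using cauchy_add[OF s(1) t(1)] by (simp add: null_sequences_def)
qed

lemma null_mult:
  assumes "s \<in> null_sequences k v" "t \<in> carrier (cauchy_ring k v)"
  shows "(\<lambda>n. t n * s n) \<in> null_sequences k v"
proof -
  have s: "s \<in> carrier (cauchy_ring k v)" "(\<lambda>n. v (s n)) \<longlonglongrightarrow> 0"
    using assms by (auto simp: null_sequences_def)
  note sk = cauchy_in[OF s(1)] and tk = cauchy_in[OF assms(2)]
  obtain B where B: "B > 0" "\<And>n. v (t n) \<le> B" using cauchy_bounded[OF assms(2)] by blast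
  have lim: "(\<lambda>n. B * v (s n)) \<longlonglongrightarrow> 0" using tendsto_mult[OF tendsto_const s(2), of B] by simp
  have "(\<lambda>n. v (t n * s n)) \<longlonglongrightarrow> 0"
  proof (rule tendsto_sandwich[OF _ _ tendsto_const lim]; intro always_eventually allI)
    fix n
    show "0 \<le> v (t n * s n)" using sk tk by (intro absolute_value_rules(1) is_subfieldD(4)[OF k])
    show "v (t n * s n) \<le> B * v (s n)"
      unfolding absolute_value_rules(5)[OF tk sk] using B absolute_value_rules(1)[OF sk] by (intro mult_right_mono)
  qed
  then show ?thesis using cauchy_mult[OF assms(2) s(1)] by (simp add: null_sequences_def)
qed

lemma ideal_null_sequences: "ideal (null_sequences k v) (cauchy_ring k v)"
proof (rule idealI)
  show "ring (cauchy_ring k v)" by (rule CR.ring_axioms)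
  show "subgroup (null_sequences k v) (add_monoid (cauchy_ring k v))"
  proof (rule group.subgroupI[OF CR.a_group])
    show "null_sequences k v \<subseteq> carrier (add_monoid (cauchy_ring k v))" by (auto simp: null_sequences_def)
    have "(\<lambda>_. 0) \<in> null_sequences k v"
      using cauchy_const[OF is_subfieldD(1)[OF k]] by (simp add: null_sequences_def absolute_value_rules(3))
    then show "null_sequences k v \<noteq> {}" by blast
    fix s assume s: "s \<in> null_sequences k v"
    then have sc: "s \<in> carrier (cauchy_ring k v)" by (simp add: null_sequences_def)
    have "- 1 \<in> k" using is_subfieldD(2,6)[OF k] by blast
    then show "inv\<^bsub>add_monoid (cauchy_ring k v)\<^esub> s \<in> null_sequences k v"
      using null_mult[OF s cauchy_const, of "- 1"] CR_a_inv[OF sc] by (simp add: a_inv_def)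
    fix t assume "t \<in> null_sequences k v"
    then show "s \<otimes>\<^bsub>add_monoid (cauchy_ring k v)\<^esub> t \<in> null_sequences k v"
      using null_add[OF s] by simp
  qed
qed (use null_mult in \<open>auto simp: mult.commute\<close>)

lemma non_null_bounded_below:
  assumes s: "s \<in> carrier (cauchy_ring k v)" and "s \<notin> null_sequences k v"
  shows "\<exists>c>0. \<exists>M. \<forall>n\<ge>M. v (s n) \<ge> c"
proof -
  note sk = cauchy_in[OF s]
  have "\<not> (\<lambda>n. v (s n)) \<longlonglongrightarrow> 0" using assms by (simp add: null_sequences_def)
  then obtain e where e: "e > 0" "\<And>M. \<exists>n\<ge>M. \<not> dist (v (s n)) 0 < e"
    unfolding lim_sequentially by auto
  obtain M where M: "\<And>m n. m \<ge> M \<Longrightarrow> n \<ge> M \<Longrightarrow> v (s m - s n) < e / 2"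
    using s e(1) unfolding cauchy_ring_carrier by (meson half_gt_zero)
  obtain m where m: "m \<ge> M" "v (s m) \<ge> e" using e(2)[of M] absolute_value_rules(1)[OF sk] by (auto simp: not_less)
  have "v (s n) \<ge> e / 2" if "n \<ge> M" for n
  proof -
    have "\<bar>v (s m) - v (s n)\<bar> < e / 2" using M[OF m(1) that] absolute_value_rules(9)[OF sk sk, of m n] by linarith
    then show ?thesis using m(2) by linarith
  qed
  then show ?thesis using e(1) by (intro exI[of _ "e / 2"]) auto
qed

lemma quasi_inverse:
  assumes s: "s \<in> carrier (cauchy_ring k v)" and "s \<notin> null_sequences k v"
  shows "\<exists>t\<in>carrier (cauchy_ring k v). (\<lambda>n. 1 + - (s n * t n)) \<in> null_sequences k v"
proof -
  note sk = cauchy_in[OF s]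
  obtain c M where c: "c > 0" "\<And>n. n \<ge> M \<Longrightarrow> v (s n) \<ge> c" using non_null_bounded_below[OF assms] by blast
  have nz: "s n \<noteq> 0" if "n \<ge> M" for n using c(2)[OF that] c(1) absolute_value_rules(3) by auto
  \<comment> \<open>The terms before \<open>M\<close>, where \<open>s\<close> may vanish, do not
    matter modulo null sequences.\<close>
  define t where "t n = (if n \<ge> M then inverse (s n) else 0)" for n
  have tk: "t n \<in> k" for n using sk is_subfieldD(1,5)[OF k] by (simp add: t_def)
  have t: "t \<in> carrier (cauchy_ring k v)"
    unfolding cauchy_ring_carrier
  proof (intro conjI allI impI tk)
    fix e :: real assume "e > 0"
    then have "e * (c * c) > 0" using c by simp
    then obtain M' where M': "\<And>m n. m \<ge> M' \<Longrightarrow> n \<ge> M' \<Longrightarrow> v (s m - s n) < e * (c * c)"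
      using s unfolding cauchy_ring_carrier by meson
    show "\<exists>L. \<forall>m\<ge>L. \<forall>n\<ge>L. v (t m - t n) < e"
    proof (intro exI[of _ "max M M'"] allI impI)
      fix m n assume mn: "m \<ge> max M M'" "n \<ge> max M M'"
      then have mM: "m \<ge> M" "n \<ge> M" by auto
      have "t m - t n = (s n - s m) * (inverse (s m) * inverse (s n))"
        using nz[OF mM(1)] nz[OF mM(2)] mM by (simp add: t_def field_simps)
      then have "v (t m - t n) = v (s n - s m) * (inverse (v (s m)) * inverse (v (s n)))"
        using absolute_value_rules(5)[of "s n - s m" "inverse (s m) * inverse (s n)"] absolute_value_rules(5)[of "inverse (s m)" "inverse (s n)"]
          is_subfieldD(3,4,5)[OF k] sk absolute_value_rules(11)[OF sk] by simp
      also have "\<dots> \<le> v (s n - s m) * (inverse c * inverse c)"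
        using c mM absolute_value_rules(1)[OF is_subfieldD(3)[OF k sk sk]]
        by (intro mult_left_mono mult_mono le_imp_inverse_le) (auto intro: order_trans[OF less_imp_le])
      also have "\<dots> < e * (c * c) * (inverse c * inverse c)"
        using M'[of n m] mn c(1) by (intro mult_strict_right_mono) auto
      also have "\<dots> = e" using c(1) by (simp add: field_simps)
      finally show "v (t m - t n) < e" .
    qed
  qed
  have "(\<lambda>n. 1 + - (s n * t n)) \<in> carrier (cauchy_ring k v)"
    using cauchy_add[OF cauchy_const[OF is_subfieldD(2)[OF k]] cauchy_uminus[OF cauchy_mult[OF s t]]] .
  moreover have "(\<lambda>n. v (1 + - (s n * t n))) \<longlonglongrightarrow> 0"
  proof (rule tendsto_eventually)
    show "\<forall>\<^sub>F n in sequentially. v (1 + - (s n * t n)) = 0"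
      using eventually_ge_at_top[of M] by eventually_elim (use nz in \<open>simp add: t_def absolute_value_rules(3)\<close>)
  qed
  ultimately show ?thesis using t by (intro bexI[of _ t]) (simp_all add: null_sequences_def)
qed

text \<open>Non-null Cauchy sequences are invertible modulo null sequences
  (\<open>quasi_inverse\<close>), so the null sequences form a maximal ideal.\<close>

lemma field_completion: "Ring.field (completion k v)"
  unfolding completion_def
proof (rule maximalideal.quotient_is_field[OF maximalidealI cring_cauchy_ring])
  show "ideal (null_sequences k v) (cauchy_ring k v)" by (rule ideal_null_sequences)
  have "(\<lambda>_. 1) \<in> carrier (cauchy_ring k v)" by (rule cauchy_const[OF is_subfieldD(2)[OF k]])
  moreover have "(\<lambda>_. 1) \<notin> null_sequences k v"
    by (auto simp: null_sequences_def absolute_value_rules(4) LIMSEQ_const_iff)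
  ultimately show "carrier (cauchy_ring k v) \<noteq> null_sequences k v" by blast
  fix J assume J: "ideal J (cauchy_ring k v)" "null_sequences k v \<subseteq> J" "J \<subseteq> carrier (cauchy_ring k v)"
  interpret J: ideal J "cauchy_ring k v" by (rule J(1))
  show "J = null_sequences k v \<or> J = carrier (cauchy_ring k v)"
  proof (cases "J \<subseteq> null_sequences k v")
    case False
    then obtain s where s: "s \<in> J" "s \<notin> null_sequences k v" by blast
    with J obtain t where t: "t \<in> carrier (cauchy_ring k v)" "(\<lambda>n. 1 + - (s n * t n)) \<in> null_sequences k v"
      using quasi_inverse by blast
    have "(\<lambda>n. s n * t n) \<in> J" using J.I_r_closed[OF s(1) t(1)] by simp
    moreover have "(\<lambda>n. 1 + - (s n * t n)) \<in> J" using t(2) J(2) by blast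
    ultimately have "(\<lambda>n. (1 + - (s n * t n)) + s n * t n) \<in> J"
      using J.a_closed by fastforce
    then have "\<one>\<^bsub>cauchy_ring k v\<^esub> \<in> J" by simp
    then show ?thesis using J.one_imp_carrier by blast
  qed (use J in blast)
qed

lemma carrier_completion:
  "carrier (completion k v) = {null_sequences k v +>\<^bsub>cauchy_ring k v\<^esub> s | s. s \<in> carrier (cauchy_ring k v)}"
  unfolding completion_def FactRing_def by (auto simp: A_RCOSETS_def')

end

section \<open>Local degrees over the rationals and at complex places\<close>

lemma local_degree_Rats:
  assumes av: "absolute_value_on \<rat> v"
  shows "local_degree \<rat> v = 1"
proof -
  interpret F: Ring.field "completion \<rat> v" by (rule field_completion[OF is_subfield_Rats av])
  have eq: "rational_completion \<rat> v = carrier (completion \<rat> v)"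
    unfolding carrier_completion[OF is_subfield_Rats av] rational_completion_def
    using cauchy_in[OF is_subfield_Rats av] by blast
  have "F.dimension 1 (carrier (completion \<rat> v)) (carrier (completion \<rat> v))"
    by (rule F.dimension_one[OF F.carrier_is_subfield])
  from F.dimI[OF F.carrier_is_subfield this] show ?thesis
    unfolding local_degree_def eq by (simp add: over_def)
qed

lemma field_degree_Rats: "field_degree \<rat> = 1"
proof -
  have Q: "subfield \<rat> complex_ring" by (rule subfield_complex_ring[OF is_subfield_Rats])
  have "complex_ring.dimension 1 \<rat> \<rat>" by (rule complex_ring.dimension_one[OF Q])
  from complex_ring.dimI[OF Q this] show ?thesis
    unfolding field_degree_def by (simp add: over_def)
qed

lemma is_subfield_Reals: "is_subfield \<real>"
  by (auto simp: is_subfield_def)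

lemma dimension_complex_over_Reals: "complex_ring.dimension 2 \<real> UNIV"
proof -
  have R: "subfield \<real> complex_ring" by (rule subfield_complex_ring[OF is_subfield_Reals])
  have le: "x \<in> complex_ring.line_extension \<real> a E \<longleftrightarrow> (\<exists>r\<in>\<real>. \<exists>w\<in>E. x = r * a + w)" for x a E
    using complex_ring.line_extension_mem_iff[of x \<real> a E] by simp
  have 1: "complex_ring.line_extension \<real> 1 {0} = \<real>"
    by (rule equalityI; rule subsetI) (auto simp: le)
  have 2: "complex_ring.line_extension \<real> \<i> \<real> = UNIV"
  proof (rule equalityI; rule subsetI)
    fix x :: complex assume "x \<in> UNIV"
    have "x = of_real (Im x) * \<i> + of_real (Re x)" by (simp add: complex_eq_iff)
    then show "x \<in> complex_ring.line_extension \<real> \<i> \<real>"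
      unfolding le by (intro bexI[of _ "of_real (Im x)"] bexI[of _ "of_real (Re x)"]) auto
  qed simp
  have "complex_ring.dimension 0 \<real> {0}" using complex_ring.zero_dim[of \<real>] by simp
  then have "complex_ring.dimension (Suc 0) \<real> \<real>"
    using complex_ring.Suc_dim[of 1 "{0}" 0 \<real>] unfolding 1 by simp
  moreover have "\<i> \<notin> \<real>" by (auto simp: complex_is_Real_iff)
  ultimately have "complex_ring.dimension (Suc (Suc 0)) \<real> UNIV"
    using complex_ring.Suc_dim[of \<i> \<real> "Suc 0" \<real>] unfolding 2 by simp
  then show ?thesis by (simp add: numeral_2_eq_2)
qed

context
  fixes \<theta> :: complex and f :: "rat poly" and \<rho> :: complex
  assumes f: "is_minpoly f \<theta>" and k: "is_subfield (adj \<theta>)" and i: "\<i> \<in> adj \<theta>"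
    and \<rho>: "\<rho> \<in> roots_ii \<theta> f"
begin

lemma rpoly_roots_ii: "rpoly f \<rho> = 0"
  using \<rho> by (simp add: roots_ii_def[OF f k i])

lemma abs_emb_place: "absolute_value_on (adj \<theta>) (emb_place \<theta> \<rho>)"
  using emb_place_arch[OF f rpoly_roots_ii k] by (simp add: arch_places_def)

abbreviation (input) "CR \<equiv> cauchy_ring (adj \<theta>) (emb_place \<theta> \<rho>)"
abbreviation (input) "NS \<equiv> null_sequences (adj \<theta>) (emb_place \<theta> \<rho>)"

lemmas CR_simps = cauchy_ring_simps[OF k abs_emb_place]

lemma CR_carrier: "s \<in> carrier CR \<longleftrightarrow> (\<forall>n. s n \<in> adj \<theta>) \<and> Cauchy (\<lambda>n. emb \<theta> \<rho> (s n))"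
proof -
  have "emb_place \<theta> \<rho> (s m - s n) = dist (emb \<theta> \<rho> (s m)) (emb \<theta> \<rho> (s n))" if "\<forall>n. s n \<in> adj \<theta>" for m n
    using that is_subfieldD(3)[OF k, of "s m" "s n"]
    by (simp add: emb_place_def dist_norm emb_hom(3)[OF f rpoly_roots_ii])
  then show ?thesis
    unfolding cauchy_ring_carrier[OF k abs_emb_place] Cauchy_def by (auto cong: conj_cong)
qed

text \<open>This induces the isomorphism of the completion with the complex numbers: the kernel is
  the ideal of null sequences, and density of the Gaussian rationals gives surjectivity.\<close>

definition limit_map :: "(nat \<Rightarrow> complex) \<Rightarrow> complex" where
  "limit_map s = lim (\<lambda>n. emb \<theta> \<rho> (s n))"

lemma limit_map: "s \<in> carrier CR \<Longrightarrow> (\<lambda>n. emb \<theta> \<rho> (s n)) \<longlonglongrightarrow> limit_map s"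
  unfolding CR_carrier limit_map_def using Cauchy_convergent convergent_LIMSEQ_iff by blast

lemma limit_map_eq: "s \<in> carrier CR \<Longrightarrow> (\<lambda>n. emb \<theta> \<rho> (s n)) \<longlonglongrightarrow> z \<Longrightarrow> limit_map s = z"
  using limit_map LIMSEQ_unique by blast

lemma ring_hom_limit_map: "ring_hom_ring CR complex_ring limit_map"
proof (rule ring_hom_ringI2)
  show "ring CR" using cring_cauchy_ring[OF k abs_emb_place] by (rule cring.axioms)
  show "limit_map \<in> ring_hom CR complex_ring"
  proof (rule ring_hom_memI)
    fix s t assume s: "s \<in> carrier CR" and t: "t \<in> carrier CR"
    have st: "s n \<in> adj \<theta>" "t n \<in> adj \<theta>" for n using s t by (auto simp: CR_carrier)
    have "(\<lambda>n. s n * t n) \<in> carrier CR" by (rule cauchy_mult[OF k abs_emb_place s t])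
    then show "limit_map (s \<otimes>\<^bsub>CR\<^esub> t) = limit_map s \<otimes>\<^bsub>complex_ring\<^esub> limit_map t"
      unfolding CR_simps complex_ring_simps using tendsto_mult[OF limit_map[OF s] limit_map[OF t]]
      by (intro limit_map_eq) (simp_all add: emb_hom(2)[OF f rpoly_roots_ii st])
    have "(\<lambda>n. s n + t n) \<in> carrier CR" by (rule cauchy_add[OF k abs_emb_place s t])
    then show "limit_map (s \<oplus>\<^bsub>CR\<^esub> t) = limit_map s \<oplus>\<^bsub>complex_ring\<^esub> limit_map t"
      unfolding CR_simps complex_ring_simps using tendsto_add[OF limit_map[OF s] limit_map[OF t]]
      by (intro limit_map_eq) (simp_all add: emb_hom(1)[OF f rpoly_roots_ii st])
  next
    have "(\<lambda>_. 1) \<in> carrier CR" by (rule cauchy_const[OF k abs_emb_place is_subfieldD(2)[OF k]])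
    then show "limit_map \<one>\<^bsub>CR\<^esub> = \<one>\<^bsub>complex_ring\<^esub>"
      unfolding CR_simps complex_ring_simps using emb_of_rat[OF f rpoly_roots_ii, of 1] by (intro limit_map_eq) auto
  qed simp
qed (rule complex_ring.ring_axioms)

interpretation lm: ring_hom_ring CR complex_ring limit_map
  by (rule ring_hom_limit_map)

lemma kernel_limit_map: "a_kernel CR complex_ring limit_map = NS"
proof -
  have "limit_map s = 0 \<longleftrightarrow> (\<lambda>n. emb_place \<theta> \<rho> (s n)) \<longlonglongrightarrow> 0" if s: "s \<in> carrier CR" for s
  proof -
    have "emb_place \<theta> \<rho> (s n) = cmod (emb \<theta> \<rho> (s n))" for n
      using s by (simp add: CR_carrier emb_place_def)
    then have "(\<lambda>n. emb_place \<theta> \<rho> (s n)) \<longlonglongrightarrow> 0 \<longleftrightarrow> (\<lambda>n. emb \<theta> \<rho> (s n)) \<longlonglongrightarrow> 0"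
      by (simp add: tendsto_norm_zero_iff)
    then show ?thesis using limit_map[OF s] limit_map_eq[OF s, of 0] by metis
  qed
  then show ?thesis unfolding a_kernel_def' null_sequences_def complex_ring_simps by (intro Collect_cong) blast
qed

lemma gauss_rats_in_CR:
  assumes "\<And>n. g n \<in> gauss_rats" "g \<longlonglongrightarrow> z"
  shows "g \<in> carrier CR" "limit_map g = z"
proof -
  have eq: "emb \<theta> \<rho> (g n) = g n" for n by (rule emb_gauss_rats[OF f k i \<rho> assms(1)])
  show "g \<in> carrier CR"
    unfolding CR_carrier eq using assms gauss_rats_subset[OF k Rats_subset_adj i]
    by (auto intro: LIMSEQ_imp_Cauchy)
  then show "limit_map g = z" using assms(2) by (intro limit_map_eq) (simp_all add: eq)
qed

text \<open>Under the isomorphism of the completion with the complex numbers, the classes of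
  rational Cauchy sequences correspond to the real numbers, so the dimension 2 is carried
  over.\<close>

lemma local_degree_emb_place: "local_degree (adj \<theta>) (emb_place \<theta> \<rho>) = 2"
proof -
  define KC where "KC = completion (adj \<theta>) (emb_place \<theta> \<rho>)"
  define \<Phi> where "\<Phi> = (\<lambda>S. the_elem (limit_map ` S))"
  have surj: "limit_map ` carrier CR = carrier complex_ring"
  proof -
    have "z \<in> limit_map ` carrier CR" for z
      using gauss_rats_sequence_tendsto[of z] gauss_rats_in_CR by (metis imageI)
    then show ?thesis by auto
  qed
  interpret KC: Ring.field KC unfolding KC_def by (rule field_completion[OF k abs_emb_place])
  have iso: "\<Phi> \<in> ring_iso KC complex_ring"
    unfolding \<Phi>_def KC_def completion_def kernel_limit_map[symmetric] by (rule lm.FactRing_iso_set[OF surj])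
  have \<Phi>: "\<Phi> (NS +>\<^bsub>CR\<^esub> s) = limit_map s" if "s \<in> carrier CR" for s
    using lm.the_elem_simp[OF that] by (simp add: \<Phi>_def kernel_limit_map)
  \<comment> \<open>The inverse is used because dimensions are transported along an injective
    homomorphism out of \<open>complex_ring\<close>.\<close>
  define g where "g = inv_into (carrier KC) \<Phi>"
  have g: "g \<in> ring_iso complex_ring KC"
    unfolding g_def by (rule ring_iso_set_sym[OF KC.ring_axioms iso])
  have carr: "NS +>\<^bsub>CR\<^esub> s \<in> carrier KC" if "s \<in> carrier CR" for s
    using that unfolding KC_def carrier_completion[OF k abs_emb_place] by blast
  have g_lim: "g (limit_map s) = NS +>\<^bsub>CR\<^esub> s" if "s \<in> carrier CR" for s
    unfolding g_def \<Phi>[OF that, symmetric] using iso carr[OF that]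
    by (intro inv_into_f_f) (auto simp: ring_iso_def bij_betw_def)
  interpret gh: ring_hom_ring complex_ring KC g
    using g complex_ring.ring_axioms KC.ring_axioms by (intro ring_hom_ringI2) (auto simp: ring_iso_def)
  have R: "subfield \<real> complex_ring" by (rule subfield_complex_ring[OF is_subfield_Reals])
  have inj: "inj_on g UNIV" and img: "g ` UNIV = carrier KC"
    using g by (auto simp: ring_iso_def bij_betw_def)
  have "rational_completion (adj \<theta>) (emb_place \<theta> \<rho>) = g ` \<real>"
  proof (rule equalityI; rule subsetI)
    fix x assume "x \<in> rational_completion (adj \<theta>) (emb_place \<theta> \<rho>)"
    then obtain s where s: "s \<in> carrier CR" "\<And>n. s n \<in> \<rat>" "x = NS +>\<^bsub>CR\<^esub> s"
      unfolding rational_completion_def by blast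
    have "emb \<theta> \<rho> (s n) \<in> \<real>" for n
      using emb_gauss_rats[OF f k i \<rho>, of "s n"] s(2)[of n] Rats_subset_gauss_rats
      by (metis Rats_cases Reals_of_real of_real_of_rat_complex subsetD)
    then have "limit_map s \<in> \<real>"
      using closed_sequentially[OF closed_complex_Reals _ limit_map[OF s(1)]] by blast
    then show "x \<in> g ` \<real>" using g_lim[OF s(1)] s(3) by (metis imageI)
  next
    fix x assume "x \<in> g ` \<real>"
    then obtain r where r: "x = g (of_real r)" by (auto elim!: Reals_cases)
    obtain q where q: "(\<lambda>n. of_rat (q n) :: complex) \<longlonglongrightarrow> of_real r" using rat_sequence_tendsto by blast
    have "of_rat (q n) \<in> gauss_rats" for n using Rats_subset_gauss_rats by auto
    note c = gauss_rats_in_CR[OF this q]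
    have "x = NS +>\<^bsub>CR\<^esub> (\<lambda>n. of_rat (q n))"
      unfolding r c(2)[symmetric] by (rule g_lim[OF c(1)])
    with c(1) show "x \<in> rational_completion (adj \<theta>) (emb_place \<theta> \<rho>)"
      unfolding rational_completion_def by (intro CollectI exI[of _ "\<lambda>n. of_rat (q n)"]) simp
  qed
  then have eq: "local_degree (adj \<theta>) (emb_place \<theta> \<rho>) = KC.dim (g ` \<real>) (g ` UNIV)"
    unfolding local_degree_def img by (simp add: KC_def)
  have "subfield (g ` \<real>) KC" by (rule gh.img_is_subfield(2)[OF R KC.one_not_zero])
  moreover have "KC.dimension 2 (g ` \<real>) (g ` UNIV)"
    by (rule gh.inj_hom_dimension[OF R KC.one_not_zero inj dimension_complex_over_Reals])
  ultimately show ?thesis unfolding eq using KC.dimI by (simp add: over_def)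
qed

end

section \<open>The p-adic absolute values\<close>

abbreviation mlt :: "nat \<Rightarrow> int \<Rightarrow> int" where
  "mlt p a \<equiv> int (Factorial_Ring.multiplicity (int p) a)"

context
  fixes p :: nat
  assumes p: "Factorial_Ring.prime p"
begin

lemma prime_elem_p: "Factorial_Ring.prime_elem (int p)"
  using p by simp

lemma p_gt_1: "real p > 1"
  using prime_gt_1_nat[OF p] by simp

lemma mlt_mult: "a \<noteq> 0 \<Longrightarrow> b \<noteq> 0 \<Longrightarrow> mlt p (a * b) = mlt p a + mlt p b"
  using prime_elem_multiplicity_mult_distrib[OF prime_elem_p, of a b] by simp

lemma padic_abs_0 [simp]: "padic_abs p 0 = 0"
  by (simp add: padic_abs_def)

text \<open>The definition refers to lowest terms; additivity of the multiplicity makes every other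
  representation give the same value.\<close>

lemma padic_abs_frac:
  assumes "a \<noteq> 0" "b \<noteq> 0"
  shows "padic_abs p (of_int a / of_int b) = real p powi (mlt p b - mlt p a)"
proof -
  define q :: rat where "q = of_int a / of_int b"
  obtain n d where nd: "quotient_of q = (n, d)" by (cases "quotient_of q")
  have d: "d > 0" and q: "q = of_int n / of_int d"
    using quotient_of_denom_pos[OF nd] quotient_of_div[OF nd] by auto
  have q0: "q \<noteq> 0" using assms by (simp add: q_def)
  then have n: "n \<noteq> 0" using q by auto
  have "(of_int (n * b) :: rat) = of_int (a * d)"
    using q d assms unfolding q_def by (simp add: field_simps)
  then have "n * b = a * d" by (simp only: of_int_eq_iff)
  then have "mlt p n + mlt p b = mlt p a + mlt p d"
    using mlt_mult[of n b] mlt_mult[of a d] n d assms by simp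
  then have "mlt p d - mlt p n = mlt p b - mlt p a" by simp
  then show ?thesis using q0 nd unfolding q_def[symmetric] padic_abs_def by simp
qed

lemma padic_abs_of_int: "a \<noteq> 0 \<Longrightarrow> padic_abs p (of_int a) = real p powi (- mlt p a)"
  using padic_abs_frac[of a 1] by simp

lemma rat_common_denominator:
  fixes x y :: rat
  obtains a b d where "d \<noteq> 0" "x = of_int a / of_int d" "y = of_int b / of_int d"
proof -
  obtain a1 d1 where 1: "quotient_of x = (a1, d1)" by (cases "quotient_of x")
  obtain a2 d2 where 2: "quotient_of y = (a2, d2)" by (cases "quotient_of y")
  have "d1 > 0" "d2 > 0" "x = of_int a1 / of_int d1" "y = of_int a2 / of_int d2"
    using quotient_of_denom_pos[OF 1] quotient_of_div[OF 1] quotient_of_denom_pos[OF 2] quotient_of_div[OF 2] by auto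
  then show thesis by (intro that[of "d1 * d2" "a1 * d2" "a2 * d1"]) (auto simp: field_simps)
qed

lemma padic_abs_mult: "padic_abs p (x * y) = padic_abs p x * padic_abs p y"
proof (cases "x = 0 \<or> y = 0")
  case False
  obtain a b d where d: "d \<noteq> 0" "x = of_int a / of_int d" "y = of_int b / of_int d"
    by (rule rat_common_denominator)
  with False have ab: "a \<noteq> 0" "b \<noteq> 0" by auto
  have "x * y = of_int (a * b) / of_int (d * d)" by (simp add: d)
  then have "padic_abs p (x * y) = real p powi (mlt p (d * d) - mlt p (a * b))"
    using padic_abs_frac[of "a * b" "d * d"] ab d(1) by simp
  also have "\<dots> = real p powi ((mlt p d - mlt p a) + (mlt p d - mlt p b))"
    by (rule arg_cong[of _ _ "\<lambda>n. real p powi n"]) (use mlt_mult[OF ab] mlt_mult[OF d(1) d(1)] in linarith)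
  also have "\<dots> = padic_abs p x * padic_abs p y"
    unfolding d(2,3) padic_abs_frac[OF ab(1) d(1)] padic_abs_frac[OF ab(2) d(1)]
    using p_gt_1 by (subst power_int_add) auto
  finally show ?thesis .
qed auto

lemma padic_abs_nonneg: "padic_abs p x \<ge> 0"
  using p_gt_1 by (simp add: padic_abs_def)

lemma padic_abs_eq_0_iff: "padic_abs p x = 0 \<longleftrightarrow> x = 0"
  using p_gt_1 by (simp add: padic_abs_def)

text \<open>The larger of the two values already bounds the left side: over a common denominator,
  the smaller of the two powers of \<open>p\<close> divides both numerators and hence their
  sum.\<close>

lemma padic_abs_add: "padic_abs p (x + y) \<le> padic_abs p x + padic_abs p y"
proof (cases "x = 0 \<or> y = 0 \<or> x + y = 0")
  case False
  obtain a b d where d: "d \<noteq> 0" "x = of_int a / of_int d" "y = of_int b / of_int d"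
    by (rule rat_common_denominator)
  have xy: "x + y = of_int (a + b) / of_int d" by (simp add: d add_divide_distrib)
  with False d have ab: "a \<noteq> 0" "b \<noteq> 0" "a + b \<noteq> 0" by (auto simp del: of_int_add)
  define m where "m = min (Factorial_Ring.multiplicity (int p) a) (Factorial_Ring.multiplicity (int p) b)"
  have "int p ^ m dvd a" "int p ^ m dvd b"
    by (rule multiplicity_dvd', simp add: m_def)+
  then have "int p ^ m dvd a + b" by (rule dvd_add)
  then have "m \<le> Factorial_Ring.multiplicity (int p) (a + b)"
    using ab(3) prime_elem_p by (intro multiplicity_geI) (auto simp: prime_elem_def)
  then have "mlt p d - mlt p (a + b) \<le> max (mlt p d - mlt p a) (mlt p d - mlt p b)"
    by (auto simp: m_def min_def max_def split: if_splits)
  then have "padic_abs p (x + y) \<le> real p powi max (mlt p d - mlt p a) (mlt p d - mlt p b)"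
    unfolding xy padic_abs_frac[OF ab(3) d(1)] using p_gt_1 by (intro power_int_increasing) auto
  also have "\<dots> \<le> padic_abs p x + padic_abs p y"
    using padic_abs_frac[OF ab(1) d(1)] padic_abs_frac[OF ab(2) d(1)] padic_abs_nonneg[of x] padic_abs_nonneg[of y]
    by (auto simp: d max_def)
  finally show ?thesis .
qed (auto simp: padic_abs_nonneg)

lemma padic_abs_int_le_1: "padic_abs p (of_int a) \<le> 1"
proof (cases "a = 0")
  case False
  have "real p powi (- mlt p a) \<le> real p powi 0"
    using p_gt_1 by (intro power_int_increasing) auto
  then show ?thesis using padic_abs_of_int[OF False] by simp
qed simp

lemma padic_abs_int_eq_1: "\<not> int p dvd a \<Longrightarrow> padic_abs p (of_int a) = 1"
  using padic_abs_of_int[of a] by (cases "a = 0") (auto simp: not_dvd_imp_multiplicity_0)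

definition padic_place :: "complex \<Rightarrow> real" where
  "padic_place x = (if x \<in> \<rat> then padic_abs p (THE q. x = of_rat q) else 0)"

lemma padic_place_of_rat [simp]: "padic_place (of_rat q) = padic_abs p q"
proof -
  have "(THE q'. (of_rat q :: complex) = of_rat q') = q" by (rule the_equality) auto
  then show ?thesis by (simp add: padic_place_def)
qed

lemma padic_place_of_int: "padic_place (of_int a) = padic_abs p (of_int a)"
  using padic_place_of_rat[of "of_int a"] by simp

lemma padic_place_abs: "absolute_value_on \<rat> padic_place"
  unfolding absolute_value_on_def
proof (intro conjI ballI)
  fix x :: complex assume "x \<in> \<rat>"
  then obtain a where x: "x = of_rat a" by (elim Rats_cases)
  show "padic_place x \<ge> 0" "padic_place x = 0 \<longleftrightarrow> x = 0"
    unfolding x by (simp_all add: padic_abs_nonneg padic_abs_eq_0_iff)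
  fix y :: complex assume "y \<in> \<rat>"
  then obtain b where y: "y = of_rat b" by (elim Rats_cases)
  show "padic_place (x * y) = padic_place x * padic_place y" "padic_place (x + y) \<le> padic_place x + padic_place y"
    unfolding x y of_rat_mult[symmetric] of_rat_add[symmetric] padic_place_of_rat
    by (rule padic_abs_mult, rule padic_abs_add)
qed

lemma padic_place_in: "padic_place \<in> places \<rat> - arch_places \<rat>"
proof
  show "padic_place \<in> places \<rat>"
    unfolding places_def nonarch_places_def using padic_place_abs p
    by (auto simp: padic_place_def intro!: exI[of _ p])
  show "padic_place \<notin> arch_places \<rat>"
  proof
    assume "padic_place \<in> arch_places \<rat>"
    then have "padic_place (of_rat (of_nat p)) = \<bar>of_rat (of_nat p)\<bar>" unfolding arch_places_def by blast
    then have "padic_abs p (of_nat p) = \<bar>of_rat (of_nat p)\<bar>" by (simp only: padic_place_of_rat)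
    then have "padic_abs p (of_int (int p)) = real p" by simp
    then show False using padic_abs_int_le_1[of "int p"] p_gt_1 by simp
  qed
qed

end

lemma norm_abs_Rats:
  assumes "absolute_value_on \<rat> v" "x \<in> \<rat>"
  shows "norm_abs \<rat> v x = v x"
  using absolute_value_onD(1)[OF assms(1) is_subfield_Rats assms(2)]
  by (simp add: norm_abs_def local_degree_Rats[OF assms(1)] field_degree_Rats)


section \<open>Heights of integral vectors\<close>

text \<open>Coprimality in terms of primes: at each prime some coordinate is a unit, which is how
  the property is used. The zero vector is excluded.\<close>

definition primitive :: "('n \<Rightarrow> int) \<Rightarrow> bool" where
  "primitive z \<longleftrightarrow> (\<forall>p. Factorial_Ring.prime p \<longrightarrow> (\<exists>i. \<not> p dvd z i))"

definition max_abs :: "('n::finite \<Rightarrow> int) \<Rightarrow> real" where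
  "max_abs z = Max (range (\<lambda>i. \<bar>of_int (z i)\<bar>))"

lemma primitive_nonzero: "primitive z \<Longrightarrow> \<exists>i. z i \<noteq> 0"
  unfolding primitive_def by (metis dvd_0_right two_is_prime)

lemma abs_le_max_abs: "\<bar>of_int (z i)\<bar> \<le> max_abs z"
  unfolding max_abs_def by (rule Max_ge) auto

lemma max_abs_attained: "\<exists>i. max_abs z = \<bar>of_int (z i)\<bar>"
proof -
  have "max_abs z \<in> range (\<lambda>i. \<bar>of_int (z i)\<bar>)" unfolding max_abs_def by (rule Max_in) auto
  then show ?thesis by auto
qed

lemma max_abs_ge_1: "primitive z \<Longrightarrow> max_abs z \<ge> 1"
proof -
  assume "primitive z"
  then obtain i where "z i \<noteq> 0" using primitive_nonzero by blast
  then have "(1 :: real) \<le> \<bar>of_int (z i)\<bar>" by linarith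
  then show ?thesis using abs_le_max_abs[of z i] by linarith
qed

text \<open>At a place above \<open>p\<close> all coordinates have absolute value at most 1, with
  equality for one not divisible by \<open>p\<close>. As 1 is unaffected by exponents, no local
  degree at a finite place of \<open>k\<close> has to be computed.\<close>

lemma nonarch_max_norm_abs:
  assumes z: "primitive z" and v: "v \<in> nonarch_places k"
  shows "Max (range (\<lambda>i. norm_abs k v (int_vec z $ i))) = 1"
proof -
  obtain p where p: "Factorial_Ring.prime p" "\<And>q. v (of_rat q) = padic_abs p q"
    using v by (auto simp: nonarch_places_def)
  have vi: "v (of_int a) = padic_abs p (of_int a)" for a using p(2)[of "of_int a"] by simp
  obtain i where i: "\<not> int p dvd z i" using z p(1) unfolding primitive_def by (metis prime_int_nat_transfer prime_nat_int_transfer)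
  show ?thesis
  proof (rule Max_eqI)
    fix y assume "y \<in> range (\<lambda>i. norm_abs k v (int_vec z $ i))"
    then obtain j where y: "y = norm_abs k v (of_int (z j))" by auto
    show "y \<le> 1"
      unfolding y norm_abs_def vi using padic_abs_int_le_1[OF p(1), of "z j"] padic_abs_nonneg[OF p(1)]
      by (intro powr_le1) auto
  next
    have "norm_abs k v (of_int (z i)) = 1" using padic_abs_int_eq_1[OF p(1) i] by (simp add: norm_abs_def vi)
    then show "1 \<in> range (\<lambda>i. norm_abs k v (int_vec z $ i))" by (metis int_vec_nth rangeI)
  qed simp
qed

lemma arch_place_of_int: "v \<in> arch_places k \<Longrightarrow> v (of_int a) = \<bar>of_int a\<bar>"
proof -
  assume "v \<in> arch_places k"
  then have "v (of_rat (of_int a)) = \<bar>of_rat (of_int a)\<bar>" unfolding arch_places_def by blast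
  then show ?thesis by simp
qed

text \<open>Only archimedean places contribute, and all by the same amount, because the coordinates
  are integers and the exponent \<open>r\<close> does not depend on the place.\<close>

lemma weil_height_primitive:
  assumes z: "primitive z" and fin: "finite (arch_places k)"
    and r: "\<And>v. v \<in> arch_places k \<Longrightarrow> real (local_degree k v) / real (field_degree k) = r"
  shows "weil_height k (int_vec z) = r * card (arch_places k) * ln (max_abs z)"
proof -
  have arch: "Max (range (\<lambda>i. norm_abs k v (int_vec z $ i))) = max_abs z powr r" if v: "v \<in> arch_places k" for v
  proof (rule Max_eqI)
    have na: "norm_abs k v (of_int a) = \<bar>of_int a\<bar> powr r" for a
      by (simp add: norm_abs_def r[OF v] arch_place_of_int[OF v])
    have r0: "r \<ge> 0" unfolding r[OF v, symmetric] by simp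
    show "y \<le> max_abs z powr r" if "y \<in> range (\<lambda>i. norm_abs k v (int_vec z $ i))" for y
      using that r0 abs_le_max_abs[of z] by (auto simp: na intro!: powr_mono2)
    obtain i where "max_abs z = \<bar>of_int (z i)\<bar>" using max_abs_attained by blast
    then show "max_abs z powr r \<in> range (\<lambda>i. norm_abs k v (int_vec z $ i))"
      by (intro range_eqI[of _ _ i]) (simp add: na)
  qed simp
  have "weil_height k (int_vec z) = (\<Sum>\<^sub>\<infinity>v\<in>arch_places k. ln (Max (range (\<lambda>i. norm_abs k v (int_vec z $ i)))))"
    unfolding weil_height_def
    by (rule infsum_cong_neutral) (use nonarch_max_norm_abs[OF z] in \<open>auto simp: places_def\<close>)
  also have "\<dots> = (\<Sum>v\<in>arch_places k. r * ln (max_abs z))"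
    unfolding infsum_finite[OF fin] using max_abs_ge_1[OF z]
    by (intro sum.cong refl) (simp only: arch, simp add: ln_powr)
  finally show ?thesis by simp
qed

lemma local_height_arch:
  assumes z: "primitive z" and v: "v \<in> arch_places k"
    and r: "real (local_degree k v) / real (field_degree k) = r"
    and nz: "mp_eval G (int_vec z) \<noteq> 0" "v (mp_eval G (int_vec z)) > 0"
  shows "local_height k v G (int_vec z) =
    ereal (real (mp_degree G) * r * ln (max_abs z) - r * ln (v (mp_eval G (int_vec z))))"
proof -
  have r0: "r \<ge> 0" unfolding r[symmetric] by simp
  have val_z: "val k v (of_int a) = ereal (- (r * ln \<bar>of_int a\<bar>))" if "a \<noteq> 0" for a
    using that by (simp add: val_def norm_abs_def r arch_place_of_int[OF v] ln_powr)
  have "Min (range (\<lambda>i. val k v (int_vec z $ i))) = ereal (- (r * ln (max_abs z)))"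
  proof (rule Min_eqI)
    fix y assume "y \<in> range (\<lambda>i. val k v (int_vec z $ i))"
    then obtain j where y: "y = val k v (of_int (z j))" by auto
    show "ereal (- (r * ln (max_abs z))) \<le> y"
    proof (cases "z j = 0")
      case False
      have "ln \<bar>of_int (z j)\<bar> \<le> ln (max_abs z)"
        using abs_le_max_abs[of z j] False by (intro ln_mono) auto
      then show ?thesis unfolding y val_z[OF False] using r0 by (simp add: mult_left_mono)
    qed (simp add: y val_def)
  next
    obtain i where i: "max_abs z = \<bar>of_int (z i)\<bar>" using max_abs_attained by blast
    then have "z i \<noteq> 0" using max_abs_ge_1[OF z] by auto
    then show "ereal (- (r * ln (max_abs z))) \<in> range (\<lambda>i. val k v (int_vec z $ i))"
      by (intro range_eqI[of _ _ i]) (simp add: val_z i)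
  qed simp
  moreover have "val k v (mp_eval G (int_vec z)) = ereal (- (r * ln (v (mp_eval G (int_vec z)))))"
    using nz by (simp add: val_def norm_abs_def r ln_powr)
  ultimately show ?thesis unfolding local_height_def by (simp add: algebra_simps)
qed


section \<open>Integral points\<close>

lemma mp_eval_int_vec_Ints:
  assumes "coeffs_in \<int> F"
  shows "mp_eval F (int_vec z) \<in> \<int>"
proof -
  have "mon_val (int_vec z) m \<in> \<int>" for m
  proof -
    have "mon_val (int_vec z) m = of_int (\<Prod>i\<in>UNIV. z i ^ Poly_Mapping.lookup m i)" by simp
    then show ?thesis by (metis Ints_of_int)
  qed
  then show ?thesis unfolding mp_eval_def using assms by (intro Ints_sum Ints_mult) (auto simp: coeffs_in_def)
qed

text \<open>Integral points come with arbitrary rational coordinates \<open>x\<close>, the estimates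
  with the coprime ones \<open>int_vec z = t *s x\<close>. The factor \<open>t\<close> shifts both
  terms of the local height by \<open>e * ln (v t)\<close> and cancels; for coprime coordinates the
  minimum of the valuations is 0.\<close>

lemma local_height_padic:
  fixes F :: "'n::finite mpoly" and x :: "complex ^ 'n"
  assumes p: "Factorial_Ring.prime p" and F: "homogeneous e F" "F \<noteq> 0" "coeffs_in \<int> F"
    and z: "primitive z" and x: "\<And>i. x $ i \<in> \<rat>" "int_vec z = t *s x" "t \<noteq> 0"
    and nz: "mp_eval F (int_vec z) = of_int a" "a \<noteq> 0"
  shows "local_height \<rat> (padic_place p) F x = ereal (mlt p a * ln (real p))"
proof -
  define v where "v = padic_place p"
  have av: "absolute_value_on \<rat> v" unfolding v_def by (rule padic_place_abs[OF p])
  note vD = absolute_value_onD[OF av is_subfield_Rats]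
  have zi: "of_int (z i) = t * x $ i" for i using arg_cong[OF x(2), of "\<lambda>y. y $ i"] by simp
  have tQ: "t \<in> \<rat>"
  proof -
    obtain i where "z i \<noteq> 0" using primitive_nonzero[OF z] by blast
    then have "x $ i \<noteq> 0" "t = of_int (z i) / x $ i" using zi[of i] x(3) by auto
    then show ?thesis using x(1)[of i] by (metis Rats_divide Rats_of_int)
  qed
  have vt: "v t > 0" using vD(1,2)[OF tQ] x(3) by simp
  have xi: "x $ i = of_int (z i) / t" for i using zi[of i] x(3) by simp
  have vx: "v (x $ i) = v (of_int (z i)) / v t" for i
    unfolding xi divide_inverse using vD(5)[of "of_int (z i)" "inverse t"] vD(11)[OF tQ] tQ by simp
  have vz: "v (of_int b) = padic_abs p (of_int b)" for b unfolding v_def by (rule padic_place_of_int[OF p])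
  have val: "val \<rat> v y = ereal (- ln (v y))" if "y \<in> \<rat>" "y \<noteq> 0" for y
    using that by (simp add: val_def norm_abs_Rats[OF av])
  have "Min (range (\<lambda>i. val \<rat> v (x $ i))) = ereal (ln (v t))"
  proof (rule Min_eqI)
    fix y assume "y \<in> range (\<lambda>i. val \<rat> v (x $ i))"
    then obtain j where y: "y = val \<rat> v (x $ j)" by auto
    show "ereal (ln (v t)) \<le> y"
    proof (cases "x $ j = 0")
      case False
      then have zj: "z j \<noteq> 0" using zi[of j] x(3) by auto
      have "v (of_int (z j)) > 0" using vD(1,2)[of "of_int (z j)"] zj by simp
      moreover have "v (of_int (z j)) \<le> 1" unfolding vz by (rule padic_abs_int_le_1[OF p])
      ultimately have "ln (v (of_int (z j))) \<le> 0" by simp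
      then show ?thesis
        unfolding y val[OF x(1) False] vx using \<open>v (of_int (z j)) > 0\<close> vt by (simp add: ln_div)
    qed (simp add: y val_def)
  next
    obtain i where i: "\<not> int p dvd z i" using z p unfolding primitive_def by (metis prime_int_nat_transfer prime_nat_int_transfer)
    then have "x $ i \<noteq> 0" using zi[of i] by auto
    have "v (x $ i) = 1 / v t" unfolding vx vz padic_abs_int_eq_1[OF p i] ..
    then show "ereal (ln (v t)) \<in> range (\<lambda>i. val \<rat> v (x $ i))"
      using val[OF x(1) \<open>x $ i \<noteq> 0\<close>] vt by (intro range_eqI[of _ _ i]) (simp add: ln_div)
  qed simp
  moreover have "val \<rat> v (mp_eval F x) = ereal (mlt p a * ln (real p) + e * ln (v t))"
  proof -
    have Fz: "of_int a = t ^ e * mp_eval F x"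
      using mp_eval_homogeneous[OF F(1), of t x] nz(1) by (simp flip: x(2))
    have FQ: "mp_eval F x \<in> \<rat>"
      using F(3) Ints_subset_Rats x(1) by (intro mp_eval_in_subfield[OF is_subfield_Rats]) (auto simp: coeffs_in_def)
    have F0: "mp_eval F x \<noteq> 0" using Fz nz(2) by auto
    have "v (of_int a) = v t ^ e * v (mp_eval F x)"
      unfolding Fz using vD(5)[of "t ^ e" "mp_eval F x"] vD(10)[OF tQ] tQ FQ by simp
    moreover have "v (of_int a) = real p powi (- mlt p a)" unfolding vz by (rule padic_abs_of_int[OF p nz(2)])
    ultimately have "v (mp_eval F x) = real p powi (- mlt p a) / v t ^ e" using vt by simp
    then have "ln (v (mp_eval F x)) = - (mlt p a * ln (real p)) - e * ln (v t)"
      using vt p_gt_1[OF p] by (simp add: ln_div ln_realpow ln_inverse power_int_minus power_int_of_nat)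
    then show ?thesis using val[OF FQ F0] by simp
  qed
  ultimately show ?thesis
    unfolding local_height_def v_def[symmetric] mp_degree_homogeneous[OF F(1,2)] by simp
qed

text \<open>Integrality bounds the contribution \<open>mlt p a * ln (real p)\<close> of each prime
  to the logarithm of the absolute value of the integer \<open>a\<close>, the value of
  \<open>F\<close>. Only finitely many of the bounds are nonzero, so their sum bounds
  \<open>a\<close>.\<close>

lemma integral_set_bounded:
  fixes F :: "'n::finite mpoly"
  assumes F: "homogeneous e F" "F \<noteq> 0" "coeffs_in \<int> F" and T: "integral_set \<rat> (arch_places \<rat>) F T"
  shows "\<exists>B. \<forall>z. primitive z \<and> proj_point (int_vec z) \<in> T \<longrightarrow>
    mp_eval F (int_vec z) \<noteq> 0 \<and> cmod (mp_eval F (int_vec z)) \<le> B"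
proof -
  obtain c :: "(complex \<Rightarrow> real) \<Rightarrow> real" where c: "finite {v \<in> places \<rat> - arch_places \<rat>. c v \<noteq> 0}"
    and T_eq: "T = {proj_point x | x. x \<in> coord_vectors \<rat> \<and> mp_eval F x \<noteq> 0 \<and>
               (\<forall>v\<in>places \<rat> - arch_places \<rat>. local_height \<rat> v F x \<le> ereal (c v))}"
    using T unfolding integral_set_def by blast
  define W where "W = {v \<in> places \<rat> - arch_places \<rat>. c v \<noteq> 0}"
  show ?thesis
  proof (intro exI[of _ "exp (\<Sum>v\<in>W. \<bar>c v\<bar>)"] allI impI; elim conjE)
    fix z assume z: "primitive z" and "proj_point (int_vec z) \<in> T"
    then obtain x where x: "proj_point (int_vec z) = proj_point x" "x \<in> coord_vectors \<rat>" "mp_eval F x \<noteq> 0"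
      "\<And>v. v \<in> places \<rat> - arch_places \<rat> \<Longrightarrow> local_height \<rat> v F x \<le> ereal (c v)"
      unfolding T_eq by blast
    have "int_vec z \<in> proj_point (int_vec z)" unfolding proj_point_def by (intro CollectI exI[of _ 1]) simp
    then obtain t where t: "int_vec z = t *s x" "t \<noteq> 0" unfolding x(1) by (auto simp: proj_point_def)
    have xQ: "\<And>i. x $ i \<in> \<rat>" using x(2) by (auto simp: coord_vectors_def)
    obtain a where a: "mp_eval F (int_vec z) = of_int a" using mp_eval_int_vec_Ints[OF F(3), of z] by (elim Ints_cases)
    have "mp_eval F (int_vec z) = t ^ e * mp_eval F x" unfolding t(1) by (rule mp_eval_homogeneous[OF F(1)])
    then have nz: "mp_eval F (int_vec z) \<noteq> 0" using t(2) x(3) by simp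
    then have a0: "a \<noteq> 0" using a by auto
    have le: "mlt p a * ln (real p) \<le> c (padic_place p)" if p: "Factorial_Ring.prime p" for p
      using x(4)[OF padic_place_in[OF p]] local_height_padic[OF p F z xQ t a a0] by simp
    define A where "A = {p::nat. Factorial_Ring.prime p \<and> int p dvd a}"
    have finA: "finite A"
    proof (rule finite_subset)
      show "A \<subseteq> {..nat \<bar>a\<bar>}"
        using a0 by (auto simp: A_def dest!: dvd_imp_le_int)
    qed simp
    \<comment> \<open>A prime divisor of \<open>a\<close> forces a positive bound, so its place lies
      in the finite set \<open>W\<close>, which does not depend on \<open>a\<close>.\<close>
    have pW: "padic_place p \<in> W" "0 \<le> c (padic_place p)" if "p \<in> A" for p
    proof -
      have p: "Factorial_Ring.prime p" "int p dvd a" using that by (auto simp: A_def)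
      have "mlt p a > 0" using p a0 prime_elem_p[OF p(1)] by (simp add: prime_multiplicity_gt_zero_iff)
      then have "mlt p a * ln (real p) > 0" using p_gt_1[OF p(1)] by simp
      then have "c (padic_place p) > 0" using le[OF p(1)] by linarith
      then show "padic_place p \<in> W" "0 \<le> c (padic_place p)" using padic_place_in[OF p(1)] by (auto simp: W_def)
    qed
    \<comment> \<open>Distinct primes give distinct places, so the sum over primes is part of the
      sum over \<open>W\<close>.\<close>
    have inj: "inj_on padic_place A"
    proof (rule inj_onI, rule ccontr)
      fix p q assume pq: "p \<in> A" "q \<in> A" "padic_place p = padic_place q" "p \<noteq> q"
      then have P: "Factorial_Ring.prime p" "Factorial_Ring.prime q" by (auto simp: A_def)
      have "\<not> q dvd p" using P pq(4) primes_dvd_imp_eq by blast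
      then have "padic_place q (of_int (int p)) = 1"
        unfolding padic_place_of_int[OF P(2)] by (intro padic_abs_int_eq_1[OF P(2)]) simp
      moreover have "padic_place p (of_int (int p)) < 1"
      proof -
        have "padic_place p (of_int (int p)) = real p powi - 1"
          unfolding padic_place_of_int[OF P(1)] using padic_abs_of_int[OF P(1), of "int p"] P(1) prime_gt_0_nat[OF P(1)]
          by (simp add: multiplicity_self)
        also have "\<dots> < 1" using p_gt_1[OF P(1)] by (simp add: power_int_minus inverse_less_1_iff)
        finally show ?thesis .
      qed
      ultimately show False using pq(3) by simp
    qed
    have "(\<Prod>p\<in>prime_factors a. p ^ Factorial_Ring.multiplicity p a) = \<bar>a\<bar>"
      using prod_prime_factors[OF a0] by simp
    also have "(\<Prod>p\<in>prime_factors a. p ^ Factorial_Ring.multiplicity p a) =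
        (\<Prod>p\<in>A. int p ^ Factorial_Ring.multiplicity (int p) a)"
    proof -
      have "prime_factors a = int ` A"
      proof (rule equalityI; rule subsetI)
        fix q assume "q \<in> prime_factors a"
        then have q: "Factorial_Ring.prime q" "q dvd a" by auto
        then have "q = int (nat q)" using prime_ge_0_int by simp
        moreover from this q have "nat q \<in> A" unfolding A_def by (metis mem_Collect_eq prime_int_nat_transfer prime_nat_int_transfer)
        ultimately show "q \<in> int ` A" by blast
      qed (use a0 in \<open>auto simp: A_def prime_factors_dvd\<close>)
      then show ?thesis by (simp add: prod.reindex)
    qed
    finally have "real_of_int \<bar>a\<bar> = (\<Prod>p\<in>A. real p ^ Factorial_Ring.multiplicity (int p) a)"
      by (metis (mono_tags, lifting) of_int_of_nat_eq of_int_power of_int_prod prod.cong)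
    then have "ln (real_of_int \<bar>a\<bar>) = ln (\<Prod>p\<in>A. real p ^ Factorial_Ring.multiplicity (int p) a)" by simp
    also have "\<dots> = (\<Sum>p\<in>A. ln (real p ^ Factorial_Ring.multiplicity (int p) a))"
      by (rule ln_prod) (use finA prime_gt_0_nat in \<open>auto simp: A_def\<close>)
    also have "\<dots> = (\<Sum>p\<in>A. mlt p a * ln (real p))"
      by (rule sum.cong) (use prime_gt_0_nat in \<open>auto simp: A_def ln_realpow\<close>)
    also have "\<dots> \<le> (\<Sum>p\<in>A. \<bar>c (padic_place p)\<bar>)"
    proof (rule sum_mono)
      fix p assume "p \<in> A"
      then have "Factorial_Ring.prime p" by (simp add: A_def)
      from le[OF this] show "mlt p a * ln (real p) \<le> \<bar>c (padic_place p)\<bar>" by linarith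
    qed
    also have "\<dots> = (\<Sum>v\<in>padic_place ` A. \<bar>c v\<bar>)" by (simp add: sum.reindex[OF inj])
    also have "\<dots> \<le> (\<Sum>v\<in>W. \<bar>c v\<bar>)"
      using c[folded W_def] pW by (intro sum_mono2) auto
    finally have "exp (ln (real_of_int \<bar>a\<bar>)) \<le> exp (\<Sum>v\<in>W. \<bar>c v\<bar>)" by simp
    then have "cmod (mp_eval F (int_vec z)) \<le> exp (\<Sum>v\<in>W. \<bar>c v\<bar>)" using a a0 by simp
    then show "mp_eval F (int_vec z) \<noteq> 0 \<and> cmod (mp_eval F (int_vec z)) \<le> exp (\<Sum>v\<in>W. \<bar>c v\<bar>)"
      using nz by simp
  qed
qed

section \<open>Orbits\<close>

lemma coeffs_in_sum: "is_subfield k \<Longrightarrow> (\<And>a. a \<in> A \<Longrightarrow> coeffs_in k (f a)) \<Longrightarrow> coeffs_in k (\<Sum>a\<in>A. f a)"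
  unfolding coeffs_in_def lookup_sum by (blast intro: is_subfield_sum)

lemma coeffs_in_single: "is_subfield k \<Longrightarrow> a \<in> k \<Longrightarrow> coeffs_in k (Poly_Mapping.single m a)"
  by (simp add: coeffs_in_def lookup_single when_def is_subfieldD)

lemma coeffs_in_mult:
  assumes "is_subfield k" "coeffs_in k F" "coeffs_in k G"
  shows "coeffs_in k (F * G)"
proof -
  have "F * G = (\<Sum>m\<in>Poly_Mapping.keys F. Poly_Mapping.single m (Poly_Mapping.lookup F m)) *
      (\<Sum>m\<in>Poly_Mapping.keys G. Poly_Mapping.single m (Poly_Mapping.lookup G m))"
    by (simp flip: mpoly_eq_sum_single)
  then show ?thesis
    unfolding sum_product mult_single using assms
    by (auto simp: coeffs_in_def[of k F] coeffs_in_def[of k G] intro!: coeffs_in_sum coeffs_in_single is_subfieldD(4))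
qed

lemma coeffs_in_const: "is_subfield k \<Longrightarrow> a \<in> k \<Longrightarrow> coeffs_in k (mp_const a)"
  unfolding mp_const_def by (rule coeffs_in_single)

lemma coeffs_in_power: "is_subfield k \<Longrightarrow> coeffs_in k F \<Longrightarrow> coeffs_in k (F ^ e)"
  by (induction e) (auto intro: coeffs_in_mult coeffs_in_const[of k 1, simplified] is_subfieldD(2))

lemma coeffs_in_prod: "is_subfield k \<Longrightarrow> (\<And>a. a \<in> A \<Longrightarrow> coeffs_in k (f a)) \<Longrightarrow> coeffs_in k (\<Prod>a\<in>A. f a)"
  by (induction A rule: infinite_finite_induct)
     (auto intro: coeffs_in_mult coeffs_in_const[of k 1, simplified] is_subfieldD(2))

lemma coeffs_in_subst:
  assumes k: "is_subfield k" and "coeffs_in k F" "\<And>i. coeffs_in k (\<sigma> i)"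
  shows "coeffs_in k (mp_subst \<sigma> F)"
  unfolding mp_subst_def
proof (intro coeffs_in_sum[OF k] coeffs_in_mult[OF k] coeffs_in_prod[OF k] coeffs_in_power[OF k] coeffs_in_const[OF k] assms(3))
  show "Poly_Mapping.lookup F m \<in> k" for m using assms(2) by (simp add: coeffs_in_def)
qed

text \<open>The lift of the endomorphism from lines to coordinate vectors, where scalar factors can
  be followed through the iterates.\<close>

definition endo_vec :: "('n::finite \<Rightarrow> 'n mpoly) \<Rightarrow> complex ^ 'n \<Rightarrow> complex ^ 'n" where
  "endo_vec \<phi> x = (\<chi> i. mp_eval (\<phi> i) x)"

lemma endo_vec_nth: "endo_vec \<phi> x $ i = mp_eval (\<phi> i) x"
  by (simp add: endo_vec_def)

lemma mp_eval_endo_iter: "mp_eval (endo_iter \<phi> n i) x = (endo_vec \<phi> ^^ n) x $ i"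
proof (induction n arbitrary: i)
  case (Suc n)
  have "(\<chi> j. mp_eval (endo_iter \<phi> n j) x) = (endo_vec \<phi> ^^ n) x" by (simp add: Suc vec_eq_iff)
  then show ?case by (simp add: mp_eval_subst endo_vec_nth)
qed simp

lemma homogeneous_endo_iter:
  assumes "\<And>i. homogeneous d (\<phi> i)"
  shows "homogeneous (d ^ n) (endo_iter \<phi> n i)"
proof (induction n arbitrary: i)
  case (Suc n)
  show ?case using homogeneous_subst[of d "\<phi> i" "d ^ n" "endo_iter \<phi> n"] assms Suc by (simp add: mult.commute)
qed simp

lemma coeffs_in_endo_iter:
  assumes k: "is_subfield k" and "\<And>i. coeffs_in k (\<phi> i)"
  shows "coeffs_in k (endo_iter \<phi> n i)"
proof (induction n arbitrary: i)
  case 0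
  show ?case unfolding endo_iter.simps mp_var_def by (rule coeffs_in_single[OF k is_subfieldD(2)[OF k]])
next
  case (Suc n)
  show ?case unfolding endo_iter.simps by (rule coeffs_in_subst[OF k assms(2) Suc])
qed

lemma proj_point_cong: "c \<noteq> 0 \<Longrightarrow> proj_point (c *s x) = proj_point x"
proof -
  assume c: "c \<noteq> 0"
  have "proj_point (a *s y) \<subseteq> proj_point y" if "a \<noteq> 0" for a and y :: "complex ^ 'n"
  proof
    fix w assume "w \<in> proj_point (a *s y)"
    then obtain b where "b \<noteq> 0" "w = b *s (a *s y)" by (auto simp: proj_point_def)
    then show "w \<in> proj_point y"
      using that unfolding proj_point_def by (intro CollectI exI[of _ "b * a"]) simp
  qed
  from this[OF c, of x] this[of "inverse c" "c *s x"] show ?thesis using c by auto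
qed

lemma self_in_proj_point: "x \<in> proj_point x"
  unfolding proj_point_def by (intro CollectI exI[of _ 1]) simp

lemma endo_vec_scale:
  assumes "\<And>i. homogeneous d (\<phi> i)"
  shows "endo_vec \<phi> (c *s x) = c ^ d *s endo_vec \<phi> x"
  by (simp add: endo_vec_def vec_eq_iff mp_eval_homogeneous[OF assms])

lemma endo_map_proj_point:
  assumes "\<And>i. homogeneous d (\<phi> i)"
  shows "endo_map \<phi> (proj_point x) = proj_point (endo_vec \<phi> x)"
proof -
  have "proj_point (endo_vec \<phi> y) = proj_point (endo_vec \<phi> x)" if "y \<in> proj_point x" for y
  proof -
    from that obtain c where "y = c *s x" "c \<noteq> 0" by (auto simp: proj_point_def)
    then show ?thesis by (simp add: endo_vec_scale[OF assms] proj_point_cong)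
  qed
  then show ?thesis
    unfolding endo_map_def endo_vec_def[symmetric] using self_in_proj_point[of x] by blast
qed

lemma endo_map_iter_proj_point:
  assumes "\<And>i. homogeneous d (\<phi> i)"
  shows "(endo_map \<phi> ^^ m) (proj_point x) = proj_point ((endo_vec \<phi> ^^ m) x)"
  by (induction m) (simp_all add: endo_map_proj_point[OF assms])

section \<open>Coprime integral coordinates\<close>

lemma primitive_multiple_int:
  fixes w :: "'n::finite \<Rightarrow> int"
  assumes "w i \<noteq> 0"
  shows "\<exists>g z. g \<noteq> 0 \<and> primitive z \<and> (\<forall>i. w i = g * z i)"
proof -
  define g where "g = Gcd (range w)"
  have g0: "g \<noteq> 0" using assms by (auto simp: g_def)
  have "g dvd w i" for i unfolding g_def by (rule Gcd_dvd) simp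
  then obtain z where z: "\<And>i. w i = g * z i" unfolding dvd_def by metis
  have "primitive z"
    unfolding primitive_def
  proof (intro allI impI, rule ccontr)
    fix p :: int assume p: "Factorial_Ring.prime p" "\<nexists>i. \<not> p dvd z i"
    then have "g * p dvd w i" for i by (simp add: z)
    then have "g * p dvd g" unfolding g_def by (intro Gcd_greatest) auto
    then have "p dvd 1" using g0 by simp
    then show False using p(1) not_prime_unit by blast
  qed
  then show ?thesis using z g0 by blast
qed

lemma primitive_multiple_rat:
  fixes x :: "complex ^ 'n::finite"
  assumes "x \<noteq> 0" "\<And>i. x $ i \<in> \<rat>"
  shows "\<exists>c z. c \<noteq> 0 \<and> primitive z \<and> x = c *s int_vec z"
proof -
  obtain A where A: "A > 0" "\<And>i. of_int A * x $ i \<in> \<int>"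
    using Rats_finite_common_denominator[of UNIV "\<lambda>i. x $ i"] assms(2) by auto
  have "\<forall>i. \<exists>w. of_int A * x $ i = of_int w" using A(2) by (metis Ints_cases)
  then obtain w where w: "\<And>i. of_int A * x $ i = of_int (w i)" by metis
  obtain i where "x $ i \<noteq> 0" using assms(1) by (auto simp: vec_eq_iff)
  then have "w i \<noteq> 0" using w[of i] A(1) by auto
  then obtain g z where g: "g \<noteq> 0" "primitive z" "\<And>i. w i = g * z i" using primitive_multiple_int by metis
  have "x = (of_int g / of_int A) *s int_vec z"
    using w g(3) A(1) by (simp add: vec_eq_iff field_simps)
  then show ?thesis using g(1,2) A(1) by (intro exI[of _ "of_int g / of_int A"] exI[of _ z]) auto
qed

text \<open>Up to a fixed denominator, the image vector of \<open>z\<close> is a bounded integer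
  times coprime coordinates \<open>z'\<close>, by \<open>bounded_common_factor\<close>. Integrality
  bounds \<open>F\<close> at \<open>z'\<close>, and homogeneity carries the bound back.\<close>

lemma pullback_bounded_at_integral_points:
  fixes \<psi> :: "'n::finite \<Rightarrow> 'n mpoly"
  assumes zero: "\<And>x. (\<forall>i. mp_eval (\<psi> i) x = 0) \<Longrightarrow> x = 0"
    and hom: "\<And>i. homogeneous q (\<psi> i)" and rat: "\<And>i. coeffs_in \<rat> (\<psi> i)"
    and F: "homogeneous e F" "F \<noteq> 0" "coeffs_in \<int> F" and T: "integral_set \<rat> (arch_places \<rat>) F T"
  shows "\<exists>B. \<forall>z. primitive z \<and> proj_point (\<chi> i. mp_eval (\<psi> i) (int_vec z)) \<in> T \<longrightarrow>
    mp_eval (mp_subst \<psi> F) (int_vec z) \<noteq> 0 \<and> cmod (mp_eval (mp_subst \<psi> F) (int_vec z)) \<le> B"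
proof -
  define J where "J = (SIGMA i:UNIV. Poly_Mapping.keys (\<psi> i))"
  have finJ: "finite J" unfolding J_def by auto
  have rat': "(case u of (i, m) \<Rightarrow> Poly_Mapping.lookup (\<psi> i) m) \<in> \<rat>" for u
    using rat by (cases u) (simp add: coeffs_in_def)
  obtain D where D: "D > 0" "\<forall>u\<in>J. of_int D * (case u of (i, m) \<Rightarrow> Poly_Mapping.lookup (\<psi> i) m) \<in> \<int>"
    using Rats_finite_common_denominator[OF finJ, of "\<lambda>(i, m). Poly_Mapping.lookup (\<psi> i) m", OF rat'] by (elim exE conjE)
  \<comment> \<open>Clearing denominators gives integral values; since \<open>D \<ge> 1\<close>,
    undoing the scaling does not increase absolute values.\<close>
  define \<psi>' where "\<psi>' i = mp_const (of_int D) * \<psi> i" for i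
  have int: "coeffs_in \<int> (\<psi>' i)" for i
    unfolding coeffs_in_def \<psi>'_def lookup_mp_const_mult
  proof
    fix m show "of_int D * Poly_Mapping.lookup (\<psi> i) m \<in> \<int>"
      using D(2)[rule_format, of "(i, m)"] by (cases "m \<in> Poly_Mapping.keys (\<psi> i)") (auto simp: J_def in_keys_iff)
  qed
  have ev: "mp_eval (\<psi>' i) x = of_int D * mp_eval (\<psi> i) x" for i x by (simp add: \<psi>'_def mp_eval_mult)
  have "\<exists>A>0. \<forall>z c. (\<forall>p. Factorial_Ring.prime p \<longrightarrow> (\<exists>i. \<not> p dvd z i)) \<and>
      (\<forall>i. \<exists>w. mp_eval (\<psi>' i) (int_vec z) = of_int (c * w)) \<longrightarrow> c dvd (A :: int)"
  proof (rule bounded_common_factor)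
    show "x = 0" if "\<forall>i. mp_eval (\<psi>' i) x = 0" for x
      using that D(1) by (intro zero) (simp add: ev)
    show "homogeneous q (\<psi>' i)" for i unfolding \<psi>'_def by (rule homogeneous_const_mult[OF hom])
    show "coeffs_in \<rat> (\<psi>' i)" for i using int[of i] Ints_subset_Rats by (auto simp: coeffs_in_def)
  qed
  then obtain A :: int where A: "A > 0"
    "\<And>z c. primitive z \<Longrightarrow> (\<forall>i. \<exists>w. mp_eval (\<psi>' i) (int_vec z) = of_int (c * w)) \<Longrightarrow> c dvd A"
    unfolding primitive_def by blast
  obtain B where B: "\<And>z. primitive z \<Longrightarrow> proj_point (int_vec z) \<in> T \<Longrightarrow>
      mp_eval F (int_vec z) \<noteq> 0 \<and> cmod (mp_eval F (int_vec z)) \<le> B"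
    using integral_set_bounded[OF F T] by blast
  show ?thesis
  proof (intro exI[of _ "of_int A ^ e * B"] allI impI; elim conjE)
    fix z assume z: "primitive z" and zT: "proj_point (\<chi> i. mp_eval (\<psi> i) (int_vec z)) \<in> T"
    define y where "y = (\<chi> i. mp_eval (\<psi> i) (int_vec z))"
    have "\<forall>i. \<exists>w. mp_eval (\<psi>' i) (int_vec z) = of_int w"
      using mp_eval_int_vec_Ints[OF int] by (metis Ints_cases)
    then obtain w where w: "\<And>i. mp_eval (\<psi>' i) (int_vec z) = of_int (w i)" by metis
    have "int_vec z \<noteq> 0" using primitive_nonzero[OF z] by (auto simp: vec_eq_iff)
    then obtain i where "mp_eval (\<psi> i) (int_vec z) \<noteq> 0" using zero by blast
    then have "w i \<noteq> 0" using w[of i] D(1) by (auto simp: ev)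
    then obtain g z' where g: "g \<noteq> 0" "primitive z'" "\<And>i. w i = g * z' i" using primitive_multiple_int by metis
    have "g dvd A" by (rule A(2)[OF z]) (use w g(3) in auto)
    then have gA: "\<bar>g\<bar> \<le> A" using dvd_imp_le_int[of A g] A(1) by simp
    have Dy: "of_int D *s y = of_int g *s int_vec z'"
      using w g(3) by (simp add: vec_eq_iff y_def ev)
    have "proj_point (int_vec z') = proj_point (of_int D *s y)"
      unfolding Dy using g(1) by (simp add: proj_point_cong)
    also have "\<dots> = proj_point y" using D(1) by (simp add: proj_point_cong)
    finally have "proj_point (int_vec z') \<in> T" using zT by (simp add: y_def)
    from B[OF g(2) this] have Fz: "mp_eval F (int_vec z') \<noteq> 0" "cmod (mp_eval F (int_vec z')) \<le> B" by auto
    have R: "mp_eval (mp_subst \<psi> F) (int_vec z) = mp_eval F y" by (simp add: mp_eval_subst y_def)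
    have eq: "of_int D ^ e * mp_eval F y = of_int g ^ e * mp_eval F (int_vec z')"
      using arg_cong[OF Dy, of "mp_eval F"] by (simp add: mp_eval_homogeneous[OF F(1)])
    then have "mp_eval F y \<noteq> 0" using Fz(1) g(1) by auto
    moreover have "cmod (mp_eval F y) \<le> of_int A ^ e * B"
    proof -
      have "1 * cmod (mp_eval F y) \<le> of_int D ^ e * cmod (mp_eval F y)"
        using D(1) by (intro mult_right_mono) (auto intro: one_le_power)
      also have "\<dots> = cmod (of_int D ^ e * mp_eval F y)" using D(1) by (simp add: norm_mult norm_power)
      also have "\<dots> = \<bar>of_int g\<bar> ^ e * cmod (mp_eval F (int_vec z'))" unfolding eq by (simp add: norm_mult norm_power)
      also have "\<dots> \<le> of_int A ^ e * B"
        using gA Fz(2) A(1) by (intro mult_mono power_mono) (auto simp: of_int_abs[symmetric] simp del: of_int_abs)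
      finally show ?thesis by simp
    qed
    ultimately show "mp_eval (mp_subst \<psi> F) (int_vec z) \<noteq> 0 \<and> cmod (mp_eval (mp_subst \<psi> F) (int_vec z)) \<le> of_int A ^ e * B"
      by (simp add: R)
  qed
qed

text \<open>Northcott's finiteness property for integral vectors.\<close>

lemma finite_max_abs_le: "finite {z :: 'n::finite \<Rightarrow> int. max_abs z \<le> C}"
proof (rule finite_subset)
  show "{z :: 'n \<Rightarrow> int. max_abs z \<le> C} \<subseteq> PiE UNIV (\<lambda>_. {- \<lfloor>C\<rfloor>..\<lfloor>C\<rfloor>})"
  proof
    fix z :: "'n \<Rightarrow> int" assume "z \<in> {z. max_abs z \<le> C}"
    then have "\<bar>real_of_int (z i)\<bar> \<le> C" for i using abs_le_max_abs[of z i] by simp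
    then have "\<bar>z i\<bar> \<le> \<lfloor>C\<rfloor>" for i by (simp add: le_floor_iff)
    then show "z \<in> PiE UNIV (\<lambda>_. {- \<lfloor>C\<rfloor>..\<lfloor>C\<rfloor>})" by (auto simp: PiE_def extensional_def abs_le_iff minus_le_iff)
  qed
  show "finite (PiE (UNIV :: 'n set) (\<lambda>_. {- \<lfloor>C\<rfloor>..\<lfloor>C\<rfloor>}))" by (rule finite_PiE) auto
qed

text \<open>The sum over the archimedean places is \<open>deg G\<close> times the height up to a bounded error, so
  Vojta's inequality bounds the height outside its exceptional set.\<close>

lemma vojta_bounds_height:
  fixes E K R :: "'n::finite mpoly"
  assumes E: "nc_subdivisor E0 E" and deg: "mp_degree E > CARD('n)" and vojta: "vojta_conjecture E"
    and EK: "E * K = R" and RQ: "coeffs_in \<rat> R"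
  shows "\<exists>\<Z> C. finite \<Z> \<and> (\<forall>Z\<in>\<Z>. hypersurface Z) \<and>
    (\<forall>z. primitive z \<and> mp_eval R (int_vec z) \<noteq> 0 \<and> cmod (mp_eval R (int_vec z)) \<le> B \<and>
       proj_point (int_vec z) \<notin> \<Union>\<Z> \<longrightarrow> max_abs z \<le> C)"
proof -
  obtain G0 where G0: "same_divisor E G0" "coeffs_in {a. Polynomial.algebraic a} G0"
    and E0: "E \<noteq> 0" "\<exists>e. homogeneous e E"
    using E by (auto simp: nc_subdivisor_def defined_over_def divisor_equation_def)
  then obtain e where e: "homogeneous e E" by blast
  define A where "A = insert \<i> (Poly_Mapping.lookup G0 ` Poly_Mapping.keys G0)"
  have "finite A" by (simp add: A_def)
  moreover have "Polynomial.algebraic a" if "a \<in> A" for a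
    using that G0(2) algebraic_int_imp_algebraic[OF algebraic_int_ii] by (auto simp: A_def coeffs_in_def)
  ultimately obtain \<theta> where \<theta>: "Polynomial.algebraic \<theta>" "A \<subseteq> adj \<theta>" using primitive_element by blast
  obtain f where f: "is_minpoly f \<theta>" using is_minpoly_exists[OF \<theta>(1)] by blast
  have k: "is_subfield (adj \<theta>)" by (rule is_subfield_adj[OF \<theta>(1)])
  have i: "\<i> \<in> adj \<theta>" using \<theta>(2) by (simp add: A_def)
  have nf: "number_field (adj \<theta>)" by (rule number_field_adj[OF \<theta>(1)])
  have "Poly_Mapping.lookup G0 m \<in> adj \<theta>" for m
    using \<theta>(2) is_subfieldD(1)[OF k] by (cases "m \<in> Poly_Mapping.keys G0") (auto simp: A_def in_keys_iff)
  then have "defined_over (adj \<theta>) E" using G0(1) by (auto simp: defined_over_def coeffs_in_def)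
  with vojta nf obtain G where G: "same_divisor E G" "coeffs_in (ring_of_integers (adj \<theta>)) G"
    and V: "\<And>S \<epsilon>. finite S \<Longrightarrow> S \<subseteq> places (adj \<theta>) \<Longrightarrow> \<epsilon> > 0 \<Longrightarrow>
         (\<exists>\<Z> C. finite \<Z> \<and> (\<forall>Z\<in>\<Z>. hypersurface Z) \<and>
             (\<forall>x\<in>coord_vectors (adj \<theta>). proj_point x \<notin> \<Union>\<Z> \<longrightarrow>
               (\<Sum>v\<in>S. local_height (adj \<theta>) v G x)
                 < ereal ((real CARD('n) + \<epsilon>) * weil_height (adj \<theta>) x + C)))"
    unfolding vojta_conjecture_def by metis
  define S where "S = arch_places (adj \<theta>)"
  have finS: "finite S" and S0: "S \<noteq> {}"
    unfolding S_def using finite_arch_places[OF f k i] arch_places_nonempty[OF f k i] by auto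
  have Sp: "S \<subseteq> places (adj \<theta>)" by (simp add: S_def places_def)
  \<comment> \<open>Since \<open>mp_degree G \<ge> CARD('n) + 1\<close>, the choice 1/2 leaves at
    least half of the height as a surplus on the left side.\<close>
  obtain \<Z> C where Z: "finite \<Z>" "\<forall>Z\<in>\<Z>. hypersurface Z"
    and VC: "\<forall>x\<in>coord_vectors (adj \<theta>). proj_point x \<notin> \<Union>\<Z> \<longrightarrow>
               (\<Sum>v\<in>S. local_height (adj \<theta>) v G x) < ereal ((real CARD('n) + 1 / 2) * weil_height (adj \<theta>) x + C)"
    using V[OF finS Sp half_gt_zero[OF zero_less_one]] by (elim exE conjE)
  obtain c where c: "c \<noteq> 0" "G = mp_const c * E" using G(1) by (auto simp: same_divisor_def)
  have Gk: "coeffs_in (adj \<theta>) G" using G(2) by (auto simp: coeffs_in_def ring_of_integers_def)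
  have GK: "G * (mp_const (1 / c) * K) = R"
  proof -
    have "G * (mp_const (1 / c) * K) = mp_const (c * (1 / c)) * (E * K)"
      unfolding c(2) mp_const_mult by (simp only: mult_ac)
    then show ?thesis using c(1) EK by simp
  qed
  have degG: "mp_degree G = mp_degree E"
    unfolding mp_degree_def c(2) keys_mp_const_mult[OF c(1)] ..
  \<comment> \<open>The common exponent of the archimedean places: local degree 2 over the degree of
    the field.\<close>
  define r where "r = 2 / real (field_degree (adj \<theta>))"
  have r0: "r > 0" unfolding r_def using field_degree_pos[OF nf] by simp
  have r: "real (local_degree (adj \<theta>) v) / real (field_degree (adj \<theta>)) = r" if "v \<in> S" for v
  proof -
    obtain \<rho> where "\<rho> \<in> roots_ii \<theta> f" "v = emb_place \<theta> \<rho>"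
      using \<open>v \<in> S\<close> bij_betw_emb_place[OF f k i] unfolding S_def bij_betw_def by blast
    then show ?thesis using local_degree_emb_place[OF f k i] by (simp add: r_def)
  qed
  obtain C1 where C1: "\<And>z. mp_eval R (int_vec z) \<noteq> 0 \<Longrightarrow> cmod (mp_eval R (int_vec z)) \<le> B \<Longrightarrow>
      (\<Prod>v\<in>S. v (mp_eval G (int_vec z))) \<le> C1"
    using prod_arch_places_bounded[OF f k i GK Gk RQ, of B] unfolding S_def by blast
  define s where "s = real (card S)"
  have s0: "s > 0" unfolding s_def using finS S0 by (simp add: card_gt_0_iff)
  \<comment> \<open>For \<open>h = ln (max_abs z)\<close> Vojta's inequality will give
    \<open>r * s * h / 2 < C + r * ln C1\<close>.\<close>
  define C2 where "C2 = exp (2 * (C + r * ln C1) / (r * s))"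
  show ?thesis
  proof (intro exI[of _ \<Z>] exI[of _ C2] conjI allI impI Z; (elim conjE)?)
    fix z assume z: "primitive z" and Rz: "mp_eval R (int_vec z) \<noteq> 0" "cmod (mp_eval R (int_vec z)) \<le> B"
      and nZ: "proj_point (int_vec z) \<notin> \<Union>\<Z>"
    define h where "h = ln (max_abs z)"
    have h0: "h \<ge> 0" unfolding h_def using max_abs_ge_1[OF z] by simp
    have zk: "int_vec z \<in> coord_vectors (adj \<theta>)"
    proof -
      have "int_vec z \<noteq> 0" using primitive_nonzero[OF z] by (auto simp: vec_eq_iff)
      moreover have "of_int a \<in> adj \<theta>" for a using Rats_subset_adj[of \<theta>] by auto
      ultimately show ?thesis by (simp add: coord_vectors_def)
    qed
    define \<gamma> where "\<gamma> = mp_eval G (int_vec z)"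
    have \<gamma>0: "\<gamma> \<noteq> 0" using Rz(1) unfolding \<gamma>_def GK[symmetric] by (auto simp: mp_eval_mult)
    have \<gamma>k: "\<gamma> \<in> adj \<theta>"
      unfolding \<gamma>_def using Rats_subset_adj[of \<theta>] by (intro mp_eval_in_subfield[OF k Gk]) auto
    have v\<gamma>: "v \<gamma> > 0" if "v \<in> S" for v
    proof -
      have av: "absolute_value_on (adj \<theta>) v" using that by (simp add: S_def arch_places_def)
      show ?thesis using absolute_value_onD(1,2)[OF av k \<gamma>k] \<gamma>0 by simp
    qed
    have "(\<Sum>v\<in>S. local_height (adj \<theta>) v G (int_vec z)) = (\<Sum>v\<in>S. ereal (real (mp_degree G) * r * h - r * ln (v \<gamma>)))"
    proof (rule sum.cong[OF refl])
      fix v assume v: "v \<in> S"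
      show "local_height (adj \<theta>) v G (int_vec z) = ereal (real (mp_degree G) * r * h - r * ln (v \<gamma>))"
        unfolding h_def \<gamma>_def using v\<gamma>[OF v] \<gamma>0 v
        by (intro local_height_arch[OF z _ r[OF v]]) (auto simp: S_def \<gamma>_def)
    qed
    also have "\<dots> = ereal (\<Sum>v\<in>S. real (mp_degree G) * r * h - r * ln (v \<gamma>))" by simp
    also have "(\<Sum>v\<in>S. real (mp_degree G) * r * h - r * ln (v \<gamma>)) =
        real (mp_degree G) * r * s * h - r * ln (\<Prod>v\<in>S. v \<gamma>)"
    proof -
      have "ln (\<Prod>v\<in>S. v \<gamma>) = (\<Sum>v\<in>S. ln (v \<gamma>))"
        by (rule ln_prod[OF finS]) (use v\<gamma> in force)
      then show ?thesis by (simp add: sum_subtractf sum_distrib_left s_def mult_ac)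
    qed
    finally have lhs: "(\<Sum>v\<in>S. local_height (adj \<theta>) v G (int_vec z)) =
        ereal (real (mp_degree G) * r * s * h - r * ln (\<Prod>v\<in>S. v \<gamma>))" .
    have rhs: "weil_height (adj \<theta>) (int_vec z) = r * s * h"
      unfolding h_def s_def S_def using finS r by (intro weil_height_primitive[OF z]) (auto simp: S_def)
    have "real (mp_degree G) * r * s * h - r * ln (\<Prod>v\<in>S. v \<gamma>) < (real CARD('n) + 1 / 2) * (r * s * h) + C"
      using VC[rule_format, OF zk nZ] unfolding lhs rhs by simp
    moreover have "(real CARD('n) + 1) * (r * s * h) \<le> real (mp_degree G) * (r * s * h)"
      using deg r0 s0 h0 unfolding degG by (intro mult_right_mono) auto
    moreover have "ln (\<Prod>v\<in>S. v \<gamma>) \<le> ln C1"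
      using C1[OF Rz] v\<gamma> unfolding \<gamma>_def[symmetric] by (intro ln_mono) (auto intro: prod_pos)
    then have "r * ln (\<Prod>v\<in>S. v \<gamma>) \<le> r * ln C1" using r0 by (intro mult_left_mono) auto
    ultimately have "r * s * h < 2 * (C + r * ln C1)" by (simp add: algebra_simps)
    then have "h \<le> 2 * (C + r * ln C1) / (r * s)" using r0 s0 by (simp add: field_simps)
    then have "exp h \<le> C2" unfolding C2_def by simp
    then show "max_abs z \<le> C2" unfolding h_def using max_abs_ge_1[OF z] by simp
  qed
qed

section \<open>Forms vanishing on exceptional sets, and Zariski density\<close>

lemma point_in_hyperplane:
  fixes y :: "complex ^ 'n::finite"
  assumes "CARD('n) \<ge> 2" "y \<noteq> 0"
  shows "\<exists>H e. H \<noteq> 0 \<and> homogeneous e H \<and> mp_eval H y = 0"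
proof -
  obtain i where i: "y $ i \<noteq> 0" using assms(2) by (auto simp: vec_eq_iff)
  have "card (UNIV - {i}) \<noteq> 0" using assms(1) by (simp add: card_Diff_singleton)
  then obtain j where j: "j \<noteq> i" by (metis Diff_iff UNIV_I card_eq_0_iff ex_in_conv insertI1 singletonD)
  \<comment> \<open>A 2 x 2 minor of the coordinates of \<open>x\<close> and \<open>y\<close>; it is
    a nonzero form because \<open>y $ i\<close> is nonzero.\<close>
  define H where "H = mp_const (y $ i) * mp_var j - mp_const (y $ j) * mp_var i"
  have ev: "mp_eval H x = y $ i * x $ j - y $ j * x $ i" for x by (simp add: H_def mp_eval_diff mp_eval_mult)
  have "mp_eval H (\<chi> l. if l = j then 1 else 0) \<noteq> 0" unfolding ev using i j by simp
  then have "H \<noteq> 0" by auto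
  moreover have "homogeneous (Suc 0) H"
    unfolding H_def by (intro homogeneous_diff homogeneous_const_mult homogeneous_var)
  moreover have "mp_eval H y = 0" by (simp add: ev)
  ultimately show ?thesis by blast
qed

text \<open>A nonzero form misses some point of projective space, so its zero set is a proper closed
  subset.\<close>

lemma not_zariski_denseI:
  fixes H :: "'n::finite mpoly"
  assumes H: "H \<noteq> 0" "homogeneous e H" and T: "\<And>Q. Q \<in> T \<Longrightarrow> \<exists>y. y \<noteq> 0 \<and> Q = proj_point y \<and> mp_eval H y = 0"
  shows "\<not> zariski_dense T"
proof
  assume dense: "zariski_dense T"
  define Z where "Z = {P \<in> proj_space. \<forall>H\<in>{H}. vanishes_at H P}"
  have "zariski_closed Z" unfolding zariski_closed_def Z_def using H(2) by blast
  moreover have "T \<subseteq> Z"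
  proof
    fix Q assume "Q \<in> T"
    then obtain y where y: "y \<noteq> 0" "Q = proj_point y" "mp_eval H y = 0" using T by blast
    then show "Q \<in> Z"
      unfolding Z_def proj_space_def vanishes_at_def by (auto simp: proj_point_def mp_eval_homogeneous[OF H(2)])
  qed
  ultimately have "Z = proj_space" using dense by (simp add: zariski_dense_def)
  obtain x :: "complex ^ 'n" where x: "\<And>i. x $ i \<noteq> 0" "mp_eval H x \<noteq> 0" using exists_nonvanishing[OF H(1) H(1)] by blast
  have "x \<noteq> 0" using x(1) by (auto simp: vec_eq_iff)
  then have "proj_point x \<in> Z" unfolding \<open>Z = proj_space\<close> proj_space_def by blast
  then show False using x(2) self_in_proj_point[of x] by (auto simp: Z_def vanishes_at_def)
qed

lemma finite_points_in_hypersurface: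
  fixes Y :: "(complex ^ 'n::finite) set"
  assumes "CARD('n) \<ge> 2" "finite Y" "0 \<notin> Y"
  shows "\<exists>H e. H \<noteq> 0 \<and> homogeneous e H \<and> (\<forall>y\<in>Y. mp_eval H y = 0)"
proof -
  have "\<forall>y\<in>Y. \<exists>H e. H \<noteq> 0 \<and> homogeneous e H \<and> mp_eval H y = 0"
  proof
    fix y assume "y \<in> Y"
    then have "y \<noteq> 0" using assms(3) by metis
    then show "\<exists>H e. H \<noteq> 0 \<and> homogeneous e H \<and> mp_eval H y = 0" by (rule point_in_hyperplane[OF assms(1)])
  qed
  then obtain H e where H: "\<And>y. y \<in> Y \<Longrightarrow> H y \<noteq> 0" "\<And>y. y \<in> Y \<Longrightarrow> homogeneous (e y) (H y)"
    "\<And>y. y \<in> Y \<Longrightarrow> mp_eval (H y) y = 0" by metis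
  have "(\<Prod>y\<in>Y. H y) \<noteq> 0" by (rule mpoly_prod_nonzero[OF H(1)])
  moreover have "homogeneous (\<Sum>y\<in>Y. e y) (\<Prod>y\<in>Y. H y)" by (rule homogeneous_prod[OF H(2)])
  moreover have "mp_eval (\<Prod>y\<in>Y. H y) y = 0" if "y \<in> Y" for y
    unfolding mp_eval_prod using assms(2) that H(3) by (intro prod_zero) auto
  ultimately show ?thesis by blast
qed

text \<open>The product of the equations works; an empty family yields the constant form 1, which is
  why the degree may be 0.\<close>

lemma finite_union_hypersurfaces:
  fixes \<Z> :: "(complex ^ 'n::finite) set set set"
  assumes "finite \<Z>" "\<And>Z. Z \<in> \<Z> \<Longrightarrow> hypersurface Z"
  shows "\<exists>H e. H \<noteq> 0 \<and> homogeneous e H \<and> (\<forall>y. proj_point y \<in> \<Union>\<Z> \<longrightarrow> mp_eval H y = 0)"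
proof -
  have "\<forall>Z\<in>\<Z>. \<exists>H e. H \<noteq> 0 \<and> homogeneous e H \<and> Z = {P \<in> proj_space. vanishes_at H P}"
    using assms(2) unfolding hypersurface_def by blast
  then obtain H e where H: "\<And>Z. Z \<in> \<Z> \<Longrightarrow> H Z \<noteq> 0" "\<And>Z. Z \<in> \<Z> \<Longrightarrow> homogeneous (e Z) (H Z)"
    "\<And>Z. Z \<in> \<Z> \<Longrightarrow> Z = {P \<in> proj_space. vanishes_at (H Z) P}" by metis
  have "(\<Prod>Z\<in>\<Z>. H Z) \<noteq> 0" by (rule mpoly_prod_nonzero[OF H(1)])
  moreover have "homogeneous (\<Sum>Z\<in>\<Z>. e Z) (\<Prod>Z\<in>\<Z>. H Z)" by (rule homogeneous_prod[OF H(2)])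
  moreover have "mp_eval (\<Prod>Z\<in>\<Z>. H Z) y = 0" if "proj_point y \<in> \<Union>\<Z>" for y
  proof -
    from that obtain Z where Z: "Z \<in> \<Z>" "proj_point y \<in> Z" by blast
    then have "vanishes_at (H Z) (proj_point y)" using H(3)[OF Z(1)] by blast
    then have "mp_eval (H Z) y = 0" using self_in_proj_point[of y] by (simp add: vanishes_at_def)
    then show ?thesis unfolding mp_eval_prod using assms(1) Z(1) by (intro prod_zero) auto
  qed
  ultimately show ?thesis by blast
qed

theorem theorem2:
  fixes N d n :: nat
    and \<phi> :: "'n::finite \<Rightarrow> 'n mpoly"
    and F Dnc :: "'n mpoly"
    and P :: "(complex ^ 'n) set"
    and T :: "(complex ^ 'n) set set"
  assumes "CARD('n) = N + 1" and "N \<ge> 1"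
    and "is_endomorphism d \<phi>" and "\<forall>i. coeffs_in \<rat> (\<phi> i)" and "d \<ge> 2"
    and "divisor_equation F" and "coeffs_in \<int> F"
    and "nc_part (mp_subst (endo_iter \<phi> n) F) Dnc"
    and "mp_degree Dnc > N + 1"
    and "vojta_conjecture Dnc"
    and "P \<in> points_over \<rat>"
    and "integral_set \<rat> (arch_places \<rat>) F T"
  shows "\<not> zariski_dense (forward_orbit \<phi> P \<inter> T)"
proof -
  have hom: "\<And>i. homogeneous d (\<phi> i)" and zero: "\<And>x. \<forall>i. mp_eval (\<phi> i) x = 0 \<Longrightarrow> x = 0"
    using assms(3) unfolding is_endomorphism_def by blast+
  have phiQ: "\<And>i. coeffs_in \<rat> (\<phi> i)" using assms(4) by blast
  obtain e where F: "F \<noteq> 0" "homogeneous e F" using assms(6) unfolding divisor_equation_def by blast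
  define \<psi> where "\<psi> = endo_iter \<phi> n"
  define \<Phi> where "\<Phi> m = endo_vec \<phi> ^^ m" for m
  have \<psi>_eval: "(\<chi> i. mp_eval (\<psi> i) x) = \<Phi> n x" for x
    by (simp add: \<psi>_def \<Phi>_def mp_eval_endo_iter vec_eq_iff)
  have \<Phi>0: "x = 0" if "\<Phi> m x = 0" for m x
    using that
  proof (induction m)
    case (Suc m)
    have "\<forall>i. mp_eval (\<phi> i) (\<Phi> m x) = 0"
      using Suc.prems by (simp add: \<Phi>_def vec_eq_iff endo_vec_nth)
    then show ?case using zero Suc.IH by blast
  qed (simp add: \<Phi>_def)
  have hom\<psi>: "homogeneous (d ^ n) (\<psi> i)" for i unfolding \<psi>_def by (rule homogeneous_endo_iter[OF hom])
  have \<psi>Q: "coeffs_in \<rat> (\<psi> i)" for i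
    unfolding \<psi>_def by (rule coeffs_in_endo_iter[OF is_subfield_Rats phiQ])
  have \<psi>0: "x = 0" if "\<forall>i. mp_eval (\<psi> i) x = 0" for x
    by (rule \<Phi>0[of n]) (simp add: that vec_eq_iff flip: \<psi>_eval)
  define R where "R = mp_subst \<psi> F"
  have RQ: "coeffs_in \<rat> R"
    unfolding R_def using assms(7) Ints_subset_Rats
    by (intro coeffs_in_subst[OF is_subfield_Rats _ \<psi>Q]) (auto simp: coeffs_in_def)
  have "\<exists>B. \<forall>z. primitive z \<and> proj_point (\<chi> i. mp_eval (\<psi> i) (int_vec z)) \<in> T \<longrightarrow>
      mp_eval R (int_vec z) \<noteq> 0 \<and> cmod (mp_eval R (int_vec z)) \<le> B"
    unfolding R_def
    by (rule pullback_bounded_at_integral_points[OF _ hom\<psi> \<psi>Q F(2,1) assms(7,12)]) (rule \<psi>0)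
  then obtain B where B: "\<And>z. primitive z \<Longrightarrow> proj_point (\<chi> i. mp_eval (\<psi> i) (int_vec z)) \<in> T \<Longrightarrow>
      mp_eval R (int_vec z) \<noteq> 0 \<and> cmod (mp_eval R (int_vec z)) \<le> B"
    by blast
  have nc: "nc_subdivisor R Dnc" using assms(8) by (simp add: nc_part_def R_def \<psi>_def)
  then obtain K where K: "Dnc * K = R" unfolding nc_subdivisor_def dvd_def by blast
  have deg: "mp_degree Dnc > CARD('n)" using assms(1,9) by simp
  obtain \<Z> C where Z: "finite \<Z>" "\<forall>Z\<in>\<Z>. hypersurface Z"
    and VC: "\<forall>z. primitive z \<and> mp_eval R (int_vec z) \<noteq> 0 \<and> cmod (mp_eval R (int_vec z)) \<le> B \<and>
       proj_point (int_vec z) \<notin> \<Union>\<Z> \<longrightarrow> max_abs z \<le> C"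
    using vojta_bounds_height[OF nc deg assms(10) K RQ, of B] by (elim exE conjE)
  have "\<exists>H e. H \<noteq> 0 \<and> homogeneous e H \<and> (\<forall>y. proj_point y \<in> \<Union>\<Z> \<longrightarrow> mp_eval H y = 0)"
    by (rule finite_union_hypersurfaces[OF Z(1)]) (use Z(2) in blast)
  then obtain HZ eZ where HZ: "HZ \<noteq> 0" "homogeneous eZ HZ" "\<forall>y. proj_point y \<in> \<Union>\<Z> \<longrightarrow> mp_eval HZ y = 0"
    by (elim exE conjE)
  have q: "d ^ n \<ge> 1" using assms(5) by simp
  \<comment> \<open>Vojta's exceptional set contains points \<open>n\<close> steps earlier in the
    orbit, while density concerns the orbit points themselves; so its image under
    \<open>\<Phi> n\<close> is needed.\<close>
  obtain H1 e1 where H1: "H1 \<noteq> 0" "homogeneous e1 H1" "\<forall>x. mp_eval HZ x = 0 \<longrightarrow> mp_eval H1 (\<Phi> n x) = 0"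
    using hypersurface_image_in_hypersurface[where \<psi> = \<psi>, OF assms(1,2) HZ(1,2) hom\<psi> q] unfolding \<psi>_eval by (elim exE conjE)
  obtain x0 :: "complex ^ 'n" where x0: "P = proj_point x0" "x0 \<noteq> 0" "\<And>i. x0 $ i \<in> \<rat>"
    using assms(11) by (auto simp: points_over_def coord_vectors_def)
  \<comment> \<open>The finitely many remaining points: the first \<open>n\<close> of the orbit, for
    which no point \<open>n\<close> steps earlier is available, and the images of coprime vectors of
    bounded size.\<close>
  define Y where "Y = (\<lambda>m. \<Phi> m x0) ` {..<n} \<union> (\<lambda>z. \<Phi> n (int_vec z)) ` {z. max_abs z \<le> C \<and> primitive z}"
  have iv0: "int_vec z \<noteq> 0" if "primitive z" for z :: "'n \<Rightarrow> int"
    using primitive_nonzero[OF that] by (auto simp: vec_eq_iff)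
  have "finite {z :: 'n \<Rightarrow> int. max_abs z \<le> C \<and> primitive z}"
    by (rule finite_subset[OF _ finite_max_abs_le[of C]]) auto
  then have "finite Y" by (simp add: Y_def)
  moreover have "0 \<notin> Y"
  proof
    assume "0 \<in> Y"
    then consider m where "0 = \<Phi> m x0" | z :: "'n \<Rightarrow> int" where "primitive z" "0 = \<Phi> n (int_vec z)"
      unfolding Y_def by blast
    then show False using \<Phi>0 x0(2) iv0 by cases metis+
  qed
  moreover have "CARD('n) \<ge> 2" using assms(1,2) by simp
  ultimately have "\<exists>H e. H \<noteq> 0 \<and> homogeneous e H \<and> (\<forall>y\<in>Y. mp_eval H y = 0)"
    by (intro finite_points_in_hypersurface)
  then obtain HY eY where HY: "HY \<noteq> 0" "homogeneous eY HY" "\<forall>y\<in>Y. mp_eval HY y = 0"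
    by (elim exE conjE)
  have \<Phi>Q: "\<Phi> m x0 $ i \<in> \<rat>" for m i
  proof (induction m arbitrary: i)
    case (Suc m)
    have "\<Phi> (Suc m) x0 $ i = mp_eval (\<phi> i) (\<Phi> m x0)" by (simp add: \<Phi>_def endo_vec_nth)
    then show ?case using mp_eval_in_subfield[OF is_subfield_Rats phiQ Suc] by simp
  qed (simp add: \<Phi>_def x0(3))
  show ?thesis
  proof (rule not_zariski_denseI)
    show "H1 * HY \<noteq> 0" by (rule mpoly_mult_nonzero[OF H1(1) HY(1)])
    show "homogeneous (e1 + eY) (H1 * HY)" by (rule homogeneous_mult[OF H1(2) HY(2)])
    fix Q assume "Q \<in> forward_orbit \<phi> P \<inter> T"
    then obtain m where QT: "Q \<in> T" and "Q = (endo_map \<phi> ^^ m) P" unfolding forward_orbit_def by blast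
    then have Q: "Q = proj_point (\<Phi> m x0)" unfolding x0(1) \<Phi>_def endo_map_iter_proj_point[OF hom] by simp
    have \<Phi>x0: "\<Phi> l x0 \<noteq> 0" for l using \<Phi>0 x0(2) by blast
    show "\<exists>y. y \<noteq> 0 \<and> Q = proj_point y \<and> mp_eval (H1 * HY) y = 0"
    proof (cases "m < n")
      case True
      then have "mp_eval HY (\<Phi> m x0) = 0" by (intro HY(3)[rule_format]) (simp add: Y_def)
      then show ?thesis using Q \<Phi>x0[of m] by (intro exI[of _ "\<Phi> m x0"]) (simp add: mp_eval_mult)
    next
      case False
      \<comment> \<open>The scalar \<open>c\<close> on the earlier point becomes
        \<open>c ^ d ^ n\<close> on the orbit point and is invisible in projective space.\<close>
      obtain c z where z: "c \<noteq> 0" "primitive z" "\<Phi> (m - n) x0 = c *s int_vec z"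
        using primitive_multiple_rat[OF \<Phi>x0 \<Phi>Q] by blast
      have "\<Phi> m x0 = \<Phi> n (\<Phi> (m - n) x0)"
        using False unfolding \<Phi>_def by (metis comp_apply funpow_add le_add_diff_inverse not_less)
      also have "\<dots> = c ^ d ^ n *s \<Phi> n (int_vec z)"
        unfolding z(3) \<psi>_eval[symmetric] by (simp add: vec_eq_iff mp_eval_homogeneous[OF hom\<psi>])
      finally have Qz: "Q = proj_point (\<Phi> n (int_vec z))"
        unfolding Q using z(1) by (simp add: proj_point_cong)
      then have Rz: "mp_eval R (int_vec z) \<noteq> 0" "cmod (mp_eval R (int_vec z)) \<le> B"
        using B[OF z(2)] QT unfolding \<psi>_eval by auto
      have "mp_eval (H1 * HY) (\<Phi> n (int_vec z)) = 0"
      proof (cases "proj_point (int_vec z) \<in> \<Union>\<Z>")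
        case True
        then have "mp_eval HZ (int_vec z) = 0" using HZ(3) by blast
        then show ?thesis using H1(3) by (simp add: mp_eval_mult)
      next
        case False
        then have "max_abs z \<le> C" using VC z(2) Rz by blast
        then have "\<Phi> n (int_vec z) \<in> Y" unfolding Y_def using z(2) by blast
        then show ?thesis using HY(3) by (simp add: mp_eval_mult)
      qed
      moreover have "\<Phi> n (int_vec z) \<noteq> 0" using \<Phi>0 iv0[OF z(2)] by blast
      ultimately show ?thesis using Qz by blast
    qed
  qed
qed

end
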